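(* Let $0<T<\infty$, $1<p<\infty$, $\frac1p+\frac1{p'}=1$. Let $V$ be a real separable reflexive Banach space and $H$ a real Hilbert space such that $(V,H,V^\ast)$ is a Gelfand triple. (Spaces) Assume there exists a reflexive, separable Banach space $Z$ with a dense continuous embedding $Z\hookrightarrow V$; an increasing sequence $(V_n)_{n\in\mathbb N}$ of finite-dimensional subspaces $V_n\subseteq Z$ such that $\bigcup_{n\in\mathbb N}V_n$ is dense in $V$; and self-adjoint projections $P_n\colon H\to H$ such that $P_n(V)=V_n$ and $\|P_n|_Z\|_{\mathcal L(Z,Z)}\le c$ with a constant $c$ independent of $n\in\mathbb N$. (Operators) Let $\{A(t)\mid 0\le t\le T\}$ be a family of operators $A(t)\colon V\to V^\ast$ such that: (A1) $A(t)\colon V\to V^\ast$ is pseudo-monotone for almost every $t\in[0,T]$. (A2) For every $u\in L^p(0,T;V)\cap L^\infty(0,T;H)$ the mapping $t\mapsto A(t)u(t)$ from $[0,T]$ to $V^\ast$ is Bochner measurable. (A3) There exist a constant $c_1>0$ and a non-negative function $C_2\in L^1((0,T))$ such that $\langle A(t)x,x\rangle_V\ge c_1\|x\|_V^p-C_2(t)$ for almost every $t\in[0,T]$ and all $x\in V$. (A4) There exist $0\le q<\infty$, constants $c_3>0$, $c_4\ge0$ and a non-negative function $C_5\in L^{p'}((0,T))$ such that $\|A(t)x\|_{V^\ast}\le c_3\|x\|_V^{p-1}+c_4\|x\|_H^q\|x\|_V^{p-1}+C_5(t)$ for almost every $t\in[0,T]$ and all $x\in V$. Then for every $u_0\in H$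 and every $f\in L^{p'}(0,T;V^\ast)$ there exists a function $u\in W^1_p(0,T;V,H)$ such that $$\frac{du}{dt}(t)+A(t)u(t)=f(t)\quad\text{in }V^\ast\text{ for a.e. }t\in[0,T],\qquad u(0)=u_0\quad\text{in }H.$$
   Context: All Banach spaces are real, and embeddings are continuous. $X^\ast$ is the dual of $X$ and $\langle\cdot,\cdot\rangle_X$ the duality pairing. $(V,H,V^\ast)$ is a Gelfand triple if $V$ is continuously and densely embedded in $H$; identifying $H\cong H^\ast$ by Riesz gives dense embeddings $V\hookrightarrow H\cong H^\ast\hookrightarrow V^\ast$. An operator $A\colon V\to V^\ast$ is pseudo-monotone if whenever $x_n\rightharpoonup x$ weakly in $V$ and $\limsup_{n\to\infty}\langle Ax_n,x_n-x\rangle_V\le0$, then $\langle Ax,x-y\rangle_V\le\liminf_{n\to\infty}\langle Ax_n,x_n-y\rangle_V$ for all $y\in V$. A function $u\in L^p(0,T;V)$ has generalized derivative $\frac{du}{dt}=g\in L^{q}(0,T;W)$ (where $V\hookrightarrow W$ densely) if $\int_0^T\varphi'(t)u(t)\,dt=-\int_0^T\varphi(t)g(t)\,dt$ for all $\varphi\in C_0^\infty((0,T))$. Set $$W^1_p(0,T;V,H):=\{u\in L^p(0,T;V)\mid \tfrac{du}{dt}\in L^{p'}(0,T;V^\ast)\}.$$ Each element of this space has a continuous representative $[0,T]\to H$, and $u(0)$ refers to this representative. *)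

theory Defs
  imports "HOL-Analysis.Analysis"
begin

section \<open>Banach spaces, duality, embeddings\<close>

text \<open>The dual of \<open>'a\<close> is the type \<open>'a \<Rightarrow>\<^sub>L real\<close> with the operator norm; the duality pairing
  \<open>\<langle>\<xi>, x\<rangle>\<close> is \<open>blinfun_apply \<xi> x\<close>.\<close>

text \<open>Reflexivity: the canonical map into the bidual is onto.\<close>

definition reflexive_space :: "'a::real_normed_vector itself \<Rightarrow> bool" where
  "reflexive_space _ \<longleftrightarrow>
     (\<forall>\<Phi> :: ('a \<Rightarrow>\<^sub>L real) \<Rightarrow>\<^sub>L real. \<exists>x :: 'a. \<forall>\<xi>.
        blinfun_apply \<Phi> \<xi> = blinfun_apply \<xi> x)"

text \<open>Different spaces are different types, so an inclusion of spaces is an explicit injective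
  bounded linear map.\<close>

definition dense_embedding :: "('a::real_normed_vector \<Rightarrow>\<^sub>L 'b::real_normed_vector) \<Rightarrow> bool" where
  "dense_embedding e \<longleftrightarrow>
     inj (blinfun_apply e) \<and> closure (range (blinfun_apply e)) = UNIV"

text \<open>The inclusion of \<open>V\<close> into its dual induced by \<open>\<iota>: V \<rightarrow> H\<close> and the Riesz identification of \<open>H\<close>
  with its dual, i.e. \<open>v \<mapsto> (w \<mapsto> (\<iota> v | \<iota> w)\<^sub>H)\<close>.\<close>

definition gelfand_embedding ::
    "('v::real_normed_vector \<Rightarrow>\<^sub>L 'h::real_inner) \<Rightarrow> 'v \<Rightarrow> ('v \<Rightarrow>\<^sub>L real)" where
  "gelfand_embedding \<iota> v = blinfun_inner_left (blinfun_apply \<iota> v) o\<^sub>L \<iota>"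

definition self_adjoint_projection :: "('h::real_inner \<Rightarrow>\<^sub>L 'h) \<Rightarrow> bool" where
  "self_adjoint_projection P \<longleftrightarrow>
     P o\<^sub>L P = P \<and> (\<forall>x y. blinfun_apply P x \<bullet> y = x \<bullet> blinfun_apply P y)"

definition finite_dim_subspace :: "'a::real_vector set \<Rightarrow> bool" where
  "finite_dim_subspace S \<longleftrightarrow> subspace S \<and> (\<exists>B. finite B \<and> S = span B)"

definition weakly_converges :: "(nat \<Rightarrow> 'a::real_normed_vector) \<Rightarrow> 'a \<Rightarrow> bool" where
  "weakly_converges x l \<longleftrightarrow>
     (\<forall>\<xi> :: 'a \<Rightarrow>\<^sub>L real. (\<lambda>n. blinfun_apply \<xi> (x n)) \<longlonglongrightarrow> blinfun_apply \<xi> l)"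

definition pseudo_monotone :: "('v::real_normed_vector \<Rightarrow> ('v \<Rightarrow>\<^sub>L real)) \<Rightarrow> bool" where
  "pseudo_monotone A \<longleftrightarrow>
     (\<forall>x l. weakly_converges x l \<and>
            limsup (\<lambda>n. ereal (blinfun_apply (A (x n)) (x n - l))) \<le> 0 \<longrightarrow>
            (\<forall>y. ereal (blinfun_apply (A l) (l - y))
                   \<le> liminf (\<lambda>n. ereal (blinfun_apply (A (x n)) (x n - y)))))"

section \<open>Bochner measurability and Bochner integral\<close>

text \<open>The library's Bochner integral is restricted to the class \<open>second_countable_topology\<close>, of which
  the type \<open>'v \<Rightarrow>\<^sub>L real\<close> is not an instance. The following are the usual definitions without this
  restriction; the integral is that of \<^const>\<open>has_bochner_integral\<close> with Bochner measurability in
  place of Borel measurability.\<close>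

definition bochner_measurable :: "'a measure \<Rightarrow> ('a \<Rightarrow> 'b::real_normed_vector) \<Rightarrow> bool" where
  "bochner_measurable M f \<longleftrightarrow>
     (\<exists>s. (\<forall>i::nat. simple_function M (s i)) \<and> (AE x in M. (\<lambda>i. s i x) \<longlonglongrightarrow> f x))"

definition bochner_integral_is ::
    "'a measure \<Rightarrow> ('a \<Rightarrow> 'b::real_normed_vector) \<Rightarrow> 'b \<Rightarrow> bool" where
  "bochner_integral_is M f I \<longleftrightarrow>
     bochner_measurable M f \<and>
     (\<exists>s. (\<forall>i::nat. Bochner_Integration.simple_bochner_integrable M (s i)) \<and>
          (\<lambda>i. \<integral>\<^sup>+x. norm (f x - s i x) \<partial>M) \<longlonglongrightarrow> 0 \<and>
          (\<lambda>i. Bochner_Integration.simple_bochner_integral M (s i)) \<longlonglongrightarrow> I)"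

section \<open>Function spaces on the time interval\<close>

text \<open>Elements of \<open>L\<^sup>p(0,T;X)\<close> are represented by functions rather than by classes of functions; the
  values outside \<open>[0,T]\<close> are irrelevant. The endpoints form a null set.\<close>

definition Lp :: "real \<Rightarrow> real \<Rightarrow> (real \<Rightarrow> 'a::real_normed_vector) set" where
  "Lp T p = {u. bochner_measurable (lebesgue_on {0..T}) u \<and>
                integrable (lebesgue_on {0..T}) (\<lambda>t. norm (u t) powr p)}"

definition Linf :: "real \<Rightarrow> (real \<Rightarrow> 'a::real_normed_vector) set" where
  "Linf T = {u. bochner_measurable (lebesgue_on {0..T}) u \<and>
                (\<exists>K. AE t in lebesgue_on {0..T}. norm (u t) \<le> K)}"

text \<open>\<open>C\<^sub>0\<^sup>\<infinity>((0,T))\<close>, as functions on the whole line. The support is bounded, hence compact, as soon as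
  it is contained in the interval.\<close>

definition test_functions :: "real \<Rightarrow> (real \<Rightarrow> real) set" where
  "test_functions T =
     {\<phi>. (\<forall>k t. (deriv ^^ k) \<phi> differentiable (at t)) \<and>
         closure {t. \<phi> t \<noteq> 0} \<subseteq> {0<..<T}}"

text \<open>\<open>du/dt = g\<close>, where \<open>u\<close> is \<open>V\<close>-valued, \<open>g\<close> is \<open>W\<close>-valued and \<open>e\<close> is the embedding of \<open>V\<close> into
  \<open>W\<close>.\<close>

definition has_generalized_derivative ::
    "('v::real_normed_vector \<Rightarrow> 'w::real_normed_vector) \<Rightarrow> real \<Rightarrow> (real \<Rightarrow> 'v) \<Rightarrow> (real \<Rightarrow> 'w) \<Rightarrow> bool"
where
  "has_generalized_derivative e T u g \<longleftrightarrow>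
     (\<forall>\<phi>\<in>test_functions T. \<exists>I J.
        bochner_integral_is (lebesgue_on {0..T}) (\<lambda>t. deriv \<phi> t *\<^sub>R u t) I \<and>
        bochner_integral_is (lebesgue_on {0..T}) (\<lambda>t. \<phi> t *\<^sub>R g t) J \<and>
        e I = - J)"

text \<open>\<open>q\<close> is the conjugate exponent of \<open>p\<close>.\<close>

definition W1p ::
    "('v::real_normed_vector \<Rightarrow>\<^sub>L 'h::real_inner) \<Rightarrow> real \<Rightarrow> real \<Rightarrow> real \<Rightarrow> (real \<Rightarrow> 'v) set" where
  "W1p \<iota> T p q =
     {u \<in> Lp T p. \<exists>g \<in> Lp T q. has_generalized_derivative (gelfand_embedding \<iota>) T u g}"

definition continuous_representative ::
    "real \<Rightarrow> (real \<Rightarrow> 'h::real_normed_vector) \<Rightarrow> (real \<Rightarrow> 'h) \<Rightarrow> bool" where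
  "continuous_representative T v w \<longleftrightarrow>
     continuous_on {0..T} w \<and> (AE t in lebesgue_on {0..T}. w t = v t)"

end

theory Submission
  imports Defs "HOL-Complex_Analysis.Great_Picard"
begin

text \<open>Replacing \<open>A(t)\<close> by \<open>B(t) = A(t) - f(t)\<close> reduces the problem to \<open>f = 0\<close>. Galerkin
  approximations \<open>u\<^sub>n\<close> in \<open>V\<^sub>n\<close> satisfy energy estimates, so that along a subsequence \<open>u\<^sub>n(t)\<close>
  converges weakly in \<open>H\<close> for every \<open>t\<close> to some \<open>u(t)\<close>, which by Fatou's lemma lies in \<open>V\<close> for a.e. \<open>t\<close>, and
  \<open>\<integral>\<^sub>s\<^sup>t \<langle>- B u\<^sub>n, w\<rangle> \<rightarrow> (u(t) - u(s) | w)\<close> for all \<open>w \<in> V\<close>. A discrete integration by parts extends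
  this convergence to the test function \<open>u\<close>, with limit \<open>(\<parallel>u(t)\<parallel>\<^sup>2 - \<parallel>u(s)\<parallel>\<^sup>2)/2\<close>; together with the
  energy estimate it gives \<open>limsup \<integral>\<langle>B u\<^sub>n, u\<^sub>n - u\<rangle> \<le> 0\<close>. For a.e. \<open>t\<close> the integrands have a nonnegative
  lower limit, by coercivity and pseudo-monotonicity, hence they tend to \<open>0\<close> in \<open>L\<^sup>1\<close> and, along a
  subsequence, a.e.; pseudo-monotonicity at a.e. \<open>t\<close> and Fatou's lemma then identify the limit equation. The
  same integration by parts, applied to \<open>- B u\<close>, shows that \<open>\<parallel>u\<parallel>\<^sup>2\<close> is continuous, so that the weakly
  continuous function \<open>u\<close> is strongly continuous.\<close>

section \<open>Hahn--Banach, Riesz and weak convergence\<close>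

text \<open>No compactness of \<open>V\<close> in \<open>H\<close> is available: the Galerkin
  solutions converge only weakly in \<open>H\<close> at each time, and at a fixed time they need not
  be bounded in \<open>V\<close>. Pseudo-monotonicity is therefore applied only to sequences on
  which the coercive lower bound itself yields boundedness in \<open>V\<close>; weak convergence in
  \<open>V\<close> then follows from that in \<open>H\<close> by reflexivity. The growth condition
  (A4) carries a power of the \<open>H\<close> norm, harmless only on balls of \<open>H\<close>, so
  an \<open>H\<close> bound has to precede all other estimates. This is why the approximate problem
  is cut off at a radius that depends on \<open>u0\<close> and \<open>k\<close> alone. The limit
  appears twice: \<open>u\<close> is \<open>H\<close>-valued, weakly continuous and defined at every
  time; \<open>v\<close> is \<open>V\<close>-valued and agrees with \<open>u\<close> almost
  everywhere. Integration by parts needs nodes at which both agree. It rests only on the sign of the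
  squared norm of x - y, so it presupposes neither a chain rule nor strong continuity of
  \<open>u\<close>; both are consequences of it. Identities between vector-valued integrals are
  reduced to scalar ones by applying functionals.\<close>

definition sublinear :: "('a::real_vector \<Rightarrow> real) \<Rightarrow> bool" where
  "sublinear q \<longleftrightarrow> (\<forall>x y. q (x + y) \<le> q x + q y) \<and> (\<forall>a x. 0 \<le> a \<longrightarrow> q (a *\<^sub>R x) = a * q x)"

lemma sublinear_add: "sublinear q \<Longrightarrow> q (x + y) \<le> q x + q y"
  and sublinear_scale: "sublinear q \<Longrightarrow> 0 \<le> a \<Longrightarrow> q (a *\<^sub>R x) = a * q x"
  by (auto simp: sublinear_def)

lemma sublinear_0: "sublinear q \<Longrightarrow> q 0 = 0"
  using sublinear_scale[of q 0 0] by simp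

lemma sublinear_neg: "sublinear q \<Longrightarrow> - q (- x) \<le> q x"
  using sublinear_add[of q x "- x"] sublinear_0[of q] by simp

text \<open>Take the infimum over t \<ge> 0 of \<open>q (x + t *\<^sub>R x0) - t * q x0\<close>.
  Subadditivity bounds it below by \<open>- q (- x)\<close>; t = 0 gives the bound by
  \<open>q\<close>, and t = 1 gives the value at \<open>- x0\<close>.\<close>

lemma sublinear_tilt:
  assumes q: "sublinear q"
  obtains r where "sublinear r" "\<And>x. r x \<le> q x" "r (- x0) \<le> - q x0"
proof -
  define r where "r x = (INF t\<in>{0..}. q (x + t *\<^sub>R x0) - t * q x0)" for x
  have lb: "- q (- x) \<le> q (x + t *\<^sub>R x0) - t * q x0" if "0 \<le> t" for x t
    using sublinear_add[OF q, of "x + t *\<^sub>R x0" "- x"] sublinear_scale[OF q that, of x0] by simp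
  have bdd: "bdd_below ((\<lambda>t. q (x + t *\<^sub>R x0) - t * q x0) ` {0..})" for x
    using lb by (intro bdd_belowI2[of _ "- q (- x)"]) auto
  have r_le: "r x \<le> q (x + t *\<^sub>R x0) - t * q x0" if "0 \<le> t" for x t
    unfolding r_def by (rule cINF_lower[OF bdd]) (use that in auto)
  have r_ge: "c \<le> r x" if "\<And>t. 0 \<le> t \<Longrightarrow> c \<le> q (x + t *\<^sub>R x0) - t * q x0" for x c
    unfolding r_def by (rule cINF_greatest) (use that in auto)
  have add: "r (x + y) \<le> r x + r y" for x y
  proof -
    have "r (x + y) - (q (y + t *\<^sub>R x0) - t * q x0) \<le> r x" if t: "0 \<le> t" for t
    proof (rule r_ge)
      fix s :: real assume s: "0 \<le> s"
      have "r (x + y) \<le> q (x + y + (s + t) *\<^sub>R x0) - (s + t) * q x0"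
        using s t by (intro r_le) auto
      also have "q (x + y + (s + t) *\<^sub>R x0) \<le> q (x + s *\<^sub>R x0) + q (y + t *\<^sub>R x0)"
        using sublinear_add[OF q, of "x + s *\<^sub>R x0" "y + t *\<^sub>R x0"] by (simp add: algebra_simps)
      finally show "r (x + y) - (q (y + t *\<^sub>R x0) - t * q x0) \<le> q (x + s *\<^sub>R x0) - s * q x0"
        by (simp add: algebra_simps)
    qed
    then have "r (x + y) - r x \<le> r y" by (intro r_ge) (simp add: algebra_simps)
    then show ?thesis by simp
  qed
  have scale_le: "a * r x \<le> r (a *\<^sub>R x)" if a: "0 < a" for a x
  proof (rule r_ge)
    fix t :: real assume t: "0 \<le> t"
    have "a * r x \<le> a * (q (x + (t / a) *\<^sub>R x0) - t / a * q x0)"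
      using a t by (intro mult_left_mono r_le) auto
    also have "\<dots> = q (a *\<^sub>R (x + (t / a) *\<^sub>R x0)) - t * q x0"
      using a by (subst sublinear_scale[OF q]) (auto simp: algebra_simps)
    finally show "a * r x \<le> q (a *\<^sub>R x + t *\<^sub>R x0) - t * q x0"
      using a by (simp add: algebra_simps)
  qed
  have r0: "r 0 = 0"
    using r_le[of 0 0] sublinear_0[OF q] sublinear_scale[OF q]
    by (intro antisym r_ge) auto
  have scale: "r (a *\<^sub>R x) = a * r x" if "0 \<le> a" for a x
  proof (cases "a = 0")
    case False
    then have a: "0 < a" using that by simp
    have "inverse a * r (a *\<^sub>R x) \<le> r x"
      using scale_le[of "inverse a" "a *\<^sub>R x"] a by simp
    then have "r (a *\<^sub>R x) \<le> a * r x" using a by (simp add: field_simps)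
    with scale_le[OF a, of x] show ?thesis by simp
  qed (simp add: r0)
  show ?thesis
  proof
    show "sublinear r" using add scale by (auto simp: sublinear_def)
    show "r x \<le> q x" for x using r_le[of 0 x] by simp
    show "r (- x0) \<le> - q x0" using r_le[of 1 "- x0"] sublinear_0[OF q] by simp
  qed
qed

text \<open>Zorn's lemma for the reversed pointwise order. All sublinear functionals below
  \<open>q\<close> share the lower bound \<open>- q (- x)\<close>, so the pointwise infimum of a
  chain is finite. It is subadditive because, of two members of a chain, the smaller one can be used
  for both summands.\<close>

lemma sublinear_minimal:
  assumes q: "sublinear q"
  obtains r where "sublinear r" "\<And>x. r x \<le> q x"
    "\<And>s. sublinear s \<Longrightarrow> (\<And>x. s x \<le> r x) \<Longrightarrow> s = r"
proof -
  define A where "A = {r. sublinear r \<and> (\<forall>x. r x \<le> q x)}"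
  define P where "P = (\<lambda>(r :: 'a \<Rightarrow> real) s. \<forall>x. s x \<le> r x)"
  have "\<exists>m\<in>A. \<forall>a\<in>A. P m a \<longrightarrow> a = m"
  proof (rule predicate_Zorn)
    show "partial_order_on A (relation_of P A)"
      by (rule partial_order_on_relation_ofI) (auto simp: P_def fun_eq_iff intro: order_trans antisym)
    fix C assume "C \<in> Chains (relation_of P A)"
    then have CA: "C \<subseteq> A" and tot: "\<And>r s. r \<in> C \<Longrightarrow> s \<in> C \<Longrightarrow> P r s \<or> P s r"
      by (auto simp: Chains_def relation_of_def)
    show "\<exists>u\<in>A. \<forall>a\<in>C. P a u"
    proof (cases "C = {}")
      case True
      then show ?thesis using q by (auto simp: A_def)
    next
      case False
      define u where "u x = (INF r\<in>C. r x)" for x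
      have sub: "sublinear r" and le: "r x \<le> q x" if "r \<in> C" for r x
        using that CA by (auto simp: A_def)
      have bdd: "bdd_below ((\<lambda>r. r x) ` C)" for x
        using order_trans[OF _ sublinear_neg[OF sub]] le
        by (intro bdd_belowI2[of _ "- q (- x)"]) (metis neg_le_iff_le)
      have u_le: "u x \<le> r x" if "r \<in> C" for r x
        unfolding u_def by (rule cINF_lower[OF bdd that])
      have u_ge: "c \<le> u x" if "\<And>r. r \<in> C \<Longrightarrow> c \<le> r x" for c x
        unfolding u_def by (rule cINF_greatest[OF False that])
      have "u (x + y) \<le> u x + u y" for x y
      proof -
        have "u (x + y) - s y \<le> u x" if s: "s \<in> C" for s
        proof (rule u_ge)
          fix r assume r: "r \<in> C"
          from tot[OF r s] show "u (x + y) - s y \<le> r x"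
          proof
            assume "P r s"
            then have "s x \<le> r x" by (simp add: P_def)
            with u_le[OF s, of "x + y"] sublinear_add[OF sub[OF s], of x y] show ?thesis by simp
          next
            assume "P s r"
            then have "r y \<le> s y" by (simp add: P_def)
            with u_le[OF r, of "x + y"] sublinear_add[OF sub[OF r], of x y] show ?thesis by simp
          qed
        qed
        then have "u (x + y) - u x \<le> u y" by (intro u_ge) (simp add: algebra_simps)
        then show ?thesis by simp
      qed
      moreover have "u (a *\<^sub>R x) = a * u x" if a: "0 \<le> a" for a x
      proof (cases "a = 0")
        case True
        obtain r where "r \<in> C" using False by blast
        have "u 0 \<le> 0" using u_le[OF \<open>r \<in> C\<close>, of 0] sublinear_0[OF sub[OF \<open>r \<in> C\<close>]] by simp
        moreover have "0 \<le> u 0"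
        proof (rule u_ge)
          fix s assume s: "s \<in> C"
          show "0 \<le> s 0" using sublinear_0[OF sub[OF s]] by simp
        qed
        ultimately show ?thesis using True by simp
      next
        case False
        then have a: "0 < a" using a by simp
        have "a * u x \<le> u (a *\<^sub>R x)"
          proof (rule u_ge)
          fix r assume r: "r \<in> C"
          show "a * u x \<le> r (a *\<^sub>R x)"
            using a mult_left_mono[OF u_le[OF r, of x], of a] sublinear_scale[OF sub[OF r], of a x] by simp
        qed
        moreover have "u (a *\<^sub>R x) / a \<le> u x"
        proof (rule u_ge)
          fix r assume r: "r \<in> C"
          show "u (a *\<^sub>R x) / a \<le> r x"
            using a u_le[OF r, of "a *\<^sub>R x"] sublinear_scale[OF sub[OF r], of a x] by (simp add: field_simps)
        qed
        ultimately show ?thesis using a by (simp add: field_simps)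
      qed
      ultimately have "sublinear u" by (auto simp: sublinear_def)
      moreover have "u x \<le> q x" for x using False u_le le by (meson all_not_in_conv order_trans)
      ultimately show ?thesis using u_le by (intro bexI[of _ u]) (auto simp: A_def P_def)
    qed
  qed
  then obtain r where r: "r \<in> A" "\<And>a. a \<in> A \<Longrightarrow> P r a \<Longrightarrow> a = r" by blast
  show ?thesis
  proof
    show "sublinear r" "\<And>x. r x \<le> q x" using r by (auto simp: A_def)
    show "s = r" if "sublinear s" "\<And>x. s x \<le> r x" for s
    proof (rule r(2))
      have "s x \<le> q x" for x using that(2)[of x] r(1) order_trans by (auto simp: A_def)
      then show "s \<in> A" using that(1) by (simp add: A_def)
      show "P r s" using that(2) by (simp add: P_def)
    qed
  qed
qed

text \<open>A minimal sublinear functional is linear, since tilting it in any direction cannot decrease it.\<close>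

lemma sublinear_dominates_linear:
  assumes q: "sublinear q"
  obtains f where "linear f" "\<And>x. f x \<le> q x" "f x0 = q x0"
proof -
  \<comment> \<open>Tilting at \<open>x0\<close> before passing to a minimal functional gives f (-
    x0) \<le> - q x0, which for linear \<open>f\<close> below \<open>q\<close> forces equality at
    \<open>x0\<close>.\<close>
  obtain q' where q': "sublinear q'" "\<And>x. q' x \<le> q x" "q' (- x0) \<le> - q x0"
    using sublinear_tilt[OF q] by blast
  obtain f where f: "sublinear f" "\<And>x. f x \<le> q' x"
    and min: "\<And>s. sublinear s \<Longrightarrow> (\<And>x. s x \<le> f x) \<Longrightarrow> s = f"
    using sublinear_minimal[OF q'(1)] by blast
  have neg: "f (- x) = - f x" for x
  proof -
    obtain s where "sublinear s" "\<And>x. s x \<le> f x" "s (- x) \<le> - f x"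
      using sublinear_tilt[OF f(1)] by blast
    with min have "f (- x) \<le> - f x" by metis
    moreover have "- f x \<le> f (- x)" using sublinear_neg[OF f(1), of "- x"] by simp
    ultimately show ?thesis by simp
  qed
  have add: "f (x + y) = f x + f y" for x y
    using sublinear_add[OF f(1), of x y] sublinear_add[OF f(1), of "x + y" "- y"] neg[of y] by simp
  have "f (a *\<^sub>R x) = a * f x" for a x
  proof (cases "0 \<le> a")
    case False
    then show ?thesis using sublinear_scale[OF f(1), of "- a" x] neg[of "a *\<^sub>R x"] by simp
  qed (rule sublinear_scale[OF f(1)])
  with add have "linear f" by (intro linearI) auto
  moreover have le: "f x \<le> q x" for x using f(2)[of x] q'(2)[of x] by simp
  moreover have "f x0 = q x0" using le[of x0] f(2)[of "- x0"] q'(3) neg[of x0] by simp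
  ultimately show ?thesis by (rule that)
qed

lemma infdist_subspace_sublinear:
  fixes S :: "'a::real_normed_vector set"
  assumes S: "subspace S"
  shows "sublinear (\<lambda>x. infdist x S)"
proof -
  have ne: "S \<noteq> {}" using subspace_0[OF S] by blast
  have ge: "c \<le> infdist x S" if "\<And>s. s \<in> S \<Longrightarrow> c \<le> dist x s" for c x
    using that ne by (simp add: infdist_notempty cINF_greatest)
  have "infdist (x + y) S \<le> infdist x S + infdist y S" for x y
  proof -
    have "infdist (x + y) S - dist y t \<le> infdist x S" if t: "t \<in> S" for t
    proof (rule ge)
      fix s assume s: "s \<in> S"
      have "infdist (x + y) S \<le> dist (x + y) (s + t)"
        using s t subspace_add[OF S] by (intro infdist_le) auto
      also have "\<dots> \<le> dist x s + dist y t" by (rule dist_triangle_add)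
      finally show "infdist (x + y) S - dist y t \<le> dist x s" by simp
    qed
    then have "infdist (x + y) S - infdist x S \<le> infdist y S" by (intro ge) (simp add: algebra_simps)
    then show ?thesis by simp
  qed
  moreover have "infdist (a *\<^sub>R x) S = a * infdist x S" if "0 \<le> a" for a x
  proof (cases "a = 0")
    case False
    then have a: "0 < a" using that by simp
    have le: "infdist (b *\<^sub>R y) S \<le> b * dist y s" if "0 < b" "s \<in> S" for b y s
    proof -
      have "infdist (b *\<^sub>R y) S \<le> dist (b *\<^sub>R y) (b *\<^sub>R s)"
        using that subspace_scale[OF S] by (intro infdist_le) auto
      then show ?thesis using that by (simp add: dist_norm flip: scaleR_diff_right)
    qed
    have "infdist (a *\<^sub>R x) S / a \<le> infdist x S"
      using le[OF a, of _ x] a by (intro ge) (simp add: field_simps)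
    moreover have "a * infdist x S \<le> infdist (a *\<^sub>R x) S"
      using le[of "inverse a" _ "a *\<^sub>R x"] a by (intro ge) (simp add: field_simps)
    ultimately show ?thesis using a by (simp add: field_simps)
  qed (use S in \<open>simp add: subspace_0 infdist_zero\<close>)
  ultimately show ?thesis by (auto simp: sublinear_def)
qed

text \<open>Domination by the distance to \<open>S\<close> gives all three properties at once: the
  distance vanishes on \<open>S\<close>, is at most the norm because 0 lies in \<open>S\<close>, and
  is attained by the functional at \<open>x0\<close>.\<close>

lemma hahn_banach_infdist:
  fixes S :: "'a::real_normed_vector set"
  assumes S: "subspace S"
  obtains \<xi> :: "'a \<Rightarrow>\<^sub>L real" where "norm \<xi> \<le> 1" "\<And>x. x \<in> S \<Longrightarrow> \<xi> x = 0" "\<xi> x0 = infdist x0 S"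
proof -
  obtain f where f: "linear f" "\<And>x. f x \<le> infdist x S" "f x0 = infdist x0 S"
    using sublinear_dominates_linear[OF infdist_subspace_sublinear[OF S]] by blast
  have "infdist x S \<le> norm x" for x using infdist_le[OF subspace_0[OF S], of x] by simp
  with f(2) have le: "f x \<le> norm x" for x by (meson order_trans)
  have bound: "norm (f x) \<le> norm x * 1" for x
    using le[of x] le[of "- x"] linear_neg[OF f(1), of x] by (simp add: abs_le_iff)
  have bl: "bounded_linear f"
    unfolding bounded_linear_def bounded_linear_axioms_def using f(1) bound by blast
  show ?thesis
  proof
    show "norm (Blinfun f) \<le> 1"
      using bound bl by (intro norm_blinfun_bound) (auto simp: bounded_linear_Blinfun_apply)
    show "Blinfun f x = 0" if "x \<in> S" for x
      using that f(2)[of x] f(2)[of "- x"] linear_neg[OF f(1), of x] subspace_neg[OF S that]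
      by (simp add: bl bounded_linear_Blinfun_apply)
    show "Blinfun f x0 = infdist x0 S" using f(3) by (simp add: bl bounded_linear_Blinfun_apply)
  qed
qed

lemma norming_functional:
  fixes x :: "'a::real_normed_vector"
  obtains \<xi> :: "'a \<Rightarrow>\<^sub>L real" where "norm \<xi> \<le> 1" "\<xi> x = norm x"
  using hahn_banach_infdist[OF subspace_single_0, of x] by (auto simp: infdist_def)

lemma dense_subspaceI:
  fixes S :: "'a::real_normed_vector set"
  assumes S: "subspace S" and van: "\<And>\<xi> :: 'a \<Rightarrow>\<^sub>L real. (\<And>x. x \<in> S \<Longrightarrow> blinfun_apply \<xi> x = 0) \<Longrightarrow> \<xi> = 0"
  shows "closure S = UNIV"
proof (rule UNIV_eq_I[symmetric])
  fix x
  obtain \<xi> :: "'a \<Rightarrow>\<^sub>L real" where "\<And>x. x \<in> S \<Longrightarrow> \<xi> x = 0" "\<xi> x = infdist x S"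
    using hahn_banach_infdist[OF S] by blast
  with van have "infdist x S = 0" by fastforce
  moreover have "S \<noteq> {}" using subspace_0[OF S] by blast
  ultimately show "x \<in> closure S" by (simp add: in_closure_iff_infdist_zero)
qed

text \<open>Variational proof: the vector sought minimizes \<open>J\<close>. The parallelogram
  identity applied to the midpoint of two points makes every minimizing sequence Cauchy, and the
  first variation at the minimizer is the representation.\<close>

lemma riesz_representation:
  fixes L :: "'h::{real_inner, complete_space} \<Rightarrow>\<^sub>L real"
  obtains h where "\<And>x. L x = h \<bullet> x"
proof -
  define J where "J x = x \<bullet> x - 2 * L x" for x
  define d where "d = (INF x. J x)"
  have "- (norm L)\<^sup>2 \<le> J x" for x
  proof -
    have "L x \<le> norm L * norm x" using norm_blinfun[of L x] by simp
    then have "J x \<ge> (norm x)\<^sup>2 - 2 * (norm L * norm x)"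
      by (simp add: J_def power2_norm_eq_inner)
    moreover have "(norm x - norm L)\<^sup>2 \<ge> 0" by simp
    ultimately show ?thesis by (simp add: power2_diff algebra_simps)
  qed
  then have "bdd_below (range J)" by (intro bdd_belowI2)
  then have d: "d \<le> J x" for x unfolding d_def by (intro cINF_lower) auto
  have "\<exists>x. J x < d + inverse (real (Suc n))" for n
  proof (rule ccontr)
    assume "\<not> ?thesis"
    then have "d + inverse (real (Suc n)) \<le> d"
      unfolding d_def by (intro cINF_greatest) (auto simp: not_less d_def)
    then show False by simp
  qed
  then obtain x where x: "\<And>n. J (x n) < d + inverse (real (Suc n))" by metis
  have par: "(norm (y - z))\<^sup>2 \<le> 2 * (J y - d) + 2 * (J z - d)" for y z
  proof -
    have "d \<le> J ((1/2) *\<^sub>R (y + z))" by (rule d)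
    then show ?thesis
      unfolding J_def power2_norm_eq_inner
      by (simp add: inner_simps blinfun.bilinear_simps inner_commute algebra_simps)
  qed
  have "Cauchy x"
  proof (rule CauchyI)
    fix e :: real assume e: "0 < e"
    obtain N where N: "inverse (real (Suc N)) < e\<^sup>2 / 4" using reals_Archimedean e
      by (metis zero_less_divide_iff zero_less_numeral zero_less_power)
    have "norm (x m - x n) < e" if "N \<le> m" "N \<le> n" for m n
    proof -
      have "inverse (real (Suc m)) \<le> inverse (real (Suc N))" "inverse (real (Suc n)) \<le> inverse (real (Suc N))"
        using that by (auto intro!: le_imp_inverse_le)
      with N have "inverse (real (Suc m)) < e\<^sup>2 / 4" "inverse (real (Suc n)) < e\<^sup>2 / 4" by (auto simp only: order.strict_trans1)
      then have "J (x m) < d + e\<^sup>2 / 4" "J (x n) < d + e\<^sup>2 / 4"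
        using x[of m] x[of n] by (meson add_strict_left_mono order.strict_trans)+
      then have "(norm (x m - x n))\<^sup>2 < e\<^sup>2"
        using par[of "x m" "x n"] by (simp add: field_simps)
      then show ?thesis using e by (meson less_eq_real_def power_less_imp_less_base)
    qed
    then show "\<exists>M. \<forall>m\<ge>M. \<forall>n\<ge>M. norm (x m - x n) < e" by blast
  qed
  then obtain h where h: "x \<longlonglongrightarrow> h" using Cauchy_convergent convergent_def by blast
  have "(\<lambda>n. J (x n)) \<longlonglongrightarrow> J h" unfolding J_def by (intro tendsto_intros h)
  moreover have "(\<lambda>n. d + inverse (real (Suc n))) \<longlonglongrightarrow> d + 0"
    by (intro tendsto_intros LIMSEQ_inverse_real_of_nat)
  ultimately have Jh: "J h \<le> d" using x by (intro LIMSEQ_le[of "\<lambda>n. J (x n)" "J h"]) (auto intro: less_imp_le)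
  show ?thesis
  proof
    fix y
    define b where "b = h \<bullet> y - L y"
    show "L y = h \<bullet> y"
    proof (cases "y = 0")
      case False
      then have yy: "y \<bullet> y > 0" by simp
      define t where "t = - b / (y \<bullet> y)"
      have "J h \<le> J (h + t *\<^sub>R y)" using Jh d order_trans by blast
      then have "0 \<le> 2 * t * b + t * t * (y \<bullet> y)"
        by (simp add: J_def b_def inner_simps blinfun.bilinear_simps inner_commute algebra_simps)
      then have "0 \<le> - (b * b) / (y \<bullet> y)" using yy by (simp add: t_def field_simps)
      then have "b * b \<le> 0" using yy by (simp add: field_simps)
      then have "b = 0" by (metis antisym mult_eq_0_iff zero_le_square)
      then show ?thesis by (simp add: b_def)
    qed simp
  qed
qed

text \<open>The inclusion of all of \<open>H\<close> into the dual of \<open>V\<close>;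
  \<open>gelfand_embedding\<close> is its composition with \<iota>. Functionals of this form are the
  ones tested by weak convergence in \<open>H\<close>.\<close>

definition adjoint_embedding ::
    "('v::real_normed_vector \<Rightarrow>\<^sub>L 'h::real_inner) \<Rightarrow> 'h \<Rightarrow> ('v \<Rightarrow>\<^sub>L real)" where
  "adjoint_embedding \<iota> h = blinfun_inner_left h o\<^sub>L \<iota>"

lemma adjoint_embedding_apply [simp]: "adjoint_embedding \<iota> h x = h \<bullet> \<iota> x"
  by (simp add: adjoint_embedding_def inner_commute)

lemma gelfand_embedding_apply [simp]: "gelfand_embedding \<iota> v w = \<iota> v \<bullet> \<iota> w"
  by (simp add: gelfand_embedding_def inner_commute)

text \<open>By reflexivity, an element of the bidual that vanishes on the range is evaluation at
  some x. Testing with \<iota> x itself shows \<iota> x = 0, and injectivity gives x = 0.\<close>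

lemma dense_adjoint_embedding:
  fixes \<iota> :: "'v::real_normed_vector \<Rightarrow>\<^sub>L 'h::real_inner"
  assumes refl: "reflexive_space TYPE('v)" and inj: "inj \<iota>"
  shows "closure (range (adjoint_embedding \<iota>)) = UNIV"
proof (rule dense_subspaceI)
  show "subspace (range (adjoint_embedding \<iota>))"
  proof (rule subspaceI)
    have "adjoint_embedding \<iota> 0 = 0" by (rule blinfun_eqI) simp
    then show "0 \<in> range (adjoint_embedding \<iota>)" by (metis rangeI)
    fix x y assume "x \<in> range (adjoint_embedding \<iota>)" "y \<in> range (adjoint_embedding \<iota>)"
    then obtain a b where "x = adjoint_embedding \<iota> a" "y = adjoint_embedding \<iota> b" by auto
    then have "x + y = adjoint_embedding \<iota> (a + b)"
      by (intro blinfun_eqI) (simp add: blinfun.bilinear_simps inner_simps)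
    then show "x + y \<in> range (adjoint_embedding \<iota>)" by simp
  next
    fix c x assume "x \<in> range (adjoint_embedding \<iota>)"
    then obtain a where "x = adjoint_embedding \<iota> a" by auto
    then have "c *\<^sub>R x = adjoint_embedding \<iota> (c *\<^sub>R a)"
      by (intro blinfun_eqI) (simp add: blinfun.bilinear_simps)
    then show "c *\<^sub>R x \<in> range (adjoint_embedding \<iota>)" by simp
  qed
  fix \<Phi> :: "('v \<Rightarrow>\<^sub>L real) \<Rightarrow>\<^sub>L real"
  assume van: "\<And>\<xi>. \<xi> \<in> range (adjoint_embedding \<iota>) \<Longrightarrow> \<Phi> \<xi> = 0"
  obtain x where x: "\<And>\<xi>. \<Phi> \<xi> = \<xi> x" using refl unfolding reflexive_space_def by blast
  have "\<iota> x \<bullet> \<iota> x = 0" using van[of "adjoint_embedding \<iota> (\<iota> x)"] x by simp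
  then have "\<iota> x = \<iota> 0" by simp
  then have "x = 0" using inj by (simp only: inj_eq)
  then show "\<Phi> = 0" using x by (intro blinfun_eqI) simp
qed

lemma tendsto_by_approximation:
  fixes a :: "nat \<Rightarrow> real"
  assumes "\<And>e. 0 < e \<Longrightarrow> \<exists>b l'. b \<longlonglongrightarrow> l' \<and> (\<forall>\<^sub>F n in sequentially. \<bar>a n - b n\<bar> \<le> e) \<and> \<bar>l - l'\<bar> \<le> e"
  shows "a \<longlonglongrightarrow> l"
proof (rule tendstoI)
  fix e :: real assume e: "0 < e"
  obtain b l' where b: "b \<longlonglongrightarrow> l'" "\<forall>\<^sub>F n in sequentially. \<bar>a n - b n\<bar> \<le> e/4" "\<bar>l - l'\<bar> \<le> e/4"
    using assms[of "e/4"] e by auto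
  have "\<forall>\<^sub>F n in sequentially. dist (b n) l' < e/4" using b(1) e by (intro tendstoD) auto
  then show "\<forall>\<^sub>F n in sequentially. dist (a n) l < e"
    using b(2) by eventually_elim (use b(3) e in \<open>unfold dist_real_def, linarith\<close>)
qed

lemma convergent_by_approximation:
  fixes a :: "nat \<Rightarrow> real"
  assumes "\<And>e. 0 < e \<Longrightarrow> \<exists>b. convergent b \<and> (\<forall>\<^sub>F n in sequentially. \<bar>a n - b n\<bar> \<le> e)"
  shows "convergent a"
proof -
  have "Cauchy a"
  proof (rule metric_CauchyI)
    fix e :: real assume e: "0 < e"
    obtain b where b: "convergent b" "\<forall>\<^sub>F n in sequentially. \<bar>a n - b n\<bar> \<le> e/4"
      using assms[of "e/4"] e by auto
    obtain N1 where N1: "\<And>m n. N1 \<le> m \<Longrightarrow> N1 \<le> n \<Longrightarrow> dist (b m) (b n) < e/4"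
      using metric_CauchyD[OF convergent_Cauchy[OF b(1)], of "e/4"] e by auto
    obtain N2 where N2: "\<And>n. N2 \<le> n \<Longrightarrow> \<bar>a n - b n\<bar> \<le> e/4"
      using b(2) by (auto simp: eventually_sequentially)
    have "dist (a m) (a n) < e" if "max N1 N2 \<le> m" "max N1 N2 \<le> n" for m n
      using N1[of m n] N2[of m] N2[of n] that e unfolding dist_real_def by (simp; linarith)
    then show "\<exists>M. \<forall>m\<ge>M. \<forall>n\<ge>M. dist (a m) (a n) < e" by blast
  qed
  then show ?thesis by (rule Cauchy_convergent)
qed

lemma dense_approx:
  fixes x :: "'a::metric_space"
  assumes "closure S = UNIV" "0 < e"
  obtains y where "y \<in> S" "dist x y < e"
proof -
  have "x \<in> closure S" using assms by simp
  then show ?thesis using that assms(2) unfolding closure_approachable by (metis dist_commute)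
qed

text \<open>Boundedness in \<open>V\<close> lets convergence pass from the dense set of functionals
  coming from \<open>H\<close> to all functionals. The limits form a bounded functional on the dual,
  which reflexivity represents by a point of \<open>V\<close>. The whole sequence converges, so no
  weakly convergent subsequence has to be extracted.\<close>

lemma weak_convergence_lift:
  fixes \<iota> :: "'v::real_normed_vector \<Rightarrow>\<^sub>L 'h::real_inner"
  assumes refl: "reflexive_space TYPE('v)" and inj: "inj \<iota>"
    and bnd: "\<And>n. norm (x n) \<le> K" and lim: "\<And>h. (\<lambda>n. h \<bullet> \<iota> (x n)) \<longlonglongrightarrow> h \<bullet> y"
  obtains l where "\<iota> l = y" "weakly_converges x l"
proof -
  have K: "0 \<le> K" using bnd[of 0] norm_ge_zero order_trans by blast
  have conv: "convergent (\<lambda>n. blinfun_apply \<xi> (x n))" for \<xi> :: "'v \<Rightarrow>\<^sub>L real"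
  proof (rule convergent_by_approximation)
    fix e :: real assume e: "0 < e"
    obtain \<eta> where \<eta>: "\<eta> \<in> range (adjoint_embedding \<iota>)" "dist \<xi> \<eta> < e / (K + 1)"
      using dense_approx[OF dense_adjoint_embedding[OF refl inj], of "e / (K + 1)"] e K
      by (metis add_nonneg_pos divide_pos_pos zero_less_one)
    then obtain h where h: "\<eta> = adjoint_embedding \<iota> h" by blast
    have "\<bar>\<xi> (x n) - h \<bullet> \<iota> (x n)\<bar> \<le> e" for n
    proof -
      have "\<bar>\<xi> (x n) - h \<bullet> \<iota> (x n)\<bar> = norm ((\<xi> - \<eta>) (x n))"
        by (simp add: h blinfun.bilinear_simps)
      also have "\<dots> \<le> norm (\<xi> - \<eta>) * norm (x n)" by (rule norm_blinfun)
      also have "\<dots> \<le> e / (K + 1) * K" using \<eta>(2) bnd e K by (intro mult_mono) (auto simp: dist_norm)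
      also have "\<dots> \<le> e" using e K by (simp add: field_simps)
      finally show ?thesis .
    qed
    moreover have "convergent (\<lambda>n. h \<bullet> \<iota> (x n))" using lim convergentI by blast
    ultimately show "\<exists>b. convergent b \<and> (\<forall>\<^sub>F n in sequentially. \<bar>\<xi> (x n) - b n\<bar> \<le> e)" by auto
  qed
  define \<Phi> where "\<Phi> \<xi> = lim (\<lambda>n. blinfun_apply \<xi> (x n))" for \<xi> :: "'v \<Rightarrow>\<^sub>L real"
  have \<Phi>: "(\<lambda>n. blinfun_apply \<xi> (x n)) \<longlonglongrightarrow> \<Phi> \<xi>" for \<xi>
    unfolding \<Phi>_def using conv convergent_LIMSEQ_iff by blast
  have "bounded_linear \<Phi>"
  proof (rule bounded_linear_intro)
    show "\<Phi> (\<xi> + \<eta>) = \<Phi> \<xi> + \<Phi> \<eta>" for \<xi> \<eta>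
      using tendsto_add[OF \<Phi>[of \<xi>] \<Phi>[of \<eta>]] \<Phi>[of "\<xi> + \<eta>"]
      by (auto simp: blinfun.bilinear_simps intro: LIMSEQ_unique)
    show "\<Phi> (r *\<^sub>R \<xi>) = r *\<^sub>R \<Phi> \<xi>" for r \<xi>
      using tendsto_mult_left[OF \<Phi>[of \<xi>], of r] \<Phi>[of "r *\<^sub>R \<xi>"]
      by (auto simp: blinfun.bilinear_simps intro: LIMSEQ_unique)
    show "norm (\<Phi> \<xi>) \<le> norm \<xi> * K" for \<xi>
    proof (rule LIMSEQ_le_const2[OF tendsto_norm[OF \<Phi>]])
      have "norm (\<xi> (x n)) \<le> norm \<xi> * K" for n
        using norm_blinfun[of \<xi> "x n"] mult_left_mono[OF bnd[of n], of "norm \<xi>"] by simp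
      then show "\<exists>N. \<forall>n\<ge>N. norm (\<xi> (x n)) \<le> norm \<xi> * K" by blast
    qed
  qed
  then have Bl: "Blinfun \<Phi> \<xi> = \<Phi> \<xi>" for \<xi> by (simp add: bounded_linear_Blinfun_apply)
  obtain l where "\<forall>\<xi>. Blinfun \<Phi> \<xi> = \<xi> l" using refl unfolding reflexive_space_def by blast
  then have l: "\<Phi> \<xi> = \<xi> l" for \<xi> using Bl by simp
  have "h \<bullet> \<iota> l = h \<bullet> y" for h
    using \<Phi>[of "adjoint_embedding \<iota> h"] lim[of h] l[of "adjoint_embedding \<iota> h"]
    by (auto intro: LIMSEQ_unique)
  then have "\<iota> l = y" by (metis vector_eq_ldot)
  then show ?thesis using \<Phi> l that by (simp add: weakly_converges_def)
qed

lemma weakly_converges_norm_le: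
  assumes "weakly_converges x l" "\<And>n. norm (x n) \<le> K"
  shows "norm l \<le> K"
proof -
  obtain \<xi> where \<xi>: "norm \<xi> \<le> 1" "blinfun_apply \<xi> l = norm l" using norming_functional by blast
  have "\<xi> (x n) \<le> K" for n
    using norm_blinfun[of \<xi> "x n"] mult_right_mono[OF \<xi>(1), of "norm (x n)"] assms(2)[of n] by simp
  moreover have "(\<lambda>n. \<xi> (x n)) \<longlonglongrightarrow> \<xi> l" using assms(1) by (simp add: weakly_converges_def)
  ultimately show ?thesis using \<xi>(2) by (metis LIMSEQ_le_const2)
qed

text \<open>The same density argument as for \<open>weak_convergence_lift\<close>, with the Riesz
  representation in place of reflexivity.\<close>

lemma weak_limit_in_hilbert_space:
  fixes x :: "nat \<Rightarrow> 'h::{real_inner, complete_space}"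
  assumes bnd: "\<And>n. norm (x n) \<le> K" and D: "closure D = UNIV"
    and conv: "\<And>d. d \<in> D \<Longrightarrow> convergent (\<lambda>n. x n \<bullet> d)"
  obtains y where "\<And>h. (\<lambda>n. x n \<bullet> h) \<longlonglongrightarrow> y \<bullet> h"
proof -
  have K: "0 \<le> K" using bnd[of 0] norm_ge_zero order_trans by blast
  have conv: "convergent (\<lambda>n. x n \<bullet> h)" for h
  proof (rule convergent_by_approximation)
    fix e :: real assume e: "0 < e"
    obtain d where d: "d \<in> D" "dist h d < e / (K + 1)"
      using dense_approx[OF D, of "e / (K + 1)"] e K by (metis add_nonneg_pos divide_pos_pos zero_less_one)
    have "\<bar>x n \<bullet> h - x n \<bullet> d\<bar> \<le> e" for n
    proof -
      have "\<bar>x n \<bullet> h - x n \<bullet> d\<bar> \<le> norm (x n) * norm (h - d)"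
        using Cauchy_Schwarz_ineq2[of "x n" "h - d"] by (simp add: inner_simps)
      also have "\<dots> \<le> K * (e / (K + 1))" using d(2) bnd e K by (intro mult_mono) (auto simp: dist_norm)
      also have "\<dots> \<le> e" using e K by (simp add: field_simps)
      finally show ?thesis .
    qed
    then show "\<exists>b. convergent b \<and> (\<forall>\<^sub>F n in sequentially. \<bar>x n \<bullet> h - b n\<bar> \<le> e)" using conv[OF d(1)] by auto
  qed
  define L where "L h = lim (\<lambda>n. x n \<bullet> h)" for h
  have L: "(\<lambda>n. x n \<bullet> h) \<longlonglongrightarrow> L h" for h
    unfolding L_def using conv convergent_LIMSEQ_iff by blast
  have "bounded_linear L"
  proof (rule bounded_linear_intro)
    show "L (g + h) = L g + L h" for g h
      using tendsto_add[OF L[of g] L[of h]] L[of "g + h"] by (auto simp: inner_simps intro: LIMSEQ_unique)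
    show "L (r *\<^sub>R h) = r *\<^sub>R L h" for r h
      using tendsto_mult_left[OF L[of h], of r] L[of "r *\<^sub>R h"] by (auto intro: LIMSEQ_unique)
    show "norm (L h) \<le> norm h * K" for h
    proof (rule LIMSEQ_le_const2[OF tendsto_norm[OF L]])
      have "norm (x n \<bullet> h) \<le> norm h * K" for n
        using Cauchy_Schwarz_ineq2[of "x n" h] mult_left_mono[OF bnd[of n], of "norm h"]
        by (simp add: mult.commute)
      then show "\<exists>N. \<forall>n\<ge>N. norm (x n \<bullet> h) \<le> norm h * K" by blast
    qed
  qed
  then have Bl: "Blinfun L h = L h" for h by (simp add: bounded_linear_Blinfun_apply)
  obtain y where "\<And>h. Blinfun L h = y \<bullet> h" using riesz_representation by blast
  then show ?thesis using L Bl that by metis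
qed

section \<open>Bochner measurability without second countability\<close>

lemma abs_integral_le:
  fixes f g :: "'a \<Rightarrow> real"
  assumes "integrable M f" "integrable M g" "AE x in M. \<bar>f x\<bar> \<le> g x"
  shows "\<bar>\<integral>x. f x \<partial>M\<bar> \<le> (\<integral>x. g x \<partial>M)"
proof -
  have "\<bar>\<integral>x. f x \<partial>M\<bar> \<le> (\<integral>x. \<bar>f x\<bar> \<partial>M)" by (rule integral_abs_bound)
  also have "\<dots> \<le> (\<integral>x. g x \<partial>M)" using assms by (intro integral_mono_AE) auto
  finally show ?thesis .
qed

lemma tendsto_by_bound:
  fixes a b :: "nat \<Rightarrow> real"
  assumes "\<And>n. \<bar>a n - l\<bar> \<le> b n" "b \<longlonglongrightarrow> 0"
  shows "a \<longlonglongrightarrow> l"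
proof -
  have "(\<lambda>n. a n - l) \<longlonglongrightarrow> 0"
    by (rule Lim_null_comparison[OF _ assms(2)]) (use assms(1) in auto)
  then show ?thesis by (rule LIM_zero_cancel)
qed

lemma complete_measure_lebesgue_on:
  assumes "S \<in> sets lebesgue"
  shows "complete_measure (lebesgue_on S)"
proof
  fix A B assume "B \<subseteq> A" "A \<in> null_sets (lebesgue_on S)"
  then have "A \<subseteq> S" "A \<in> null_sets lebesgue" using assms by (auto simp: null_sets_restrict_space)
  with \<open>B \<subseteq> A\<close> have "B \<subseteq> S" "B \<in> sets lebesgue" by (auto intro: completion.complete)
  then show "B \<in> sets (lebesgue_on S)" using assms by (simp add: sets_restrict_space_iff)
qed

context complete_measure
begin

lemma measurable_AE:
  assumes f: "f \<in> measurable M N" and g: "\<And>x. x \<in> space M \<Longrightarrow> g x \<in> space N"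
    and eq: "AE x in M. f x = g x"
  shows "g \<in> measurable M N"
proof (rule measurableI)
  fix B assume B: "B \<in> sets N"
  obtain Z where Z: "{x \<in> space M. f x \<noteq> g x} \<subseteq> Z" "Z \<in> null_sets M"
    using eq by (auto elim!: AE_E simp: null_sets_def)
  have "g -` B \<inter> space M = ((f -` B \<inter> space M) - Z) \<union> (g -` B \<inter> space M \<inter> Z)"
    using Z(1) by auto
  moreover have "g -` B \<inter> space M \<inter> Z \<in> sets M" by (rule complete[OF _ Z(2)]) auto
  moreover have "Z \<in> sets M" using Z(2) by auto
  ultimately show "g -` B \<inter> space M \<in> sets M" using measurable_sets[OF f B] by (metis sets.Diff sets.Un)
qed (rule g)

lemma borel_measurable_AE_limit:
  fixes f :: "'a \<Rightarrow> real"
  assumes s: "\<And>i. s i \<in> borel_measurable M" and lim: "AE x in M. (\<lambda>i. s i x) \<longlonglongrightarrow> f x"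
  shows "f \<in> borel_measurable M"
proof (rule measurable_AE)
  show "(\<lambda>x. lim (\<lambda>i. s i x)) \<in> borel_measurable M" using s by measurable
  show "AE x in M. lim (\<lambda>i. s i x) = f x" using lim by eventually_elim (rule limI)
qed auto

lemma bochner_measurable_real:
  fixes f :: "'a \<Rightarrow> real"
  shows "bochner_measurable M f \<longleftrightarrow> f \<in> borel_measurable M"
proof
  assume "bochner_measurable M f"
  then show "f \<in> borel_measurable M"
    unfolding bochner_measurable_def using borel_measurable_AE_limit borel_measurable_simple_function by metis
next
  assume "f \<in> borel_measurable M"
  from borel_measurable_implies_sequence_metric[OF this, of 0]
  obtain F where "\<And>i. simple_function M (F i)" "\<And>x. x \<in> space M \<Longrightarrow> (\<lambda>i. F i x) \<longlonglongrightarrow> f x" by blast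
  then show "bochner_measurable M f" unfolding bochner_measurable_def by (intro exI[of _ F]) (auto intro: AE_I2)
qed

end

lemma bochner_measurable_compose2:
  assumes f: "bochner_measurable M f" and g: "bochner_measurable M g"
    and c: "\<And>a b x y. a \<longlonglongrightarrow> x \<Longrightarrow> b \<longlonglongrightarrow> y \<Longrightarrow> (\<lambda>i. c (a i) (b i)) \<longlonglongrightarrow> c x y"
  shows "bochner_measurable M (\<lambda>x. c (f x) (g x))"
proof -
  obtain s where s: "\<And>i. simple_function M (s i)" "AE x in M. (\<lambda>i. s i x) \<longlonglongrightarrow> f x"
    using f unfolding bochner_measurable_def by blast
  obtain t where t: "\<And>i. simple_function M (t i)" "AE x in M. (\<lambda>i. t i x) \<longlonglongrightarrow> g x"
    using g unfolding bochner_measurable_def by blast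
  show ?thesis
    unfolding bochner_measurable_def
  proof (intro exI conjI allI)
    show "simple_function M (\<lambda>x. c (s i x) (t i x))" for i
      using s(1) t(1) by (rule simple_function_compose2)
    show "AE x in M. (\<lambda>i. c (s i x) (t i x)) \<longlonglongrightarrow> c (f x) (g x)"
      using s(2) t(2) by eventually_elim (rule c)
  qed
qed

lemma bochner_measurable_compose:
  assumes f: "bochner_measurable M f" and c: "\<And>a x. a \<longlonglongrightarrow> x \<Longrightarrow> (\<lambda>i. c (a i)) \<longlonglongrightarrow> c x"
  shows "bochner_measurable M (\<lambda>x. c (f x))"
  using bochner_measurable_compose2[OF f f, of "\<lambda>x y. c x"] c by blast

lemma bochner_measurable_const: "bochner_measurable M (\<lambda>x. c)"
  unfolding bochner_measurable_def by (intro exI[of _ "\<lambda>i x. c"]) auto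

lemma bochner_measurable_add:
  "bochner_measurable M f \<Longrightarrow> bochner_measurable M g \<Longrightarrow> bochner_measurable M (\<lambda>x. f x + g x)"
  by (rule bochner_measurable_compose2[where c="(+)"]) (auto intro: tendsto_add)

lemma bochner_measurable_diff:
  "bochner_measurable M f \<Longrightarrow> bochner_measurable M g \<Longrightarrow> bochner_measurable M (\<lambda>x. f x - g x)"
  by (rule bochner_measurable_compose2[where c="(-)"]) (auto intro: tendsto_diff)

lemma bochner_measurable_sum:
  "(\<And>i. i \<in> I \<Longrightarrow> bochner_measurable M (f i)) \<Longrightarrow> bochner_measurable M (\<lambda>x. \<Sum>i\<in>I. f i x)"
  by (induction I rule: infinite_finite_induct)
     (simp_all add: bochner_measurable_const bochner_measurable_add)

lemma bochner_measurable_blinfun_apply: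
  "bochner_measurable M f \<Longrightarrow> bochner_measurable M (\<lambda>x. blinfun_apply L (f x))"
  by (rule bochner_measurable_compose[where c="blinfun_apply L"]) (auto intro: tendsto_intros)

context complete_measure
begin

lemma bochner_measurable_scaleR:
  fixes c :: "'a \<Rightarrow> real"
  assumes "c \<in> borel_measurable M" "bochner_measurable M f"
  shows "bochner_measurable M (\<lambda>x. c x *\<^sub>R f x)"
  using assms bochner_measurable_compose2[of M c f scaleR] by (simp add: bochner_measurable_real tendsto_scaleR)

lemma bochner_measurable_norm:
  assumes "bochner_measurable M f"
  shows "(\<lambda>x. norm (f x)) \<in> borel_measurable M"
  using bochner_measurable_compose[OF assms, of norm] by (simp add: bochner_measurable_real tendsto_norm)

lemma bochner_measurable_pairing:
  fixes F :: "'a \<Rightarrow> 'v::real_normed_vector \<Rightarrow>\<^sub>L real"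
  assumes "bochner_measurable M F" "bochner_measurable M v"
  shows "(\<lambda>x. F x (v x)) \<in> borel_measurable M"
  using bochner_measurable_compose2[OF assms, of blinfun_apply]
  by (simp add: bochner_measurable_real blinfun.tendsto)

end

text \<open>Pettis' criterion: in a separable space countably many functionals determine the norm, so the
  distances to a dense sequence are measurable, and the nearest points among the first \<open>i\<close> terms of
  the sequence form simple functions.\<close>

lemma bochner_measurable_weak:
  fixes v :: "'a \<Rightarrow> 'v::real_normed_vector"
  assumes sep: "separable_space (euclidean :: 'v topology)"
    and meas: "\<And>\<xi> :: 'v \<Rightarrow>\<^sub>L real. (\<lambda>t. \<xi> (v t)) \<in> borel_measurable M"
  shows "bochner_measurable M v"
proof -
  obtain D :: "'v set" where D: "countable D" "closure D = UNIV"
    using sep by (auto simp: separable_space_def)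
  then have "D \<noteq> {}" by auto
  then obtain d :: "nat \<Rightarrow> 'v" where d: "range d = D" using D(1) uncountable_def by metis
  have near: "\<exists>k. dist x (d k) < e" if "0 < e" for x e
    using dense_approx[OF D(2) that, of x] d by (metis rangeE)
  have "\<exists>\<xi> :: 'v \<Rightarrow>\<^sub>L real. norm \<xi> \<le> 1 \<and> blinfun_apply \<xi> (d k) = norm (d k)" for k
    using norming_functional by metis
  then obtain \<xi> :: "nat \<Rightarrow> 'v \<Rightarrow>\<^sub>L real" where \<xi>: "\<And>k. norm (\<xi> k) \<le> 1" "\<And>k. \<xi> k (d k) = norm (d k)"
    by metis
  have le: "\<xi> k x \<le> norm x" for k x
    using norm_blinfun[of "\<xi> k" x] mult_right_mono[OF \<xi>(1)[of k], of "norm x"] by simp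
  have norm_eq: "norm x = (SUP k. \<xi> k x)" for x
  proof (rule antisym)
    have bdd: "bdd_above (range (\<lambda>k. \<xi> k x))" using le by (intro bdd_aboveI2)
    show "norm x \<le> (SUP k. \<xi> k x)"
    proof (rule field_le_epsilon)
      fix e :: real assume "0 < e"
      \<comment> \<open>Both \<open>\<xi> k x\<close> and \<open>norm x\<close> differ from
        \<open>norm (d k)\<close> by at most the distance from \<open>x\<close> to
        \<open>d k\<close>, hence the half.\<close>
      then obtain k where k: "dist x (d k) < e/2" using near[of "e/2"] by auto
      have "\<xi> k x = norm (d k) - \<xi> k (d k - x)" by (simp add: blinfun.bilinear_simps \<xi>(2))
      moreover have "norm x \<le> norm (d k) + norm (d k - x)" using norm_triangle_sub[of x "d k"] by (simp add: norm_minus_commute)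
      ultimately have "norm x \<le> \<xi> k x + e"
        using le[of k "d k - x"] k by (simp add: dist_norm norm_minus_commute)
      also have "\<xi> k x \<le> (SUP k. \<xi> k x)" by (rule cSUP_upper[OF _ bdd]) simp
      finally show "norm x \<le> (SUP k. \<xi> k x) + e" by simp
    qed
    show "(SUP k. \<xi> k x) \<le> norm x" by (rule cSUP_least) (auto simp: le)
  qed
  define \<delta> where "\<delta> k t = norm (v t - d k)" for k t
  have [measurable]: "\<delta> k \<in> borel_measurable M" for k
  proof -
    have "(\<lambda>t. SUP j. \<xi> j (v t) - \<xi> j (d k)) \<in> borel_measurable M"
    proof (rule borel_measurable_cSUP)
      show "(\<lambda>t. \<xi> j (v t) - \<xi> j (d k)) \<in> borel_measurable M" for j using meas by measurable
      show "bdd_above (range (\<lambda>j. \<xi> j (v t) - \<xi> j (d k)))" for t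
        using le[of _ "v t - d k"] by (intro bdd_aboveI2[of _ _ "norm (v t - d k)"]) (simp add: blinfun.bilinear_simps)
    qed simp
    moreover have "\<delta> k = (\<lambda>t. SUP j. \<xi> j (v t) - \<xi> j (d k))"
      by (rule ext) (simp add: \<delta>_def norm_eq[of "v _ - d k"] blinfun.bilinear_simps)
    ultimately show ?thesis by simp
  qed
  define K where "K i t = (LEAST k. k \<le> i \<and> (\<forall>l\<le>i. \<delta> k t \<le> \<delta> l t))" for i t
  have K: "K i t \<le> i \<and> (\<forall>l\<le>i. \<delta> (K i t) t \<le> \<delta> l t)" for i t
  proof -
    obtain k where "k \<in> {..i}" "\<forall>l\<in>{..i}. \<delta> k t \<le> \<delta> l t"
      using ex_min_if_finite[of "(\<lambda>l. \<delta> l t) ` {..i}"] by (force simp: not_less)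
    then show ?thesis unfolding K_def using LeastI[of "\<lambda>k. k \<le> i \<and> (\<forall>l\<le>i. \<delta> k t \<le> \<delta> l t)" k] by simp
  qed
  have [measurable]: "K i \<in> measurable M (count_space UNIV)" for i
    unfolding K_def by measurable
  show ?thesis
    unfolding bochner_measurable_def
  proof (intro exI conjI allI)
    have "simple_function M (K i)" for i
      unfolding simple_function_eq_measurable
      using K by (auto intro!: finite_subset[of "K i ` space M" "{..i}"])
    then show "simple_function M (\<lambda>t. d (K i t))" for i by (rule simple_function_compose1)
    show "AE t in M. (\<lambda>i. d (K i t)) \<longlonglongrightarrow> v t"
    proof (rule AE_I2)
      fix t
      show "(\<lambda>i. d (K i t)) \<longlonglongrightarrow> v t"
      proof (rule metric_LIMSEQ_I)
        fix e :: real assume "0 < e"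
        then obtain k where k: "dist (v t) (d k) < e" using near by blast
        have "dist (d (K i t)) (v t) < e" if "k \<le> i" for i
          using K[of i t] that k by (auto simp: \<delta>_def dist_norm norm_minus_commute intro: le_less_trans)
        then show "\<exists>N. \<forall>n\<ge>N. dist (d (K n t)) (v t) < e" by blast
      qed
    qed
  qed
qed

section \<open>Approximation by simple functions and existence of the Bochner integral\<close>

context complete_measure
begin

text \<open>Approximants that exceed twice the norm of the target are replaced by 0. Where the
  target is nonzero, the factor 2 leaves room, so eventually nothing is replaced; where it is zero,
  every approximant becomes 0. The result has the domination that the dominated convergence theorem
  requires.\<close>

lemma bochner_dominated_simple_approx:
  fixes v :: "'a \<Rightarrow> 'b::real_normed_vector"
  assumes v: "bochner_measurable M v"
  obtains s where "\<And>i::nat. simple_function M (s i)" "\<And>i x. norm (s i x) \<le> 2 * norm (v x)"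
    "AE x in M. (\<lambda>i. s i x) \<longlonglongrightarrow> v x"
proof -
  obtain r where r: "\<And>i::nat. simple_function M (r i)" "AE x in M. (\<lambda>i. r i x) \<longlonglongrightarrow> v x"
    using v unfolding bochner_measurable_def by blast
  define s where "s i x = (if norm (r i x) \<le> 2 * norm (v x) then r i x else 0)" for i x
  show ?thesis
  proof
    fix i
    have [measurable]: "(\<lambda>x. norm (v x)) \<in> borel_measurable M" by (rule bochner_measurable_norm[OF v])
    have [measurable]: "(\<lambda>x. norm (r i x)) \<in> borel_measurable M"
      by (intro borel_measurable_simple_function simple_function_compose1[of M "r i" norm] r(1))
    show "simple_function M (s i)"
      unfolding s_def by (intro simple_function_If r(1) simple_function_const) measurable
  next
    show "norm (s i x) \<le> 2 * norm (v x)" for i x by (simp add: s_def)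
    show "AE x in M. (\<lambda>i. s i x) \<longlonglongrightarrow> v x"
      using r(2)
    proof eventually_elim
      fix x assume lim: "(\<lambda>i. r i x) \<longlonglongrightarrow> v x"
      show "(\<lambda>i. s i x) \<longlonglongrightarrow> v x"
      proof (cases "v x = 0")
        case True
        then show ?thesis by (simp add: s_def cong: if_cong)
      next
        case False
        then have "\<forall>\<^sub>F i in sequentially. norm (r i x) < 2 * norm (v x)"
          by (intro order_tendstoD(2)[OF tendsto_norm[OF lim]]) simp
        then have "\<forall>\<^sub>F i in sequentially. r i x = s i x"
          by eventually_elim (simp add: s_def)
        then show ?thesis using lim by (rule Lim_transform_eventually[rotated])
      qed
    qed
  qed
qed

lemma bochner_Lp_simple_approx:
  fixes v :: "'a \<Rightarrow> 'b::real_normed_vector"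
  assumes v: "bochner_measurable M v" and p: "0 < p" and int: "integrable M (\<lambda>x. norm (v x) powr p)"
  obtains s where "\<And>i::nat. simple_function M (s i)" "\<And>i x. norm (s i x) \<le> 2 * norm (v x)"
    "\<And>i. integrable M (\<lambda>x. norm (v x - s i x) powr p)"
    "(\<lambda>i. \<integral>x. norm (v x - s i x) powr p \<partial>M) \<longlonglongrightarrow> 0"
proof -
  obtain s where s: "\<And>i::nat. simple_function M (s i)" "\<And>i x. norm (s i x) \<le> 2 * norm (v x)"
    "AE x in M. (\<lambda>i. s i x) \<longlonglongrightarrow> v x" using bochner_dominated_simple_approx[OF v] by blast
  have bms: "bochner_measurable M (s i)" for i
    unfolding bochner_measurable_def using s(1) by (intro exI[of _ "\<lambda>_. s i"]) auto
  have [measurable]: "(\<lambda>x. norm (v x - s i x)) \<in> borel_measurable M" for i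
    by (intro bochner_measurable_norm bochner_measurable_diff v bms)
  have bound: "norm (norm (v x - s i x) powr p) \<le> 3 powr p * norm (v x) powr p" for i x
  proof -
    have "norm (v x - s i x) \<le> 3 * norm (v x)"
      using norm_triangle_ineq4[of "v x" "s i x"] s(2)[of i x] by simp
    then have "norm (v x - s i x) powr p \<le> (3 * norm (v x)) powr p" using p by (intro powr_mono2) auto
    then show ?thesis by (simp add: powr_mult)
  qed
  have lim: "AE x in M. (\<lambda>i. norm (v x - s i x) powr p) \<longlonglongrightarrow> 0"
    using s(3)
  proof eventually_elim
    fix x assume "(\<lambda>i. s i x) \<longlonglongrightarrow> v x"
    then have "(\<lambda>i. norm (v x - s i x)) \<longlonglongrightarrow> norm (v x - v x)" by (intro tendsto_intros)
    then have "(\<lambda>i. norm (v x - s i x) powr p) \<longlonglongrightarrow> 0 powr p"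
      using p by (intro tendsto_powr2) auto
    then show "(\<lambda>i. norm (v x - s i x) powr p) \<longlonglongrightarrow> 0" using p by simp
  qed
  have bi: "integrable M (\<lambda>x. 3 powr p * norm (v x) powr p)" using int by simp
  have "(\<lambda>i. \<integral>x. norm (v x - s i x) powr p \<partial>M) \<longlonglongrightarrow> (\<integral>x. 0 \<partial>M)"
    by (rule integral_dominated_convergence[OF _ _ bi lim]) (use bound in auto)
  moreover have "integrable M (\<lambda>x. norm (v x - s i x) powr p)" for i
    by (rule Bochner_Integration.integrable_bound[OF bi]) (use bound in auto)
  ultimately show ?thesis using s by (intro that) auto
qed

lemma bochner_integral_exists:
  fixes f :: "'a \<Rightarrow> 'b::banach"
  assumes f: "bochner_measurable M f" and int: "integrable M (\<lambda>x. norm (f x))"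
  obtains I where "bochner_integral_is M f I" "\<And>\<xi> :: 'b \<Rightarrow>\<^sub>L real. \<xi> I = (\<integral>x. \<xi> (f x) \<partial>M)"
proof -
  obtain s where s: "\<And>i::nat. simple_function M (s i)" "\<And>i x. norm (s i x) \<le> 2 * norm (f x)"
    "\<And>i. integrable M (\<lambda>x. norm (f x - s i x))" "(\<lambda>i. \<integral>x. norm (f x - s i x) \<partial>M) \<longlonglongrightarrow> 0"
    using bochner_Lp_simple_approx[OF f, of 1] int by (auto simp: powr_one)
  define a where "a i = (\<integral>x. norm (f x - s i x) \<partial>M)" for i
  have nint: "integrable M (\<lambda>x. norm (s i x))" for i
  proof (rule Bochner_Integration.integrable_bound)
    show "integrable M (\<lambda>x. 2 * norm (f x))" using int by simp
    show "(\<lambda>x. norm (s i x)) \<in> borel_measurable M"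
      by (intro borel_measurable_simple_function simple_function_compose1[of M "s i" norm] s(1))
  qed (use s(2) in auto)
  have sbi: "Bochner_Integration.simple_bochner_integrable M (s i)" for i
  proof (rule simple_bochner_integrableI_bounded[OF s(1)])
    show "(\<integral>\<^sup>+x. norm (s i x) \<partial>M) < \<infinity>" using nint[of i] by (simp add: integrable_iff_bounded)
  qed
  define J where "J i = Bochner_Integration.simple_bochner_integral M (s i)" for i
  have J: "norm (J i - J k) \<le> a i + a k" for i k
  proof -
    have sd: "Bochner_Integration.simple_bochner_integrable M (\<lambda>x. s i x - s k x)"
      by (rule simple_bochner_integrable_compose2[of "(-)"]) (auto simp: sbi)
    have sn: "Bochner_Integration.simple_bochner_integrable M (\<lambda>x. norm (s i x - s k x))"
      by (rule simple_bochner_integrable_compose2[of "\<lambda>x y. norm (x - y)"]) (auto simp: sbi)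
    have "norm (J i - J k) \<le> Bochner_Integration.simple_bochner_integral M (\<lambda>x. norm (s i x - s k x))"
      unfolding J_def simple_bochner_integral_diff[OF sbi sbi, symmetric]
      by (rule simple_bochner_integral_norm_bound[OF sd])
    also have "\<dots> = (\<integral>x. norm (s i x - s k x) \<partial>M)" by (rule simple_bochner_integrable_eq_integral[OF sn])
    also have "\<dots> \<le> (\<integral>x. norm (f x - s i x) + norm (f x - s k x) \<partial>M)"
    proof (rule integral_mono)
      show "integrable M (\<lambda>x. norm (s i x - s k x))" by (rule integrableI_simple_bochner_integrable[OF sn])
      show "norm (s i x - s k x) \<le> norm (f x - s i x) + norm (f x - s k x)" for x
        using norm_triangle_ineq4[of "f x - s k x" "f x - s i x"] by simp
    qed (use s(3) in auto)
    also have "\<dots> = a i + a k" unfolding a_def using s(3)[of i] s(3)[of k] by simp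
    finally show ?thesis .
  qed
  have "Cauchy J"
  proof (rule CauchyI)
    fix e :: real assume "0 < e"
    then have "\<forall>\<^sub>F i in sequentially. a i < e/2" using s(4) by (intro order_tendstoD) (auto simp: a_def)
    then obtain N where N: "\<And>i. N \<le> i \<Longrightarrow> a i < e/2" by (auto simp: eventually_sequentially)
    have "norm (J m - J n) < e" if "N \<le> m" "N \<le> n" for m n
      using J[of m n] N[OF that(1)] N[OF that(2)] by simp
    then show "\<exists>M. \<forall>m\<ge>M. \<forall>n\<ge>M. norm (J m - J n) < e" by blast
  qed
  then obtain I where I: "J \<longlonglongrightarrow> I" using Cauchy_convergent convergent_def by blast
  show ?thesis
  proof
    have "(\<integral>\<^sup>+x. norm (f x - s i x) \<partial>M) = ennreal (a i)" for i
      unfolding a_def using s(3) by (intro nn_integral_eq_integral) auto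
    then have "(\<lambda>i. \<integral>\<^sup>+x. norm (f x - s i x) \<partial>M) \<longlonglongrightarrow> 0"
      using tendsto_ennrealI[OF s(4)] by (simp add: a_def)
    then show "bochner_integral_is M f I"
      unfolding bochner_integral_is_def using f sbi I unfolding J_def by (intro conjI exI[of _ s]) auto
    fix \<xi> :: "'b \<Rightarrow>\<^sub>L real"
    have "(\<lambda>i. \<xi> (J i)) \<longlonglongrightarrow> \<xi> I" by (intro tendsto_intros I)
    moreover have "(\<lambda>i. \<xi> (J i)) \<longlonglongrightarrow> (\<integral>x. \<xi> (f x) \<partial>M)"
    proof -
      have 1: "Bochner_Integration.simple_bochner_integrable M (\<lambda>x. \<xi> (s i x))" for i
        using simple_bochner_integrable_compose2[of "\<lambda>x y. \<xi> x" M "s i" "s i"] sbi by simp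
      have 2: "\<xi> (J i) = (\<integral>x. \<xi> (s i x) \<partial>M)" for i
        unfolding J_def simple_bochner_integrable_eq_integral[OF 1, symmetric]
        by (rule simple_bochner_integral_linear[OF _ sbi, symmetric])
           (simp add: blinfun.bounded_linear_right bounded_linear.linear)
      have fi: "integrable M (\<lambda>x. \<xi> (f x))"
      proof (rule Bochner_Integration.integrable_bound)
        show "integrable M (\<lambda>x. norm \<xi> * norm (f x))" using int by simp
        show "(\<lambda>x. \<xi> (f x)) \<in> borel_measurable M"
          using bochner_measurable_blinfun_apply[OF f, of \<xi>] by (simp add: bochner_measurable_real)
      qed (use norm_blinfun[of \<xi>] in auto)
      have "norm (\<xi> (J i) - (\<integral>x. \<xi> (f x) \<partial>M)) \<le> norm \<xi> * a i" for i
      proof -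
        have "\<xi> (J i) - (\<integral>x. \<xi> (f x) \<partial>M) = (\<integral>x. \<xi> (s i x) - \<xi> (f x) \<partial>M)"
          unfolding 2 using fi integrableI_simple_bochner_integrable[OF 1] by simp
        also have "norm \<dots> \<le> (\<integral>x. norm \<xi> * norm (f x - s i x) \<partial>M)"
          unfolding real_norm_def
        proof (rule abs_integral_le)
          show "AE x in M. \<bar>\<xi> (s i x) - \<xi> (f x)\<bar> \<le> norm \<xi> * norm (f x - s i x)"
            using norm_blinfun[of \<xi> "s i _ - f _"]
            by (intro AE_I2) (simp add: blinfun.bilinear_simps norm_minus_commute)
        qed (use fi integrableI_simple_bochner_integrable[OF 1] s(3) in auto)
        finally show ?thesis by (simp add: a_def)
      qed
      moreover have "(\<lambda>i. norm \<xi> * a i) \<longlonglongrightarrow> 0" using tendsto_mult_left[OF s(4), of "norm \<xi>"] by (simp add: a_def)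
      ultimately show ?thesis unfolding real_norm_def by (rule tendsto_by_bound)
    qed
    ultimately show "\<xi> I = (\<integral>x. \<xi> (f x) \<partial>M)" by (rule LIMSEQ_unique)
  qed
qed

end

section \<open>Integrals over a time interval\<close>

lemma conjugate_exponent:
  fixes p q :: real
  assumes "1 < p" "1 / p + 1 / q = 1"
  shows "1 < q" "(p - 1) * q = p"
proof -
  have "1 / q = 1 - 1 / p" using assms(2) by simp
  moreover have "0 < 1 - 1 / p" "1 - 1 / p < 1" using assms(1) by auto
  ultimately have q: "0 < 1 / q" "1 / q < 1" by auto
  then have "0 < q" by simp
  then show "1 < q" using q(2) by simp
  show "(p - 1) * q = p" using assms \<open>0 < q\<close> by (simp add: field_simps)
qed

lemma young_epsilon:
  fixes p q l :: real
  assumes p: "1 < p" "1 / p + 1 / q = 1" and l: "0 < l"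
  obtains C where "0 < C" "\<And>a b. 0 \<le> a \<Longrightarrow> 0 \<le> b \<Longrightarrow> a * b \<le> l * a powr q + C * b powr p"
proof
  have q: "1 < q" using conjugate_exponent[OF p] by simp
  \<comment> \<open>Young's inequality is applied to the factors \<open>m * a\<close> and
    \<open>b / m\<close>; the q-th power of \<open>m\<close> is \<open>l\<close>. The coefficients
    1/p and 1/q are at most 1 and are dropped.\<close>
  define m where "m = l powr (1 / q)"
  have m: "0 < m" "m powr q = l" using l q by (auto simp: m_def powr_powr)
  show "0 < (1 / m) powr p" using m by simp
  fix a b :: real assume a: "0 \<le> a" and b: "0 \<le> b"
  have "a * b = (b / m) * (m * a)" using m by simp
  also have "\<dots> \<le> (b / m) powr p / p + (m * a) powr q / q"
    using a b m p q by (intro Youngs_inequality) auto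
  also have "(b / m) powr p / p \<le> (1 / m) powr p * b powr p"
  proof -
    have "(b / m) powr p = (1 / m) powr p * b powr p" using powr_mult[of "1 / m" b p] by simp
    then show ?thesis using p mult_left_mono[of 1 p "(1 / m) powr p * b powr p"] by (simp add: divide_le_eq)
  qed
  also have "(m * a) powr q / q \<le> l * a powr q"
    using q m a l mult_left_mono[of 1 q "l * a powr q"] by (simp add: powr_mult divide_le_eq)
  finally show "a * b \<le> l * a powr q + (1 / m) powr p * b powr p" by simp
qed

lemma powr_add_le:
  fixes a b p :: real
  assumes "0 \<le> a" "0 \<le> b" "0 < p"
  shows "(a + b) powr p \<le> 2 powr p * (a powr p + b powr p)"
proof -
  have "(a + b) powr p \<le> (2 * max a b) powr p" using assms by (intro powr_mono2) auto
  also have "\<dots> = 2 powr p * max a b powr p" using assms by (simp add: powr_mult)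
  also have "max a b powr p \<le> a powr p + b powr p" by (simp add: max_def)
  finally show ?thesis by simp
qed

lemma abs_triangle_products:
  fixes a :: real
  shows "\<bar>a * b + c * d + (e * f + g * h)\<bar> \<le> \<bar>a\<bar> * \<bar>b\<bar> + \<bar>c\<bar> * \<bar>d\<bar> + (\<bar>e\<bar> * \<bar>f\<bar> + \<bar>g\<bar> * \<bar>h\<bar>)"
  unfolding abs_mult[symmetric] by linarith

lemma integrable_powr_diff:
  fixes a b :: "'a \<Rightarrow> 'b::real_normed_vector"
  assumes p: "0 < p" and "integrable M (\<lambda>x. norm (a x) powr p)" "integrable M (\<lambda>x. norm (b x) powr p)"
    and m: "(\<lambda>x. norm (a x - b x)) \<in> borel_measurable M"
  shows "integrable M (\<lambda>x. norm (a x - b x) powr p)"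
    and "(\<integral>x. norm (a x - b x) powr p \<partial>M)
      \<le> 2 powr p * ((\<integral>x. norm (a x) powr p \<partial>M) + (\<integral>x. norm (b x) powr p \<partial>M))"
proof -
  have le: "norm (a x - b x) powr p \<le> 2 powr p * (norm (a x) powr p + norm (b x) powr p)" for x
  proof -
    have "norm (a x - b x) powr p \<le> (norm (a x) + norm (b x)) powr p"
      using p by (intro powr_mono2 norm_triangle_ineq4) auto
    also have "\<dots> \<le> 2 powr p * (norm (a x) powr p + norm (b x) powr p)" using p by (intro powr_add_le) auto
    finally show ?thesis .
  qed
  have i: "integrable M (\<lambda>x. 2 powr p * (norm (a x) powr p + norm (b x) powr p))" using assms by simp
  show *: "integrable M (\<lambda>x. norm (a x - b x) powr p)"
    by (rule Bochner_Integration.integrable_bound[OF i]) (use m le in auto)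
  have "(\<integral>x. norm (a x - b x) powr p \<partial>M) \<le> (\<integral>x. 2 powr p * (norm (a x) powr p + norm (b x) powr p) \<partial>M)"
    by (rule integral_mono[OF * i le])
  then show "(\<integral>x. norm (a x - b x) powr p \<partial>M)
      \<le> 2 powr p * ((\<integral>x. norm (a x) powr p \<partial>M) + (\<integral>x. norm (b x) powr p \<partial>M))"
    using assms by simp
qed

text \<open>A form of Fatou's lemma: truncating each \<open>h n\<close> from above at
  \<open>g\<close> supplies an integrable majorant, and the truncated functions tend to
  \<open>g\<close>, so dominated convergence applies to them.\<close>

lemma eventually_integral_ge:
  fixes h :: "nat \<Rightarrow> 'a \<Rightarrow> real"
  assumes h: "\<And>n. integrable M (h n)" and k: "integrable M k" and g: "integrable M g"
    and lb: "\<And>n. AE x in M. - k x \<le> h n x"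
    and lim: "AE x in M. \<forall>e>0. \<forall>\<^sub>F n in sequentially. g x - e < h n x"
    and e: "0 < e"
  shows "\<forall>\<^sub>F n in sequentially. (\<integral>x. g x \<partial>M) - e < (\<integral>x. h n x \<partial>M)"
proof -
  have "(\<lambda>n. \<integral>x. min (h n x) (g x) \<partial>M) \<longlonglongrightarrow> (\<integral>x. g x \<partial>M)"
  proof (rule integral_dominated_convergence)
    show "integrable M (\<lambda>x. \<bar>k x\<bar> + \<bar>g x\<bar>)" using k g by auto
    show "g \<in> borel_measurable M" using g by auto
    show "(\<lambda>x. min (h n x) (g x)) \<in> borel_measurable M" for n
      using h[of n] g by measurable
    show "AE x in M. norm (min (h n x) (g x)) \<le> \<bar>k x\<bar> + \<bar>g x\<bar>" for n
      using lb[of n] by eventually_elim (auto simp: min_def)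
    show "AE x in M. (\<lambda>n. min (h n x) (g x)) \<longlonglongrightarrow> g x"
      using lim
    proof eventually_elim
      fix x assume x: "\<forall>e>0. \<forall>\<^sub>F n in sequentially. g x - e < h n x"
      show "(\<lambda>n. min (h n x) (g x)) \<longlonglongrightarrow> g x"
      proof (rule tendstoI)
        fix e :: real assume "0 < e"
        with x have "\<forall>\<^sub>F n in sequentially. g x - e < h n x" by blast
        then show "\<forall>\<^sub>F n in sequentially. dist (min (h n x) (g x)) (g x) < e"
          by eventually_elim (use \<open>0 < e\<close> in \<open>auto simp: dist_real_def min_def\<close>)
      qed
    qed
  qed
  then have "\<forall>\<^sub>F n in sequentially. (\<integral>x. g x \<partial>M) - e < (\<integral>x. min (h n x) (g x) \<partial>M)"
    using e by (intro order_tendstoD(1)) auto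
  then show ?thesis
  proof eventually_elim
    fix n assume "(\<integral>x. g x \<partial>M) - e < (\<integral>x. min (h n x) (g x) \<partial>M)"
    also have "\<dots> \<le> (\<integral>x. h n x \<partial>M)" using h g by (intro integral_mono) auto
    finally show "(\<integral>x. g x \<partial>M) - e < (\<integral>x. h n x \<partial>M)" .
  qed
qed

text \<open>The bridge between two integrals: the gauge integral over subintervals carries
  additivity and the fundamental theorem of calculus, the Lebesgue integral over the whole interval
  carries almost-everywhere estimates and limit theorems.\<close>

lemma integral_subinterval:
  fixes \<gamma> :: "real \<Rightarrow> real"
  assumes i: "integrable (lebesgue_on {0..T}) \<gamma>" and st: "0 \<le> s" "t \<le> T"
  shows "integrable (lebesgue_on {s..t}) \<gamma>" "\<gamma> integrable_on {s..t}"
    "integrable (lebesgue_on {0..T}) (\<lambda>r. indicator {s..t} r * \<gamma> r)"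
    "integral {s..t} \<gamma> = (\<integral>r. indicator {s..t} r * \<gamma> r \<partial>lebesgue_on {0..T})"
proof -
  have sub: "{s..t} \<subseteq> {0..T}" using st by auto
  show 1: "integrable (lebesgue_on {s..t}) \<gamma>" by (rule integrable_subinterval[OF i sub])
  then show "\<gamma> integrable_on {s..t}" by (rule integrable_on_lebesgue_on) simp
  have "{s..t} \<in> sets (lebesgue_on {0..T})" using sub by (simp add: sets_restrict_space_iff)
  then show "integrable (lebesgue_on {0..T}) (\<lambda>r. indicator {s..t} r * \<gamma> r)"
    using integrable_mult_indicator[OF _ i] by simp
  have eq: "indicator {0..T} r * (indicator {s..t} r * \<gamma> r) = indicator {s..t} r * \<gamma> r" for r
    using sub by (auto simp: indicator_def)
  have "integral {s..t} \<gamma> = integral\<^sup>L (lebesgue_on {s..t}) \<gamma>"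
    by (rule lebesgue_integral_eq_integral[OF 1, symmetric]) simp
  also have "\<dots> = (\<integral>r. indicator {s..t} r * \<gamma> r \<partial>lebesgue)"
    by (subst integral_restrict_space) auto
  also have "\<dots> = (\<integral>r. indicator {s..t} r * \<gamma> r \<partial>lebesgue_on {0..T})"
    using integral_restrict_space[of "{0..T}" lebesgue "\<lambda>r. indicator {s..t} r * \<gamma> r"] by (simp add: eq)
  finally show "integral {s..t} \<gamma> = (\<integral>r. indicator {s..t} r * \<gamma> r \<partial>lebesgue_on {0..T})" .
qed

lemma integral_full_interval:
  fixes \<gamma> :: "real \<Rightarrow> real"
  assumes "integrable (lebesgue_on {0..T}) \<gamma>"
  shows "integral {0..T} \<gamma> = (\<integral>r. \<gamma> r \<partial>lebesgue_on {0..T})"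
  using lebesgue_integral_eq_integral[OF assms] by simp

lemma integral_subinterval_le:
  fixes \<gamma> :: "real \<Rightarrow> real"
  assumes i: "integrable (lebesgue_on {0..T}) \<gamma>" and st: "0 \<le> s" "t \<le> T"
  shows "\<bar>integral {s..t} \<gamma>\<bar> \<le> (\<integral>r. \<bar>\<gamma> r\<bar> \<partial>lebesgue_on {0..T})"
  unfolding integral_subinterval(4)[OF assms]
  by (rule abs_integral_le) (use integral_subinterval(3)[OF assms] i in \<open>auto simp: indicator_def\<close>)

text \<open>The primitive is continuous on a compact interval, hence uniformly continuous.\<close>

lemma integral_absolutely_continuous:
  fixes \<gamma> :: "real \<Rightarrow> real"
  assumes i: "integrable (lebesgue_on {0..T}) \<gamma>" and e: "0 < e"
  obtains d where "0 < d" "\<And>s t. 0 \<le> s \<Longrightarrow> s \<le> t \<Longrightarrow> t \<le> T \<Longrightarrow> t - s < d \<Longrightarrow> \<bar>integral {s..t} \<gamma>\<bar> < e"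
proof -
  have int: "\<gamma> integrable_on {0..T}" using integral_subinterval(2)[OF i] by simp
  have "uniformly_continuous_on {0..T} (\<lambda>t. integral {0..t} \<gamma>)"
    by (intro compact_uniformly_continuous indefinite_integral_continuous_1 int) simp
  then obtain d where d: "0 < d"
    "\<And>s t. s \<in> {0..T} \<Longrightarrow> t \<in> {0..T} \<Longrightarrow> dist t s < d \<Longrightarrow> dist (integral {0..t} \<gamma>) (integral {0..s} \<gamma>) < e"
    using e unfolding uniformly_continuous_on_def by metis
  show ?thesis
  proof (rule that[OF d(1)])
    fix s t :: real assume st: "0 \<le> s" "s \<le> t" "t \<le> T" "t - s < d"
    have "integral {0..s} \<gamma> + integral {s..t} \<gamma> = integral {0..t} \<gamma>"
      using st integral_subinterval(2)[OF i] by (intro Henstock_Kurzweil_Integration.integral_combine) auto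
    then show "\<bar>integral {s..t} \<gamma>\<bar> < e" using d(2)[of s t] st by (auto simp: dist_real_def)
  qed
qed

lemma simple_function_sum_indicator:
  fixes s :: "'a \<Rightarrow> 'b::real_vector"
  assumes "simple_function M s" "x \<in> space M"
  shows "s x = (\<Sum>y\<in>s ` space M. indicator (s -` {y} \<inter> space M) x *\<^sub>R y)"
proof -
  have "(\<Sum>y\<in>s ` space M. indicator (s -` {y} \<inter> space M) x *\<^sub>R y) = (\<Sum>y\<in>s ` space M. if y = s x then y else 0)"
    using assms(2) by (intro sum.cong) (auto simp: indicator_def)
  also have "\<dots> = s x" using assms simple_functionD(1)[OF assms(1)] by (simp add: sum.delta)
  finally show ?thesis by simp
qed

text \<open>\<open>measurable_on\<close> is by definition a limit of continuous functions outside a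
  negligible set. Clamping the approximants to values between 0 and 1 preserves the limit and makes
  them bounded.\<close>

lemma indicator_limit_of_continuous:
  fixes E :: "real set"
  assumes "E \<in> sets lebesgue"
  obtains g :: "nat \<Rightarrow> real \<Rightarrow> real"
  where "\<And>n. continuous_on UNIV (g n)" "\<And>n t. \<bar>g n t\<bar> \<le> 1" "AE t in lebesgue. (\<lambda>n. g n t) \<longlonglongrightarrow> indicator E t"
proof -
  have "(indicator E :: real \<Rightarrow> real) measurable_on UNIV"
    using assms by (intro lebesgue_measurable_imp_measurable_on_real) auto
  then obtain N g where N: "negligible N" and g: "\<And>n::nat. continuous_on UNIV (g n)"
    "\<And>t. t \<notin> N \<Longrightarrow> (\<lambda>n. g n t) \<longlonglongrightarrow> (indicator E t :: real)"
    unfolding measurable_on_def by auto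
  show ?thesis
  proof
    show "continuous_on UNIV (\<lambda>t. max 0 (min 1 (g n t)))" for n using g(1) by (intro continuous_intros)
    show "\<bar>max 0 (min 1 (g n t))\<bar> \<le> 1" for n t by auto
    have "N \<in> null_sets lebesgue" using N by (simp add: negligible_iff_null_sets)
    moreover have "(\<lambda>n. max 0 (min 1 (g n t))) \<longlonglongrightarrow> max 0 (min 1 (indicator E t))" if "t \<notin> N" for t
      using g(2)[OF that] by (intro tendsto_intros)
    then have "(\<lambda>n. max 0 (min 1 (g n t))) \<longlonglongrightarrow> indicator E t" if "t \<notin> N" for t
      using that by (simp add: indicator_def split: if_splits)
    ultimately show "AE t in lebesgue. (\<lambda>n. max 0 (min 1 (g n t))) \<longlonglongrightarrow> indicator E t"
      by (intro AE_I'[of N]) auto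
  qed
qed

lemma AE_lebesgue_onI: "AE t in lebesgue. P t \<Longrightarrow> S \<in> sets lebesgue \<Longrightarrow> AE t in lebesgue_on S. P t"
  by (simp add: AE_restrict_space_iff) (erule eventually_mono, simp)

lemma continuous_on_sum_bochner:
  fixes y :: "'i \<Rightarrow> 'b::real_normed_vector" and T :: real
  assumes "finite R" "\<And>i. i \<in> R \<Longrightarrow> continuous_on {0..T} (g i)"
  shows "bochner_measurable (lebesgue_on {0..T}) (\<lambda>t. \<Sum>i\<in>R. g i t *\<^sub>R y i)"
proof (rule bochner_measurable_sum)
  interpret complete_measure "lebesgue_on {0..T}" by (rule complete_measure_lebesgue_on) simp
  fix i assume "i \<in> R"
  then have "g i \<in> borel_measurable (lebesgue_on {0..T})"
    by (intro continuous_imp_measurable_on_sets_lebesgue assms) auto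
  then show "bochner_measurable (lebesgue_on {0..T}) (\<lambda>t. g i t *\<^sub>R y i)"
    by (intro bochner_measurable_scaleR bochner_measurable_const)
qed

lemma Lp_continuous_approx:
  fixes v :: "real \<Rightarrow> 'b::real_normed_vector"
  assumes p: "0 < p" and v: "v \<in> Lp T p" and e: "0 < e"
  obtains \<phi> where "continuous_on {0..T} \<phi>" "\<phi> \<in> Lp T p"
    "integrable (lebesgue_on {0..T}) (\<lambda>t. norm (v t - \<phi> t) powr p)"
    "(\<integral>t. norm (v t - \<phi> t) powr p \<partial>lebesgue_on {0..T}) < e"
proof -
  let ?M = "lebesgue_on {0..T}"
  interpret complete_measure ?M by (rule complete_measure_lebesgue_on) simp
  interpret finite_measure ?M by (rule finite_measure_lebesgue_on) simp
  have vm: "bochner_measurable ?M v" and vi: "integrable ?M (\<lambda>t. norm (v t) powr p)" using v by (auto simp: Lp_def)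
  \<comment> \<open>Two errors of size \<open>e'\<close> are added at the cost of the factor 2 powr
    p.\<close>
  define e' where "e' = e / (2 * 2 powr p)"
  have e': "0 < e'" using e by (simp add: e'_def)
  obtain s where s: "simple_function ?M s" "integrable ?M (\<lambda>t. norm (v t - s t) powr p)"
    "(\<integral>t. norm (v t - s t) powr p \<partial>?M) < e'"
  proof (rule bochner_Lp_simple_approx[OF vm p vi])
    fix s :: "nat \<Rightarrow> real \<Rightarrow> 'b"
    assume s: "\<And>i. simple_function ?M (s i)" "\<And>i. integrable ?M (\<lambda>t. norm (v t - s i t) powr p)"
      "(\<lambda>i. \<integral>t. norm (v t - s i t) powr p \<partial>?M) \<longlonglongrightarrow> 0"
    have "\<forall>\<^sub>F i in sequentially. (\<integral>t. norm (v t - s i t) powr p \<partial>?M) < e'"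
      using s(3) e' by (rule order_tendstoD)
    then obtain i where "(\<integral>t. norm (v t - s i t) powr p \<partial>?M) < e'"
      by (auto simp: eventually_sequentially)
    then show thesis using s(1,2) by (intro that)
  qed
  define R where "R = s ` {0..T}"
  have fR: "finite R" using simple_functionD(1)[OF s(1)] by (simp add: R_def)
  define E where "E y = s -` {y} \<inter> {0..T}" for y
  have "E y \<in> sets lebesgue" for y
    using simple_functionD(2)[OF s(1), of "{y}"] by (auto simp: E_def sets_restrict_space_iff)
  then have "\<exists>g :: nat \<Rightarrow> real \<Rightarrow> real. (\<forall>n. continuous_on UNIV (g n)) \<and> (\<forall>n t. \<bar>g n t\<bar> \<le> 1) \<and>
      (AE t in lebesgue. (\<lambda>n. g n t) \<longlonglongrightarrow> indicator (E y) t)" for y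
    using indicator_limit_of_continuous by metis
  then obtain g :: "'b \<Rightarrow> nat \<Rightarrow> real \<Rightarrow> real" where g: "\<And>y n. continuous_on UNIV (g y n)" "\<And>y n t. \<bar>g y n t\<bar> \<le> 1"
    "\<And>y. AE t in lebesgue. (\<lambda>n. g y n t) \<longlonglongrightarrow> indicator (E y) t" by metis
  define \<phi> where "\<phi> n t = (\<Sum>y\<in>R. g y n t *\<^sub>R y)" for n t
  define B where "B = (\<Sum>y\<in>R. norm y)"
  have seq: "s t = (\<Sum>y\<in>R. indicator (E y) t *\<^sub>R y)" if "t \<in> {0..T}" for t
    unfolding R_def E_def
    by (rule simple_function_sum_indicator[OF s(1), of t, unfolded space_lebesgue_on, OF that])
  have sB: "norm (s t) \<le> B" if "t \<in> {0..T}" for t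
    unfolding B_def using that fR by (intro member_le_sum[of "s t" R norm]) (auto simp: R_def)
  have \<phi>B: "norm (\<phi> n t) \<le> B" for n t
    unfolding \<phi>_def B_def using g(2)[of _ n t] by (intro sum_norm_le) (simp add: mult_left_le_one_le)
  have cont: "continuous_on {0..T} (\<phi> n)" for n
    unfolding \<phi>_def by (intro continuous_intros continuous_on_subset[OF g(1)]) auto
  have \<phi>m: "bochner_measurable ?M (\<phi> n)" for n
    unfolding \<phi>_def by (intro continuous_on_sum_bochner fR continuous_on_subset[OF g(1)]) auto
  have sm: "bochner_measurable ?M s"
    unfolding bochner_measurable_def using s(1) by (intro exI[of _ "\<lambda>_. s"]) auto
  have B: "0 \<le> B" by (simp add: B_def sum_nonneg)
  have \<phi>i: "integrable ?M (\<lambda>t. norm (\<phi> n t) powr p)" for n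
  proof (rule integrable_const_bound[where B = "B powr p"])
    show "AE t in ?M. norm (norm (\<phi> n t) powr p) \<le> B powr p"
      using \<phi>B p by (intro AE_I2) (auto intro: powr_mono2)
    show "(\<lambda>t. norm (\<phi> n t) powr p) \<in> borel_measurable ?M"
      using bochner_measurable_norm[OF \<phi>m[of n]] by measurable
  qed
  have [measurable]: "(\<lambda>t. norm (s t - \<phi> n t)) \<in> borel_measurable ?M" for n
    by (intro bochner_measurable_norm bochner_measurable_diff sm \<phi>m)
  have lim: "AE t in ?M. (\<lambda>n. norm (s t - \<phi> n t) powr p) \<longlonglongrightarrow> 0"
  proof -
    have "AE t in lebesgue. \<forall>y\<in>R. (\<lambda>n. g y n t) \<longlonglongrightarrow> indicator (E y) t"
      using fR g(3) by (intro AE_finite_allI) auto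
    then have "AE t in ?M. \<forall>y\<in>R. (\<lambda>n. g y n t) \<longlonglongrightarrow> indicator (E y) t" by (rule AE_lebesgue_onI) simp
    moreover have "AE t in ?M. t \<in> {0..T}" by (intro AE_I2) simp
    ultimately show ?thesis
    proof eventually_elim
      fix t assume t: "\<forall>y\<in>R. (\<lambda>n. g y n t) \<longlonglongrightarrow> indicator (E y) t" "t \<in> {0..T}"
      have "(\<lambda>n. \<phi> n t) \<longlonglongrightarrow> s t"
        unfolding seq[OF t(2)] \<phi>_def using t(1) by (intro tendsto_sum tendsto_scaleR tendsto_const) auto
      then have "(\<lambda>n. norm (s t - \<phi> n t)) \<longlonglongrightarrow> norm (s t - s t)" by (intro tendsto_intros)
      then have "(\<lambda>n. norm (s t - \<phi> n t) powr p) \<longlonglongrightarrow> 0 powr p"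
        using p by (intro tendsto_powr2) auto
      then show "(\<lambda>n. norm (s t - \<phi> n t) powr p) \<longlonglongrightarrow> 0" using p by simp
    qed
  qed
  have bound: "AE t in ?M. norm (norm (s t - \<phi> n t) powr p) \<le> (2 * B) powr p" for n
  proof (rule AE_I2)
    fix t assume "t \<in> space ?M"
    then have "norm (s t - \<phi> n t) \<le> 2 * B"
      using norm_triangle_ineq4[of "s t" "\<phi> n t"] sB[of t] \<phi>B[of n t] by simp
    then show "norm (norm (s t - \<phi> n t) powr p) \<le> (2 * B) powr p" using p by (auto intro: powr_mono2)
  qed
  have si: "integrable ?M (\<lambda>t. norm (s t - \<phi> n t) powr p)" for n
    by (rule integrable_const_bound[OF bound]) simp
  have "(\<lambda>n. \<integral>t. norm (s t - \<phi> n t) powr p \<partial>?M) \<longlonglongrightarrow> (\<integral>t. 0 \<partial>?M)"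
    by (rule integral_dominated_convergence[OF _ _ _ lim bound]) auto
  then have "\<forall>\<^sub>F n in sequentially. (\<integral>t. norm (s t - \<phi> n t) powr p \<partial>?M) < e'"
    using e' by (intro order_tendstoD) auto
  then obtain n where n: "(\<integral>t. norm (s t - \<phi> n t) powr p \<partial>?M) < e'" by (auto simp: eventually_sequentially)
  have [measurable]: "(\<lambda>t. norm (v t - \<phi> n t)) \<in> borel_measurable ?M"
    by (intro bochner_measurable_norm bochner_measurable_diff vm \<phi>m)
  have neg: "norm (\<phi> n t - s t) = norm (s t - \<phi> n t)" for t by (rule norm_minus_commute)
  have m': "(\<lambda>t. norm ((v t - s t) - (\<phi> n t - s t))) \<in> borel_measurable ?M" by simp
  show ?thesis
  proof
    show "continuous_on {0..T} (\<phi> n)" by (rule cont)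
    show "\<phi> n \<in> Lp T p" using \<phi>m \<phi>i by (simp add: Lp_def)
    show "integrable ?M (\<lambda>t. norm (v t - \<phi> n t) powr p)"
      using integrable_powr_diff(1)[OF p s(2) _ m'] si[of n] by (simp add: neg)
    have "(\<integral>t. norm (v t - \<phi> n t) powr p \<partial>?M)
        \<le> 2 powr p * ((\<integral>t. norm (v t - s t) powr p \<partial>?M) + (\<integral>t. norm (s t - \<phi> n t) powr p \<partial>?M))"
      using integrable_powr_diff(2)[OF p s(2) _ m'] si[of n] by (simp add: neg)
    also have "\<dots> < 2 powr p * (e' + e')"
      using n s(3) by (intro mult_strict_left_mono add_strict_mono) auto
    also have "\<dots> = e" by (simp add: e'_def)
    finally show "(\<integral>t. norm (v t - \<phi> n t) powr p \<partial>?M) < e" .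
  qed
qed

section \<open>Product rule for primitives of integrable functions\<close>

lemma product_rule_continuous:
  fixes f g :: "real \<Rightarrow> real"
  assumes f: "continuous_on {0..t} f" and g: "continuous_on {0..t} g" and t: "0 \<le> t"
    and F: "\<And>r. r \<in> {0..t} \<Longrightarrow> F r = a + integral {0..r} f"
    and G: "\<And>r. r \<in> {0..t} \<Longrightarrow> G r = b + integral {0..r} g"
  shows "F t * G t = a * b + integral {0..t} (\<lambda>r. f r * G r + F r * g r)"
proof -
  have der: "((\<lambda>r. (a + integral {0..r} f) * (b + integral {0..r} g)) has_real_derivative
      f r * (b + integral {0..r} g) + (a + integral {0..r} f) * g r) (at r within {0..t})" if "r \<in> {0..t}" for r
    using integral_has_real_derivative[OF f that] integral_has_real_derivative[OF g that]
    by (auto intro!: derivative_eq_intros)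
  have "((\<lambda>r. f r * (b + integral {0..r} g) + (a + integral {0..r} f) * g r) has_integral
      (a + integral {0..t} f) * (b + integral {0..t} g) - (a + integral {0..0} f) * (b + integral {0..0} g)) {0..t}"
    using der t by (intro fundamental_theorem_of_calculus)
      (auto simp: has_real_derivative_iff_has_vector_derivative[symmetric])
  then have "((\<lambda>r. f r * G r + F r * g r) has_integral F t * G t - a * b) {0..t}"
    using t F G by (subst has_integral_cong[of _ _ "\<lambda>r. f r * (b + integral {0..r} g) + (a + integral {0..r} f) * g r"]) auto
  then show ?thesis by (simp add: has_integral_iff)
qed

lemma Lp_1_real_iff: "(f :: real \<Rightarrow> real) \<in> Lp T 1 \<longleftrightarrow> integrable (lebesgue_on {0..T}) f"
proof -
  interpret complete_measure "lebesgue_on {0..T}" by (rule complete_measure_lebesgue_on) simp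
  show ?thesis
    using integrable_norm_cancel[of "lebesgue_on {0..T}" f]
    by (auto simp: Lp_def bochner_measurable_real powr_one intro: integrable_abs)
qed

lemma integrable_mult_continuous:
  fixes h H :: "real \<Rightarrow> real"
  assumes h: "integrable (lebesgue_on {0..T}) h" and H: "continuous_on {0..T} H"
  shows "integrable (lebesgue_on {0..T}) (\<lambda>r. h r * H r)"
proof -
  have "bounded (H ` {0..T})" by (intro compact_imp_bounded compact_continuous_image H) simp
  then obtain K where "\<forall>x\<in>H ` {0..T}. norm x \<le> K" unfolding bounded_iff by blast
  then have K: "\<And>r. r \<in> {0..T} \<Longrightarrow> \<bar>H r\<bar> \<le> K" by simp
  show ?thesis
  proof (rule Bochner_Integration.integrable_bound)
    show "integrable (lebesgue_on {0..T}) (\<lambda>r. K * \<bar>h r\<bar>)" using h by auto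
    have "H \<in> borel_measurable (lebesgue_on {0..T})" by (intro continuous_imp_measurable_on_sets_lebesgue H) auto
    then show "(\<lambda>r. h r * H r) \<in> borel_measurable (lebesgue_on {0..T})" using h by measurable
    have "\<bar>h r\<bar> * \<bar>H r\<bar> \<le> \<bar>K\<bar> * \<bar>h r\<bar>" if "r \<in> {0..T}" for r
      using mult_right_mono[OF order_trans[OF K[OF that] abs_ge_self], of "\<bar>h r\<bar>"] by (simp add: mult.commute)
    then show "AE r in lebesgue_on {0..T}. norm (h r * H r) \<le> norm (K * \<bar>h r\<bar>)"
      by (intro AE_I2) (auto simp: abs_mult)
  qed
qed

lemma product_rule_integral:
  fixes f g :: "real \<Rightarrow> real"
  assumes f: "integrable (lebesgue_on {0..T}) f" and g: "integrable (lebesgue_on {0..T}) g"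
    and F: "\<And>r. r \<in> {0..T} \<Longrightarrow> F r = a + integral {0..r} f"
    and G: "\<And>r. r \<in> {0..T} \<Longrightarrow> G r = b + integral {0..r} g"
    and t: "t \<in> {0..T}"
  shows "integrable (lebesgue_on {0..T}) (\<lambda>r. f r * G r + F r * g r)"
    and "F t * G t = a * b + integral {0..t} (\<lambda>r. f r * G r + F r * g r)"
proof -
  let ?M = "lebesgue_on {0..T}"
  define N where "N h = (\<integral>r. \<bar>h r\<bar> \<partial>?M)" for h :: "real \<Rightarrow> real"
  have cont: "continuous_on {0..T} (\<lambda>r. c + integral {0..r} h)" if "integrable ?M h" for h :: "real \<Rightarrow> real" and c
    by (intro continuous_intros indefinite_integral_continuous_1 integral_subinterval(2)[OF that]) auto
  have Fc: "continuous_on {0..T} F" using cont[OF f, of a] F by (subst continuous_on_cong[of _ "{0..T}" F]) auto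
  have Gc: "continuous_on {0..T} G" using cont[OF g, of b] G by (subst continuous_on_cong[of _ "{0..T}" G]) auto
  note mult = integrable_mult_continuous
  show int: "integrable ?M (\<lambda>r. f r * G r + F r * g r)"
    using mult[OF f Gc] mult[OF g Fc] by (simp add: mult.commute)
  have "\<exists>\<phi>. continuous_on {0..T} \<phi> \<and> integrable ?M \<phi> \<and> N (\<lambda>r. h r - \<phi> r) < inverse (real (Suc n))"
    if h: "integrable ?M h" for h :: "real \<Rightarrow> real" and n
  proof -
    have "h \<in> Lp T 1" using h by (simp add: Lp_1_real_iff)
    from Lp_continuous_approx[OF _ this, of "inverse (real (Suc n))"] show ?thesis
      by (auto simp: Lp_1_real_iff N_def powr_one)
  qed
  note approx = this
  obtain \<phi> where \<phi>: "\<And>n. continuous_on {0..T} (\<phi> n)" "\<And>n. integrable ?M (\<phi> n)" "\<And>n. N (\<lambda>r. f r - \<phi> n r) < inverse (real (Suc n))"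
    using approx[OF f] by metis
  obtain \<psi> where \<psi>: "\<And>n. continuous_on {0..T} (\<psi> n)" "\<And>n. integrable ?M (\<psi> n)" "\<And>n. N (\<lambda>r. g r - \<psi> n r) < inverse (real (Suc n))"
    using approx[OF g] by metis
  define Fn where "Fn n r = a + integral {0..r} (\<phi> n)" for n r
  define Gn where "Gn n r = b + integral {0..r} (\<psi> n)" for n r
  have dist: "\<bar>(c + integral {0..r} h) - (c + integral {0..r} k)\<bar> \<le> N (\<lambda>r. h r - k r)"
    if "integrable ?M h" "integrable ?M k" "r \<in> {0..T}" for h k :: "real \<Rightarrow> real" and c r
  proof -
    have "(c + integral {0..r} h) - (c + integral {0..r} k) = integral {0..r} (\<lambda>r. h r - k r)"
      using that integral_subinterval(2)[OF that(1), of 0 r] integral_subinterval(2)[OF that(2), of 0 r]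
      by (simp add: Henstock_Kurzweil_Integration.integral_diff)
    then show ?thesis using integral_subinterval_le[of T "\<lambda>r. h r - k r" 0 r] that by (simp add: N_def)
  qed
  have Fd: "\<bar>F r - Fn n r\<bar> \<le> inverse (real (Suc n))" if "r \<in> {0..T}" for n r
    using dist[OF f \<phi>(2) that, of a n] \<phi>(3)[of n] F[OF that] by (simp add: Fn_def)
  have Gd: "\<bar>G r - Gn n r\<bar> \<le> inverse (real (Suc n))" if "r \<in> {0..T}" for n r
    using dist[OF g \<psi>(2) that, of b n] \<psi>(3)[of n] G[OF that] by (simp add: Gn_def)
  have l0: "(\<lambda>n. inverse (real (Suc n))) \<longlonglongrightarrow> 0" by (rule LIMSEQ_inverse_real_of_nat)
  have FL: "(\<lambda>n. Fn n t) \<longlonglongrightarrow> F t"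
    using tendsto_by_bound[OF _ l0, of "\<lambda>n. Fn n t" "F t"] Fd[OF t] by (simp add: abs_minus_commute)
  have GL: "(\<lambda>n. Gn n t) \<longlonglongrightarrow> G t"
    using tendsto_by_bound[OF _ l0, of "\<lambda>n. Gn n t" "G t"] Gd[OF t] by (simp add: abs_minus_commute)
  have "bounded (F ` {0..T})" "bounded (G ` {0..T})" by (intro compact_imp_bounded compact_continuous_image Fc Gc; simp)+
  then obtain K1 K2 where "\<forall>x\<in>F ` {0..T}. norm x \<le> K1" "\<forall>x\<in>G ` {0..T}. norm x \<le> K2"
    unfolding bounded_iff by blast
  then have K1: "\<And>r. r \<in> {0..T} \<Longrightarrow> \<bar>F r\<bar> \<le> K1" and K2: "\<And>r. r \<in> {0..T} \<Longrightarrow> \<bar>G r\<bar> \<le> K2" by auto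
  have t0: "0 \<in> {0..T}" using t by auto
  have Knn: "0 \<le> K1" "0 \<le> K2" using K1[OF t0] K2[OF t0] by auto
  have FnC: "continuous_on {0..T} (Fn n)" and GnC: "continuous_on {0..T} (Gn n)" for n
    unfolding Fn_def Gn_def by (intro cont \<phi>(2) \<psi>(2))+
  have intn: "integrable ?M (\<lambda>r. \<phi> n r * Gn n r + Fn n r * \<psi> n r)" for n
    using mult[OF \<phi>(2) GnC[of n], of n] mult[OF \<psi>(2) FnC[of n], of n] by (simp add: mult.commute)
  define C where "C = K1 + 1 + (K2 + 1) + N f + N g"
  have close: "\<bar>integral {0..t} (\<lambda>r. f r * G r + F r * g r) - integral {0..t} (\<lambda>r. \<phi> n r * Gn n r + Fn n r * \<psi> n r)\<bar>
      \<le> C * inverse (real (Suc n))" for n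
  proof -
    let ?d = "inverse (real (Suc n))"
    let ?D = "\<lambda>r. (f r * G r + F r * g r) - (\<phi> n r * Gn n r + Fn n r * \<psi> n r)"
    have d: "0 \<le> ?d" "?d \<le> 1" by (auto simp: field_simps)
    have Di: "integrable ?M ?D" using int intn by auto
    have bnd: "\<bar>?D r\<bar> \<le> \<bar>f r - \<phi> n r\<bar> * (K2 + 1) + \<bar>f r\<bar> * ?d + (\<bar>g r - \<psi> n r\<bar> * (K1 + 1) + \<bar>g r\<bar> * ?d)"
      if r: "r \<in> {0..T}" for r
    proof -
      have GK: "\<bar>Gn n r\<bar> \<le> K2 + 1" using K2[OF r] Gd[OF r, of n] d by linarith
      have FK: "\<bar>Fn n r\<bar> \<le> K1 + 1" using K1[OF r] Fd[OF r, of n] d by linarith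
      have "?D r = (f r - \<phi> n r) * Gn n r + f r * (G r - Gn n r) + ((g r - \<psi> n r) * Fn n r + g r * (F r - Fn n r))"
        by (simp add: algebra_simps)
      then have "\<bar>?D r\<bar> = \<bar>(f r - \<phi> n r) * Gn n r + f r * (G r - Gn n r) + ((g r - \<psi> n r) * Fn n r + g r * (F r - Fn n r))\<bar>"
        by (simp only:)
      also have "\<dots> \<le> \<bar>f r - \<phi> n r\<bar> * \<bar>Gn n r\<bar> + \<bar>f r\<bar> * \<bar>G r - Gn n r\<bar> + (\<bar>g r - \<psi> n r\<bar> * \<bar>Fn n r\<bar> + \<bar>g r\<bar> * \<bar>F r - Fn n r\<bar>)"
        by (rule abs_triangle_products)
      also have "\<dots> \<le> \<bar>f r - \<phi> n r\<bar> * (K2 + 1) + \<bar>f r\<bar> * ?d + (\<bar>g r - \<psi> n r\<bar> * (K1 + 1) + \<bar>g r\<bar> * ?d)"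
        by (intro add_mono mult_left_mono[OF GK] mult_left_mono[OF FK] mult_left_mono[OF Gd[OF r]] mult_left_mono[OF Fd[OF r]] abs_ge_zero)
      finally show ?thesis .
    qed
    have eq: "integral {0..t} (\<lambda>r. f r * G r + F r * g r) - integral {0..t} (\<lambda>r. \<phi> n r * Gn n r + Fn n r * \<psi> n r) = integral {0..t} ?D"
      using t integral_subinterval(2)[OF int, of 0 t] integral_subinterval(2)[OF intn, of 0 t n]
      by (simp add: Henstock_Kurzweil_Integration.integral_diff)
    have "\<bar>integral {0..t} ?D\<bar> \<le> (\<integral>r. \<bar>?D r\<bar> \<partial>?M)" using t by (intro integral_subinterval_le Di) auto
    also have "\<dots> \<le> (\<integral>r. \<bar>f r - \<phi> n r\<bar> * (K2 + 1) + \<bar>f r\<bar> * ?d + (\<bar>g r - \<psi> n r\<bar> * (K1 + 1) + \<bar>g r\<bar> * ?d) \<partial>?M)"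
      by (rule integral_mono) (use Di bnd f g \<phi>(2) \<psi>(2) in auto)
    also have "\<dots> = N (\<lambda>r. f r - \<phi> n r) * (K2 + 1) + N f * ?d + (N (\<lambda>r. g r - \<psi> n r) * (K1 + 1) + N g * ?d)"
      unfolding N_def using f g \<phi>(2) \<psi>(2) by simp
    also have "\<dots> \<le> ?d * (K2 + 1) + N f * ?d + (?d * (K1 + 1) + N g * ?d)"
      using \<phi>(3)[of n] \<psi>(3)[of n] Knn by (intro add_mono mult_right_mono) auto
    also have "\<dots> = C * ?d" by (simp add: C_def algebra_simps)
    finally show ?thesis unfolding eq .
  qed
  have eqn: "Fn n t * Gn n t = a * b + integral {0..t} (\<lambda>r. \<phi> n r * Gn n r + Fn n r * \<psi> n r)" for n
    using t by (intro product_rule_continuous continuous_on_subset[OF \<phi>(1)] continuous_on_subset[OF \<psi>(1)])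
      (auto simp: Fn_def Gn_def)
  have "(\<lambda>n. C * inverse (real (Suc n))) \<longlonglongrightarrow> 0" using tendsto_mult_left[OF l0, of C] by simp
  then have "(\<lambda>n. integral {0..t} (\<lambda>r. \<phi> n r * Gn n r + Fn n r * \<psi> n r)) \<longlonglongrightarrow> integral {0..t} (\<lambda>r. f r * G r + F r * g r)"
    by (rule tendsto_by_bound[rotated]) (subst abs_minus_commute, rule close)
  then have "(\<lambda>n. a * b + integral {0..t} (\<lambda>r. \<phi> n r * Gn n r + Fn n r * \<psi> n r)) \<longlonglongrightarrow> a * b + integral {0..t} (\<lambda>r. f r * G r + F r * g r)"
    by (intro tendsto_intros)
  then have "(\<lambda>n. Fn n t * Gn n t) \<longlonglongrightarrow> a * b + integral {0..t} (\<lambda>r. f r * G r + F r * g r)" by (simp add: eqn)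
  then show "F t * G t = a * b + integral {0..t} (\<lambda>r. f r * G r + F r * g r)"
    using tendsto_mult[OF FL GL] LIMSEQ_unique by blast
qed

section \<open>Step functions with good nodes and the energy identity\<close>

lemma integral_consecutive:
  fixes f :: "real \<Rightarrow> real"
  assumes "\<And>k. k \<le> m \<Longrightarrow> z k \<le> z (Suc k)" "f integrable_on {z 0..z (Suc m)}"
  shows "(\<Sum>k\<le>m. integral {z k..z (Suc k)} f) = integral {z 0..z (Suc m)} f"
  using assms
proof (induction m)
  case (Suc m)
  have mono: "z 0 \<le> z (Suc k)" if "k \<le> Suc m" for k
    using that Suc.prems(1) by (induction k) (auto intro: order_trans)
  have le: "z 0 \<le> z (Suc m)" "z (Suc m) \<le> z (Suc (Suc m))" using mono[of m] Suc.prems(1)[of "Suc m"] by auto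
  have "f integrable_on {z 0..z (Suc m)}"
    by (rule integrable_subinterval_real[OF Suc.prems(2)]) (use le in auto)
  then have "(\<Sum>k\<le>m. integral {z k..z (Suc k)} f) = integral {z 0..z (Suc m)} f"
    using Suc by auto
  then show ?case
    using Henstock_Kurzweil_Integration.integral_combine[OF le Suc.prems(2)] by simp
qed simp

text \<open>If every point with property \<open>Q\<close> violated the bound, \<open>F\<close> would
  exceed the constant \<open>c\<close> almost everywhere on the interval, while the integral of
  \<open>c\<close> already exceeds that of \<open>F\<close> by \<open>d\<close>.\<close>

lemma good_point:
  fixes F :: "real \<Rightarrow> real"
  assumes F: "integrable (lebesgue_on {0..T}) F" and ab: "0 \<le> a" "a < b" "b \<le> T"
    and Q: "AE r in lebesgue_on {0..T}. Q r" and d: "0 < d"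
  obtains r where "r \<in> {a..b}" "Q r" "(b - a) * F r \<le> integral {a..b} F + d"
proof (rule ccontr)
  let ?M = "lebesgue_on {0..T}"
  define J where "J = integral {a..b} F"
  define c where "c = (J + d) / (b - a)"
  assume "\<not> thesis"
  with that have no: "r \<in> {a..b} \<Longrightarrow> Q r \<Longrightarrow> J + d < (b - a) * F r" for r by (force simp: J_def)
  have cst: "integrable ?M (\<lambda>_. c)"
    by (rule finite_measure.integrable_const[OF finite_measure_lebesgue_on]) simp
  have "integral {a..b} (\<lambda>_. c) \<le> integral {a..b} F"
    unfolding integral_subinterval(4)[OF F ab(1,3)] integral_subinterval(4)[OF cst ab(1,3)]
  proof (rule integral_mono_AE)
    show "AE r in ?M. indicator {a..b} r * c \<le> indicator {a..b} r * F r"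
      using Q
    proof eventually_elim
      fix r assume "Q r"
      then show "indicator {a..b} r * c \<le> indicator {a..b} r * F r"
        using no[of r] ab by (cases "r \<in> {a..b}") (auto simp: c_def divide_le_eq mult.commute)
    qed
  qed (use integral_subinterval(3)[OF F ab(1,3)] integral_subinterval(3)[OF cst ab(1,3)] in auto)
  then show False using ab d by (simp add: c_def J_def)
qed

text \<open>The hypothesis is phrased with \<open>w powr (1 / p)\<close> so that \<open>w\<close>
  enters the p-th power estimate linearly. The factor 4 comes from using \<open>powr_add_le\<close>
  twice.\<close>

lemma norm_powr_triangle3:
  fixes a b c d :: "'b::real_normed_vector"
  assumes p: "0 < p" and "norm (b - c) \<le> w powr (1 / p)" "0 \<le> w"
  shows "norm (a - d) powr p \<le> 4 powr p * (norm (a - b) powr p + w + norm (d - c) powr p)"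
proof -
  have "norm (a - d) \<le> norm (a - b) + (norm (b - c) + norm (d - c))"
    using norm_triangle_ineq[of "a - b" "b - d"] norm_triangle_ineq4[of "b - c" "d - c"] by simp
  then have "norm (a - d) powr p \<le> (norm (a - b) + (norm (b - c) + norm (d - c))) powr p"
    using p by (intro powr_mono2) auto
  also have "\<dots> \<le> 2 powr p * (norm (a - b) powr p + (norm (b - c) + norm (d - c)) powr p)"
    using p by (intro powr_add_le) auto
  also have "\<dots> \<le> 2 powr p * (2 powr p * norm (a - b) powr p + 2 powr p * (norm (b - c) powr p + norm (d - c) powr p))"
    using p powr_add_le[of "norm (b - c)" "norm (d - c)" p] mult_right_mono[of 1 "2 powr p" "norm (a - b) powr p"]
    by (intro mult_left_mono add_mono) (auto simp: ge_one_powr_ge_zero)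
  also have "\<dots> = 4 powr p * (norm (a - b) powr p + norm (b - c) powr p + norm (d - c) powr p)"
    using powr_mult[of 2 2 p] by (simp add: algebra_simps)
  also have "norm (b - c) powr p \<le> w"
    using powr_mono2[OF _ _ assms(2), of p] p assms(3) by (simp add: powr_powr)
  finally show ?thesis by simp
qed

lemma Lp_diff_const_integrable:
  assumes p: "0 < p" and v: "v \<in> Lp T p"
  shows "integrable (lebesgue_on {0..T}) (\<lambda>r. norm (v r - c) powr p)"
proof -
  interpret complete_measure "lebesgue_on {0..T}" by (rule complete_measure_lebesgue_on) simp
  interpret finite_measure "lebesgue_on {0..T}" by (rule finite_measure_lebesgue_on) simp
  show ?thesis
    using v p by (intro integrable_powr_diff bochner_measurable_norm bochner_measurable_diff bochner_measurable_const)
      (auto simp: Lp_def)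
qed

lemma Lp_step_approx:
  fixes v :: "real \<Rightarrow> 'b::real_normed_vector"
  assumes p: "0 < p" and v: "v \<in> Lp T p" and st: "0 \<le> s" "s < t" "t \<le> T"
    and Q: "AE r in lebesgue_on {0..T}. Q r" and e: "0 < e"
  obtains m z where "z 0 = s" "z (Suc m) = t" "\<And>k. k \<le> m \<Longrightarrow> z k \<le> z (Suc k)"
    "\<And>k. 1 \<le> k \<Longrightarrow> k \<le> m \<Longrightarrow> Q (z k)" "1 \<le> m" "z 1 - s < e" "t - z m < e"
    "(\<Sum>k\<le>m. integral {z k..z (Suc k)} (\<lambda>r. norm (v r - (if k = 0 then 0 else v (z k))) powr p)) < e"
    "(\<Sum>k\<le>m. integral {z k..z (Suc k)} (\<lambda>r. norm (v r - (if k = m then 0 else v (z (Suc k)))) powr p)) < e"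
proof -
  let ?M = "lebesgue_on {0..T}"
  have T: "0 < T" using st by simp
  define C where "C = 4 powr p"
  have C: "0 < C" by (simp add: C_def)
  \<comment> \<open>The total error will be e/2 + 5 C e1 + 4 C T w = e/2 + e/4 + e/8, which is below
    \<open>e\<close>.\<close>
  define e1 where "e1 = e / (20 * C)"
  define w where "w = e / (32 * C * T)"
  have pos: "0 < e1" "0 < w" using e C T by (auto simp: e1_def w_def)
  obtain \<phi> where \<phi>: "continuous_on {0..T} \<phi>" "integrable ?M (\<lambda>r. norm (v r - \<phi> r) powr p)"
    "(\<integral>r. norm (v r - \<phi> r) powr p \<partial>?M) < e1"
    by (rule Lp_continuous_approx[OF p v pos(1)])
  define F where "F = (\<lambda>r. norm (v r - \<phi> r) powr p)"
  have Fi: "integrable ?M F" and F0: "0 \<le> F r" for r using \<phi>(2) by (auto simp: F_def)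
  have FI: "integral {s..t} F < e1"
    using integral_subinterval_le[OF Fi st(1,3)] \<phi>(3) F0 by (simp add: F_def)
  have "uniformly_continuous_on {0..T} \<phi>" by (intro compact_uniformly_continuous \<phi>(1)) simp
  then obtain d where d: "0 < d"
    "\<And>x y. x \<in> {0..T} \<Longrightarrow> y \<in> {0..T} \<Longrightarrow> dist y x < d \<Longrightarrow> dist (\<phi> y) (\<phi> x) < w powr (1 / p)"
    using pos(2) unfolding uniformly_continuous_on_def by (metis powr_gt_zero less_irrefl)
  have vi: "integrable ?M (\<lambda>r. norm (v r - c) powr p)" for c by (rule Lp_diff_const_integrable[OF p v])
  obtain d' where d': "0 < d'"
    "\<And>a b. 0 \<le> a \<Longrightarrow> a \<le> b \<Longrightarrow> b \<le> T \<Longrightarrow> b - a < d' \<Longrightarrow> \<bar>integral {a..b} (\<lambda>r. norm (v r - 0) powr p)\<bar> < e / 2"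
    using integral_absolutely_continuous[OF vi[of 0], of "e / 2"] e by (metis half_gt_zero)
  \<comment> \<open>Halved because consecutive nodes lie in neighbouring cells and may be two cell
    lengths apart.\<close>
  define D where "D = min (min d d') e / 2"
  have D: "0 < D" "2 * D \<le> d" "2 * D \<le> d'" "D < e" using d(1) d'(1) e by (auto simp: D_def min_def)
  obtain n where n: "(t - s) / D < real (Suc n)" using reals_Archimedean2 less_trans lessI of_nat_less_iff by meson
  define m where "m = Suc n"
  define h where "h = (t - s) / real m"
  have h: "0 < h" "h < D" "real m * h = t - s"
    using n st D(1) by (auto simp: h_def m_def field_simps)
  define \<sigma> where "\<sigma> k = s + real k * h" for k
  have \<sigma>: "\<sigma> 0 = s" "\<sigma> m = t" "\<sigma> (Suc k) = \<sigma> k + h" for k using h(3) by (auto simp: \<sigma>_def algebra_simps)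
  have \<sigma>st: "s \<le> \<sigma> k" "\<sigma> k \<le> t" if "k \<le> m" for k
    using that h(1,3) mult_right_mono[of "real k" "real m" h] by (auto simp: \<sigma>_def)
  have "\<exists>r. r \<in> {\<sigma> k..\<sigma> (Suc k)} \<and> Q r \<and> h * F r \<le> integral {\<sigma> k..\<sigma> (Suc k)} F + e1 / real m" if k: "k < m" for k
  proof -
    have "0 \<le> \<sigma> k" "\<sigma> (Suc k) \<le> T" using \<sigma>st[of k] \<sigma>st[of "Suc k"] k st by auto
    then show ?thesis
      using good_point[OF Fi, of "\<sigma> k" "\<sigma> (Suc k)" Q "e1 / real m"] h(1) \<sigma>(3)[of k] Q pos(1)
      by (metis add_diff_cancel_left' less_add_same_cancel1 divide_pos_pos m_def of_nat_0_less_iff zero_less_Suc)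
  qed
  then obtain \<tau> where \<tau>: "\<And>k. k < m \<Longrightarrow> \<tau> k \<in> {\<sigma> k..\<sigma> (Suc k)}" "\<And>k. k < m \<Longrightarrow> Q (\<tau> k)"
    "\<And>k. k < m \<Longrightarrow> h * F (\<tau> k) \<le> integral {\<sigma> k..\<sigma> (Suc k)} F + e1 / real m" by metis
  \<comment> \<open>The nodes \<tau> 0, ..., \<tau> (m - 1) are shifted by one to make room for
    \<open>s\<close> in front; \<open>t\<close> follows at index m + 1. The m grid cells thus give m
    + 1 intervals, each of length at most 2 h.\<close>
  define z where "z k = (case k of 0 \<Rightarrow> s | Suc j \<Rightarrow> if j < m then \<tau> j else t)" for k
  have z: "z 0 = s" "\<And>j. j < m \<Longrightarrow> z (Suc j) = \<tau> j" "z (Suc m) = t" by (auto simp: z_def)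
  have zl: "\<sigma> (k - 1) \<le> z k" and zu: "z k \<le> \<sigma> (min k m)" if "k \<le> Suc m" for k
    using that \<tau>(1) \<sigma> \<sigma>st[of m] by (cases k; force simp: z_def min_def not_less_eq_eq less_Suc_eq)+
  have mono: "z k \<le> z (Suc k)" if "k \<le> m" for k
    using zu[of k] zl[of "Suc k"] that by (simp add: min_def)
  have gap: "z (Suc k) - z k \<le> 2 * h" if "k \<le> m" for k
  proof -
    have "z (Suc k) \<le> \<sigma> (Suc k)" using zu[of "Suc k"] that \<sigma>(3)[of m] h(1) by (cases "k = m") (auto simp: min_def)
    moreover have "\<sigma> k \<le> \<sigma> (k - 1) + h" using \<sigma>(3)[of "k - 1"] h(1) by (cases k) auto
    ultimately show ?thesis using zl[of k] \<sigma>(3)[of k] that by simp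
  qed
  have zst: "s \<le> z k" "z k \<le> t" if "k \<le> Suc m" for k
  proof -
    have "k - 1 \<le> m" using that by simp
    then show "s \<le> z k" "z k \<le> t" using zl[OF that] zu[OF that] \<sigma>st[of "k - 1"] \<sigma>st[of "min k m"] by auto
  qed
  have zT: "0 \<le> z k" "z k \<le> T" if "k \<le> Suc m" for k using zst[OF that] st by auto
  have Fsub: "F integrable_on {a..b}" if "0 \<le> a" "b \<le> T" for a b by (rule integral_subinterval(2)[OF Fi that])
  \<comment> \<open>The difference v r - v c is compared through the continuous function at
    \<open>r\<close> and at \<open>c\<close>. Integrating the term that depends on \<open>c\<close>
    alone contributes the length of the interval times \<open>F c\<close>, which is summable over
    the chosen nodes.\<close>
  have piece: "integral {a..b} (\<lambda>r. norm (v r - v c) powr p) \<le> C * integral {a..b} F + C * (2 * h * w) + 2 * C * (h * F c)"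
    if abc: "0 \<le> a" "a \<le> b" "b \<le> T" "b - a \<le> 2 * h" "c \<in> {a..b}" for a b c
  proof -
    have "integral {a..b} (\<lambda>r. norm (v r - v c) powr p) \<le> integral {a..b} (\<lambda>r. C * F r + C * (w + F c))"
    proof (rule integral_le)
      show "(\<lambda>r. norm (v r - v c) powr p) integrable_on {a..b}" by (rule integral_subinterval(2)[OF vi abc(1,3)])
      show "(\<lambda>r. C * F r + C * (w + F c)) integrable_on {a..b}"
        by (intro integrable_add integrable_on_mult_right Fsub abc integrable_const_ivl)
      fix r assume r: "r \<in> {a..b}"
      have "dist (\<phi> r) (\<phi> c) < w powr (1 / p)"
        using r abc h D by (intro d(2)) (auto simp: dist_real_def)
      then have "norm (\<phi> r - \<phi> c) \<le> w powr (1 / p)" by (simp add: dist_norm)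
      from norm_powr_triangle3[OF p this, of "v r" "v c"] pos(2)
      show "norm (v r - v c) powr p \<le> C * F r + C * (w + F c)" by (simp add: C_def F_def algebra_simps)
    qed
    also have "\<dots> = C * integral {a..b} F + (b - a) * (C * (w + F c))"
      using abc Fsub[of a b] by (subst Henstock_Kurzweil_Integration.integral_add) (auto intro: integrable_on_mult_right)
    also have "\<dots> \<le> C * integral {a..b} F + (2 * h) * (C * (w + F c))"
      using abc C pos F0 by (intro add_left_mono mult_right_mono) auto
    finally show ?thesis by (simp add: algebra_simps)
  qed
  have sumF: "(\<Sum>k\<le>m. integral {z k..z (Suc k)} F) < e1"
    using integral_consecutive[of m z F] mono z(1,3) Fsub[of s t] st FI by simp
  have sumS: "(\<Sum>k<m. h * F (\<tau> k)) \<le> 2 * e1"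
  proof -
    have "(\<Sum>k<m. h * F (\<tau> k)) \<le> (\<Sum>k<m. integral {\<sigma> k..\<sigma> (Suc k)} F + e1 / real m)"
      using \<tau>(3) by (intro sum_mono) auto
    also have "\<dots> = (\<Sum>k\<le>n. integral {\<sigma> k..\<sigma> (Suc k)} F) + e1"
      by (simp add: sum.distrib m_def lessThan_Suc_atMost del: sum.lessThan_Suc sum.atMost_Suc)
    also have "(\<Sum>k\<le>n. integral {\<sigma> k..\<sigma> (Suc k)} F) = integral {s..t} F"
      using integral_consecutive[of n \<sigma> F] \<sigma> h(1) Fsub[of s t] st by (simp add: m_def)
    finally show ?thesis using FI by simp
  qed
  have total: "(\<Sum>k\<le>m. X k) < e"
    if X: "\<And>k. k \<le> m \<Longrightarrow> X k \<le> (if k = k0 then e / 2 else 0) + C * integral {z k..z (Suc k)} F + C * (2 * h * w) + 2 * C * G k"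
      and k0: "k0 \<le> m" and G: "(\<Sum>k\<le>m. G k) \<le> 2 * e1" for X G :: "nat \<Rightarrow> real" and k0
  proof -
    have "(\<Sum>k\<le>m. X k) \<le> (\<Sum>k\<le>m. (if k = k0 then e / 2 else 0) + C * integral {z k..z (Suc k)} F + C * (2 * h * w) + 2 * C * G k)"
      using X by (intro sum_mono) auto
    also have "\<dots> = e / 2 + C * (\<Sum>k\<le>m. integral {z k..z (Suc k)} F) + real (Suc m) * (C * (2 * h * w)) + 2 * C * (\<Sum>k\<le>m. G k)"
      using k0 by (simp add: sum.distrib sum_distrib_left del: sum.atMost_Suc)
    also have "\<dots> < e / 2 + C * e1 + 4 * C * T * w + 2 * C * (2 * e1)"
    proof -
      have "C * (\<Sum>k\<le>m. integral {z k..z (Suc k)} F) < C * e1" using sumF C by simp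
      moreover have "2 * C * (\<Sum>k\<le>m. G k) \<le> 2 * C * (2 * e1)" using G C by simp
      moreover have "real (Suc m) * (C * (2 * h * w)) \<le> 4 * C * T * w"
      proof -
        have "real (Suc m) * h \<le> 2 * (real m * h)" using h(1) by (simp add: m_def algebra_simps)
        also have "\<dots> \<le> 2 * T" using h(3) st by simp
        finally have "real (Suc m) * h * (2 * C * w) \<le> 2 * T * (2 * C * w)" using C pos by (intro mult_right_mono) auto
        then show ?thesis by (simp add: algebra_simps)
      qed
      ultimately show ?thesis by linarith
    qed
    also have "\<dots> = e / 2 + 5 * (C * e1) + 4 * (C * T * w)" by simp
    also have "C * e1 = e / 20" using C by (simp add: e1_def)
    also have "C * T * w = e / 32" using C T by (simp add: w_def)
    finally show ?thesis using e by simp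
  qed
  have small: "integral {a..b} (\<lambda>r. norm (v r - 0) powr p) \<le> e / 2" if "0 \<le> a" "a \<le> b" "b \<le> T" "b - a \<le> 2 * h" for a b
    using d'(2)[of a b] that h D by auto
  have IF0: "0 \<le> C * integral {a..b} F + C * (2 * h * w)" if "0 \<le> a" "b \<le> T" for a b
  proof -
    have "0 \<le> integral {a..b} F" using F0 by (intro Henstock_Kurzweil_Integration.integral_nonneg Fsub that)
    then show ?thesis using C h pos by simp
  qed
  show ?thesis
  proof (rule that[of z m])
    show "z 0 = s" "z (Suc m) = t" by (rule z)+
    show "z k \<le> z (Suc k)" if "k \<le> m" for k by (rule mono[OF that])
    show "Q (z k)" if "1 \<le> k" "k \<le> m" for k using that \<tau>(2) z(2) by (cases k) auto
    show "1 \<le> m" by (simp add: m_def)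
    show "z 1 - s < e" using gap[of 0] zu[of 1] \<sigma> h D by (simp add: m_def)
    show "t - z m < e" using zl[of m] \<sigma>(3)[of "m - 1"] \<sigma>(2) h D by (simp add: m_def)
    show "(\<Sum>k\<le>m. integral {z k..z (Suc k)} (\<lambda>r. norm (v r - (if k = 0 then 0 else v (z k))) powr p)) < e"
    \<comment> \<open>For left-endpoint values, interval \<open>k\<close> uses the node \<tau> (k -
      1), and interval 0 is the exceptional one.\<close>
    proof (rule total[where ?k0.0 = 0 and G = "\<lambda>k. case k of 0 \<Rightarrow> 0 | Suc j \<Rightarrow> h * F (\<tau> j)"])
      show "(\<Sum>k\<le>m. case k of 0 \<Rightarrow> 0 | Suc j \<Rightarrow> h * F (\<tau> j)) \<le> 2 * e1"
        using sumS by (simp add: sum.atMost_shift)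
      fix k assume k: "k \<le> m"
      show "integral {z k..z (Suc k)} (\<lambda>r. norm (v r - (if k = 0 then 0 else v (z k))) powr p)
        \<le> (if k = 0 then e / 2 else 0) + C * integral {z k..z (Suc k)} F + C * (2 * h * w) + 2 * C * (case k of 0 \<Rightarrow> 0 | Suc j \<Rightarrow> h * F (\<tau> j))"
      proof (cases k)
        case 0
        then show ?thesis using small[of "z 0" "z 1"] mono[of 0] gap[of 0] zT[of 0] zT[of 1] IF0[of "z 0" "z 1"] k by simp
      next
        case (Suc j)
        then have "z k = \<tau> j" using z(2) k by simp
        then show ?thesis using piece[of "z k" "z (Suc k)" "z k"] mono[OF k] gap[OF k] zT[of k] zT[of "Suc k"] k Suc by simp
      qed
    qed simp
    show "(\<Sum>k\<le>m. integral {z k..z (Suc k)} (\<lambda>r. norm (v r - (if k = m then 0 else v (z (Suc k)))) powr p)) < e"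
    \<comment> \<open>For right-endpoint values, interval \<open>k\<close> uses the node \<tau> k,
      and interval \<open>m\<close> is the exceptional one.\<close>
    proof (rule total[where ?k0.0 = m and G = "\<lambda>k. if k = m then 0 else h * F (\<tau> k)"])
      have "(\<Sum>k\<le>m. if k = m then 0 else h * F (\<tau> k)) = (\<Sum>k<m. h * F (\<tau> k))"
        unfolding lessThan_Suc_atMost[symmetric] sum.lessThan_Suc by (auto intro: sum.cong)
      then show "(\<Sum>k\<le>m. if k = m then 0 else h * F (\<tau> k)) \<le> 2 * e1" using sumS by simp
      fix k assume k: "k \<le> m"
      show "integral {z k..z (Suc k)} (\<lambda>r. norm (v r - (if k = m then 0 else v (z (Suc k)))) powr p)
        \<le> (if k = m then e / 2 else 0) + C * integral {z k..z (Suc k)} F + C * (2 * h * w) + 2 * C * (if k = m then 0 else h * F (\<tau> k))"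
      proof (cases "k = m")
        case True
        then show ?thesis using small[of "z m" "z (Suc m)"] mono[of m] gap[of m] zT[of m] zT[of "Suc m"] IF0[of "z m" "z (Suc m)"] by simp
      next
        case False
        then have "z (Suc k) = \<tau> k" using z(2) k by simp
        then show ?thesis using piece[of "z k" "z (Suc k)" "z (Suc k)"] mono[OF k] gap[OF k] zT[of k] zT[of "Suc k"] k False by simp
      qed
    qed simp
  qed
qed

lemma LpD:
  assumes "v \<in> Lp T p"
  shows "bochner_measurable (lebesgue_on {0..T}) v" "integrable (lebesgue_on {0..T}) (\<lambda>r. norm (v r) powr p)"
  using assms by (auto simp: Lp_def)

lemma pairing_integrable:
  fixes g :: "real \<Rightarrow> 'v::real_normed_vector \<Rightarrow>\<^sub>L real"
  assumes p: "1 < p" "1 / p + 1 / q = 1" and g: "g \<in> Lp T q" and v: "v \<in> Lp T p"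
  shows "integrable (lebesgue_on {0..T}) (\<lambda>r. g r (v r))"
proof -
  let ?M = "lebesgue_on {0..T}"
  interpret complete_measure ?M by (rule complete_measure_lebesgue_on) simp
  obtain C where C: "0 < C" "\<And>a b. 0 \<le> a \<Longrightarrow> 0 \<le> b \<Longrightarrow> a * b \<le> 1 * a powr q + C * b powr p"
    by (rule young_epsilon[OF p zero_less_one]) (rule that)
  show ?thesis
  proof (rule Bochner_Integration.integrable_bound)
    show "integrable ?M (\<lambda>r. norm (g r) powr q + C * norm (v r) powr p)" using LpD[OF g] LpD[OF v] by simp
    show "(\<lambda>r. g r (v r)) \<in> borel_measurable ?M" by (rule bochner_measurable_pairing[OF LpD(1)[OF g] LpD(1)[OF v]])
    show "AE r in ?M. norm (g r (v r)) \<le> norm (norm (g r) powr q + C * norm (v r) powr p)"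
    proof (rule AE_I2)
      fix r
      have "norm (g r (v r)) \<le> norm (g r) * norm (v r)" by (rule norm_blinfun)
      also have "\<dots> \<le> norm (g r) powr q + C * norm (v r) powr p" using C(2)[of "norm (g r)" "norm (v r)"] by simp
      finally show "norm (g r (v r)) \<le> norm (norm (g r) powr q + C * norm (v r) powr p)" by simp
    qed
  qed
qed

lemma Lp_const: "(\<lambda>_. c) \<in> Lp T p"
proof -
  interpret finite_measure "lebesgue_on {0..T}" by (rule finite_measure_lebesgue_on) simp
  show ?thesis by (simp add: Lp_def bochner_measurable_const)
qed

lemma pairing_step_estimate:
  fixes g :: "real \<Rightarrow> 'v::real_normed_vector \<Rightarrow>\<^sub>L real"
  assumes p: "1 < p" "1 / p + 1 / q = 1" and g: "g \<in> Lp T q" and v: "v \<in> Lp T p"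
    and z: "\<And>k. k \<le> m \<Longrightarrow> z k \<le> z (Suc k)" "0 \<le> z 0" "z (Suc m) \<le> T"
    and young: "\<And>a b. 0 \<le> a \<Longrightarrow> 0 \<le> b \<Longrightarrow> a * b \<le> l * a powr q + C * b powr p" and lC: "0 \<le> l" "0 \<le> C"
    and small: "(\<Sum>k\<le>m. integral {z k..z (Suc k)} (\<lambda>r. norm (v r - c k) powr p)) < e"
  shows "\<bar>integral {z 0..z (Suc m)} (\<lambda>r. g r (v r)) - (\<Sum>k\<le>m. integral {z k..z (Suc k)} (\<lambda>r. g r (c k)))\<bar>
    \<le> l * (\<integral>r. norm (g r) powr q \<partial>lebesgue_on {0..T}) + C * e"
proof -
  let ?M = "lebesgue_on {0..T}"
  have z_ge: "z 0 \<le> z k" if "k \<le> Suc m" for k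
    using that z(1) by (induction k) (auto intro: order_trans)
  have z_le: "z k \<le> z (Suc m)" if "k \<le> Suc m" for k
    using that by (induction k rule: inc_induct) (auto intro: order_trans z(1) simp: less_Suc_eq_le)
  have zT: "0 \<le> z k" "z (Suc k) \<le> T" if "k \<le> m" for k
    using z_ge[of k] z_le[of "Suc k"] z that by auto
  have gvi: "integrable ?M (\<lambda>r. g r (v r))" by (rule pairing_integrable[OF p g v])
  have gci: "integrable ?M (\<lambda>r. g r (c k))" for k by (rule pairing_integrable[OF p g Lp_const])
  have gi: "integrable ?M (\<lambda>r. norm (g r) powr q)" by (rule LpD[OF g])
  have vi: "integrable ?M (\<lambda>r. norm (v r - c k) powr p)" for k
    using p by (intro Lp_diff_const_integrable[OF _ v]) auto
  have each: "\<bar>integral {z k..z (Suc k)} (\<lambda>r. g r (v r)) - integral {z k..z (Suc k)} (\<lambda>r. g r (c k))\<bar>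
      \<le> l * integral {z k..z (Suc k)} (\<lambda>r. norm (g r) powr q) + C * integral {z k..z (Suc k)} (\<lambda>r. norm (v r - c k) powr p)"
    if k: "k \<le> m" for k
  proof -
    note i = integral_subinterval(2)[OF gvi zT[OF k]] integral_subinterval(2)[OF gci zT[OF k]]
      integral_subinterval(2)[OF gi zT[OF k]] integral_subinterval(2)[OF vi zT[OF k]]
    have "norm (integral {z k..z (Suc k)} (\<lambda>r. g r (v r) - g r (c k)))
      \<le> integral {z k..z (Suc k)} (\<lambda>r. l * norm (g r) powr q + C * norm (v r - c k) powr p)"
    proof (rule Henstock_Kurzweil_Integration.integral_norm_bound_integral)
      fix r
      have "norm (g r (v r) - g r (c k)) \<le> norm (g r) * norm (v r - c k)"
        using norm_blinfun[of "g r" "v r - c k"] by (simp add: blinfun.bilinear_simps)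
      also have "\<dots> \<le> l * norm (g r) powr q + C * norm (v r - c k) powr p" by (rule young) auto
      finally show "norm (g r (v r) - g r (c k)) \<le> l * norm (g r) powr q + C * norm (v r - c k) powr p" .
    qed (intro i integrable_diff integrable_add integrable_on_mult_right)+
    then show ?thesis
      using i by (simp add: Henstock_Kurzweil_Integration.integral_diff Henstock_Kurzweil_Integration.integral_add integrable_on_mult_right)
  qed
  have "(\<Sum>k\<le>m. integral {z k..z (Suc k)} (\<lambda>r. g r (v r))) = integral {z 0..z (Suc m)} (\<lambda>r. g r (v r))"
    by (rule integral_consecutive[OF z(1) integral_subinterval(2)[OF gvi z(2,3)]])
  then have "\<bar>integral {z 0..z (Suc m)} (\<lambda>r. g r (v r)) - (\<Sum>k\<le>m. integral {z k..z (Suc k)} (\<lambda>r. g r (c k)))\<bar>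
    = \<bar>\<Sum>k\<le>m. integral {z k..z (Suc k)} (\<lambda>r. g r (v r)) - integral {z k..z (Suc k)} (\<lambda>r. g r (c k))\<bar>"
    by (simp only: sum_subtractf)
  also have "\<dots> \<le> (\<Sum>k\<le>m. \<bar>integral {z k..z (Suc k)} (\<lambda>r. g r (v r)) - integral {z k..z (Suc k)} (\<lambda>r. g r (c k))\<bar>)"
    by (rule sum_abs)
  also have "\<dots> \<le> (\<Sum>k\<le>m. l * integral {z k..z (Suc k)} (\<lambda>r. norm (g r) powr q) + C * integral {z k..z (Suc k)} (\<lambda>r. norm (v r - c k) powr p))"
    using each by (intro sum_mono) auto
  also have "\<dots> = l * (\<Sum>k\<le>m. integral {z k..z (Suc k)} (\<lambda>r. norm (g r) powr q))
      + C * (\<Sum>k\<le>m. integral {z k..z (Suc k)} (\<lambda>r. norm (v r - c k) powr p))"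
    by (simp only: sum.distrib sum_distrib_left)
  also have "(\<Sum>k\<le>m. integral {z k..z (Suc k)} (\<lambda>r. norm (g r) powr q)) = integral {z 0..z (Suc m)} (\<lambda>r. norm (g r) powr q)"
    by (rule integral_consecutive[OF z(1) integral_subinterval(2)[OF gi z(2,3)]])
  also have "l * integral {z 0..z (Suc m)} (\<lambda>r. norm (g r) powr q)
      + C * (\<Sum>k\<le>m. integral {z k..z (Suc k)} (\<lambda>r. norm (v r - c k) powr p))
    \<le> l * (\<integral>r. norm (g r) powr q \<partial>?M) + C * e"
    using integral_subinterval_le[OF gi z(2,3)] small lC by (intro add_mono mult_left_mono) auto
  finally show ?thesis .
qed

text \<open>Both inequalities say that the squared norm of x - y is nonnegative. They make
  left-endpoint sums at most, and right-endpoint sums at least, the increment of half the squared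
  norm.\<close>

lemma half_norm_diff_bounds:
  fixes x y :: "'h::real_inner"
  shows "(x - y) \<bullet> y \<le> (norm x)\<^sup>2 / 2 - (norm y)\<^sup>2 / 2" "(norm x)\<^sup>2 / 2 - (norm y)\<^sup>2 / 2 \<le> (x - y) \<bullet> x"
proof -
  have "0 \<le> (x - y) \<bullet> (x - y)" by simp
  then have "2 * (x \<bullet> y) \<le> x \<bullet> x + y \<bullet> y" by (simp add: inner_simps inner_commute)
  then show "(x - y) \<bullet> y \<le> (norm x)\<^sup>2 / 2 - (norm y)\<^sup>2 / 2" "(norm x)\<^sup>2 / 2 - (norm y)\<^sup>2 / 2 \<le> (x - y) \<bullet> x"
    by (simp_all add: power2_norm_eq_inner inner_simps inner_commute field_simps)
qed

lemma norm_weakly_lsc: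
  fixes u :: "real \<Rightarrow> 'h::real_inner"
  assumes wc: "\<And>h. continuous_on {0..T} (\<lambda>t. u t \<bullet> h)" and s: "s \<in> {0..T}" and e: "0 < e"
  obtains d where "0 < d" "\<And>r. r \<in> {0..T} \<Longrightarrow> \<bar>r - s\<bar> < d \<Longrightarrow> (norm (u s))\<^sup>2 / 2 - e < (norm (u r))\<^sup>2 / 2"
proof -
  obtain d where d: "0 < d" "\<And>r. r \<in> {0..T} \<Longrightarrow> dist r s < d \<Longrightarrow> dist (u r \<bullet> u s) (u s \<bullet> u s) < e"
    using wc[of "u s"] s e unfolding continuous_on_iff by metis
  show ?thesis
  proof (rule that[OF d(1)])
    fix r assume "r \<in> {0..T}" "\<bar>r - s\<bar> < d"
    then have "\<bar>u r \<bullet> u s - u s \<bullet> u s\<bar> < e" using d(2)[of r] by (simp add: dist_real_def)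
    then show "(norm (u s))\<^sup>2 / 2 - e < (norm (u r))\<^sup>2 / 2"
      using half_norm_diff_bounds(1)[of "u r" "u s"] by (simp add: inner_simps)
  qed
qed

text \<open>Testing with the left-endpoint (right-endpoint) step function turns the integral into a telescoping
  sum that is bounded above (below) by the increment of \<open>\<parallel>u\<parallel>\<^sup>2/2\<close>; at the end of the
  interval where the step function vanishes, weak lower semicontinuity of the norm has the right sign.\<close>

lemma energy_limit:
  fixes \<iota> :: "'v::real_normed_vector \<Rightarrow>\<^sub>L 'h::real_inner" and g :: "nat \<Rightarrow> real \<Rightarrow> 'v \<Rightarrow>\<^sub>L real"
  assumes p: "1 < p" "1 / p + 1 / q = 1" and v: "v \<in> Lp T p"
    and uv: "AE r in lebesgue_on {0..T}. \<iota> (v r) = u r"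
    and wc: "\<And>h. continuous_on {0..T} (\<lambda>t. u t \<bullet> h)"
    and g: "\<And>n. g n \<in> Lp T q" and gK: "\<And>n. (\<integral>r. norm (g n r) powr q \<partial>lebesgue_on {0..T}) \<le> K"
    and conv: "\<And>w s t. 0 \<le> s \<Longrightarrow> s \<le> t \<Longrightarrow> t \<le> T \<Longrightarrow>
      (\<lambda>n. integral {s..t} (\<lambda>r. g n r w)) \<longlonglongrightarrow> (u t - u s) \<bullet> \<iota> w"
    and st: "0 \<le> s" "s \<le> t" "t \<le> T"
  shows "(\<lambda>n. integral {s..t} (\<lambda>r. g n r (v r))) \<longlonglongrightarrow> (norm (u t))\<^sup>2 / 2 - (norm (u s))\<^sup>2 / 2"
proof (cases "s = t")
  case False
  then have s_t: "s < t" using st by simp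
  let ?M = "lebesgue_on {0..T}"
  define \<phi> where "\<phi> r = (norm (u r))\<^sup>2 / 2" for r
  have K: "0 \<le> K" using order_trans[OF Bochner_Integration.integral_nonneg gK[of 0]] by simp
  show ?thesis
  proof (rule tendstoI)
    fix e :: real assume e: "0 < e"
    \<comment> \<open>With l K \<le> e/8 and C e' \<le> e/8, replacing \<open>v\<close> by a step
      function costs at most e/4. The limit in \<open>n\<close> and the semicontinuity at an
      endpoint cost e/4 each.\<close>
    define l where "l = e / (8 * (K + 1))"
    have l: "0 < l" "l * K \<le> e / 8" using e K by (auto simp: l_def field_simps)
    obtain C where C: "0 < C" "\<And>a b. 0 \<le> a \<Longrightarrow> 0 \<le> b \<Longrightarrow> a * b \<le> l * a powr q + C * b powr p"
      by (rule young_epsilon[OF p l(1)]) (rule that)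
    have sT: "s \<in> {0..T}" "t \<in> {0..T}" "0 < e / 4" using st e by auto
    obtain d1 where d1: "0 < d1" "\<And>r. r \<in> {0..T} \<Longrightarrow> \<bar>r - s\<bar> < d1 \<Longrightarrow> \<phi> s - e / 4 < \<phi> r"
      by (rule norm_weakly_lsc[OF wc sT(1,3), folded \<phi>_def]) (rule that)
    obtain d2 where d2: "0 < d2" "\<And>r. r \<in> {0..T} \<Longrightarrow> \<bar>r - t\<bar> < d2 \<Longrightarrow> \<phi> t - e / 4 < \<phi> r"
      by (rule norm_weakly_lsc[OF wc sT(2,3), folded \<phi>_def]) (rule that)
    define e' where "e' = min (e / (8 * C)) (min d1 d2)"
    have e': "0 < e'" "C * e' \<le> e / 8" "e' \<le> d1" "e' \<le> d2"
    proof -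
      show "0 < e'" "e' \<le> d1" "e' \<le> d2" using e C d1 d2 by (auto simp: e'_def)
      have "C * e' \<le> C * (e / (8 * C))" using C by (intro mult_left_mono) (auto simp: e'_def)
      then show "C * e' \<le> e / 8" using C by simp
    qed
    have "0 < p" using p by simp
    \<comment> \<open>The property \<open>Q\<close> is taken to be \<iota> (v r) = u r, so the value
      of the step function at an interior node can be exchanged for the value of
      \<open>u\<close>.\<close>
    then obtain m z where z: "z 0 = s" "z (Suc m) = t" "\<And>k. k \<le> m \<Longrightarrow> z k \<le> z (Suc k)"
      and zu: "\<And>k. 1 \<le> k \<Longrightarrow> k \<le> m \<Longrightarrow> \<iota> (v (z k)) = u (z k)" and m: "1 \<le> m"
      and ends: "z 1 - s < e'" "t - z m < e'"
      and left: "(\<Sum>k\<le>m. integral {z k..z (Suc k)} (\<lambda>r. norm (v r - (if k = 0 then 0 else v (z k))) powr p)) < e'"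
      and right: "(\<Sum>k\<le>m. integral {z k..z (Suc k)} (\<lambda>r. norm (v r - (if k = m then 0 else v (z (Suc k)))) powr p)) < e'"
      by (rule Lp_step_approx[OF _ v st(1) s_t st(3) uv e'(1)]) (rule that)
    have z_ge: "s \<le> z k" if "k \<le> Suc m" for k
      using that by (induction k) (auto intro: order_trans z(3) simp: z(1))
    have z_le: "z k \<le> t" if "k \<le> Suc m" for k
      using that by (induction k rule: inc_induct) (auto intro: order_trans z(3) simp: z(2) less_Suc_eq_le)
    have z0T: "0 \<le> z 0" "z (Suc m) \<le> T" using z st by auto
    have est: "\<bar>integral {s..t} (\<lambda>r. g n r (v r)) - (\<Sum>k\<le>m. integral {z k..z (Suc k)} (\<lambda>r. g n r (c k)))\<bar> \<le> e / 4"
      if "(\<Sum>k\<le>m. integral {z k..z (Suc k)} (\<lambda>r. norm (v r - c k) powr p)) < e'" for c n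
    proof -
      have "\<bar>integral {z 0..z (Suc m)} (\<lambda>r. g n r (v r)) - (\<Sum>k\<le>m. integral {z k..z (Suc k)} (\<lambda>r. g n r (c k)))\<bar>
        \<le> l * (\<integral>r. norm (g n r) powr q \<partial>?M) + C * e'"
        by (rule pairing_step_estimate[OF p g v z(3) z0T C(2) _ _ that]) (use l C in auto)
      moreover have "l * (\<integral>r. norm (g n r) powr q \<partial>?M) \<le> l * K" using gK l by (intro mult_left_mono) auto
      ultimately show ?thesis using l(2) e'(2) z(1,2) by simp
    qed
    have lim: "(\<lambda>n. \<Sum>k\<le>m. integral {z k..z (Suc k)} (\<lambda>r. g n r (c k))) \<longlonglongrightarrow> (\<Sum>k\<le>m. (u (z (Suc k)) - u (z k)) \<bullet> \<iota> (c k))" for c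
    proof (intro tendsto_sum conv)
      fix k assume "k \<in> {..m}"
      then show "0 \<le> z k" "z k \<le> z (Suc k)" "z (Suc k) \<le> T" using z_ge[of k] z_le[of "Suc k"] z(3)[of k] st by auto
    qed
    define c where "c k = (if k = 0 then 0 else v (z k))" for k
    define c' where "c' k = (if k = m then 0 else v (z (Suc k)))" for k
    define S where "S = (\<Sum>k\<le>m. (u (z (Suc k)) - u (z k)) \<bullet> \<iota> (c k))"
    define S' where "S' = (\<Sum>k\<le>m. (u (z (Suc k)) - u (z k)) \<bullet> \<iota> (c' k))"
    have "S = (\<Sum>k<m. (u (z (Suc (Suc k))) - u (z (Suc k))) \<bullet> \<iota> (c (Suc k)))"
      by (simp add: S_def c_def sum.atMost_shift blinfun.bilinear_simps)
    also have "\<dots> \<le> (\<Sum>k<m. \<phi> (z (Suc (Suc k))) - \<phi> (z (Suc k)))"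
      unfolding \<phi>_def by (intro sum_mono) (simp add: c_def zu half_norm_diff_bounds)
    also have "\<dots> = \<phi> t - \<phi> (z 1)" using sum_lessThan_telescope[of "\<lambda>k. \<phi> (z (Suc k))" m] z(2) by simp
    finally have "S \<le> \<phi> t - \<phi> (z 1)" .
    moreover have "\<phi> s - e / 4 < \<phi> (z 1)"
      using d1(2)[of "z 1"] ends(1) e'(3) z_ge[of 1] z_le[of 1] m st by auto
    ultimately have S: "S < \<phi> t - \<phi> s + e / 4" by simp
    have "\<phi> t - e / 4 < \<phi> (z m)"
      using d2(2)[of "z m"] ends(2) e'(4) z_ge[of m] z_le[of m] m st by auto
    then have "\<phi> t - \<phi> s - e / 4 < \<phi> (z m) - \<phi> (z 0)" using z(1) by simp
    also have "\<dots> = (\<Sum>k<m. \<phi> (z (Suc k)) - \<phi> (z k))" using sum_lessThan_telescope[of "\<lambda>k. \<phi> (z k)" m] by simp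
    also have "\<dots> \<le> (\<Sum>k<m. (u (z (Suc k)) - u (z k)) \<bullet> \<iota> (c' k))"
      unfolding \<phi>_def by (intro sum_mono) (simp add: c'_def zu half_norm_diff_bounds)
    also have "\<dots> = S'" by (simp add: S'_def c'_def lessThan_Suc_atMost[symmetric] blinfun.bilinear_simps)
    finally have S': "\<phi> t - \<phi> s - e / 4 < S'" .
    have "\<forall>\<^sub>F n in sequentially. (\<Sum>k\<le>m. integral {z k..z (Suc k)} (\<lambda>r. g n r (c k))) < S + e / 4"
      using lim[of c] e unfolding S_def by (intro order_tendstoD(2)) auto
    moreover have "\<forall>\<^sub>F n in sequentially. S' - e / 4 < (\<Sum>k\<le>m. integral {z k..z (Suc k)} (\<lambda>r. g n r (c' k)))"
      using lim[of c'] e unfolding S'_def by (intro order_tendstoD(1)) auto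
    ultimately show "\<forall>\<^sub>F n in sequentially. dist (integral {s..t} (\<lambda>r. g n r (v r))) ((norm (u t))\<^sup>2 / 2 - (norm (u s))\<^sup>2 / 2) < e"
    proof eventually_elim
      fix n
      assume a: "(\<Sum>k\<le>m. integral {z k..z (Suc k)} (\<lambda>r. g n r (c k))) < S + e / 4"
        "S' - e / 4 < (\<Sum>k\<le>m. integral {z k..z (Suc k)} (\<lambda>r. g n r (c' k)))"
      have "\<bar>integral {s..t} (\<lambda>r. g n r (v r)) - (\<Sum>k\<le>m. integral {z k..z (Suc k)} (\<lambda>r. g n r (c k)))\<bar> \<le> e / 4"
        by (rule est) (use left in \<open>simp add: c_def\<close>)
      moreover have "\<bar>integral {s..t} (\<lambda>r. g n r (v r)) - (\<Sum>k\<le>m. integral {z k..z (Suc k)} (\<lambda>r. g n r (c' k)))\<bar> \<le> e / 4"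
        by (rule est) (use right in \<open>simp add: c'_def\<close>)
      ultimately have "\<bar>integral {s..t} (\<lambda>r. g n r (v r)) - (\<phi> t - \<phi> s)\<bar> < e"
        using a S S' e by linarith
      then show "dist (integral {s..t} (\<lambda>r. g n r (v r))) ((norm (u t))\<^sup>2 / 2 - (norm (u s))\<^sup>2 / 2) < e"
        by (simp add: dist_real_def \<phi>_def)
    qed
  qed
qed simp

section \<open>Galerkin approximation by a delay equation\<close>

lemma Lp_real_integrable:
  fixes b :: "real \<Rightarrow> real"
  assumes q: "1 \<le> q" and b: "b \<in> Lp T q"
  shows "integrable (lebesgue_on {0..T}) b"
proof -
  interpret complete_measure "lebesgue_on {0..T}" by (rule complete_measure_lebesgue_on) simp
  interpret finite_measure "lebesgue_on {0..T}" by (rule finite_measure_lebesgue_on) simp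
  show ?thesis
  proof (rule Bochner_Integration.integrable_bound)
    show "integrable (lebesgue_on {0..T}) (\<lambda>t. 1 + norm (b t) powr q)" using LpD(2)[OF b] by simp
    show "b \<in> borel_measurable (lebesgue_on {0..T})" using LpD(1)[OF b] by (simp add: bochner_measurable_real)
    have "\<bar>x\<bar> \<le> 1 + \<bar>x\<bar> powr q" for x :: real
    proof (cases "\<bar>x\<bar> \<le> 1")
      case False
      then have "\<bar>x\<bar> powr 1 \<le> \<bar>x\<bar> powr q" using q by (intro powr_mono) auto
      then show ?thesis by simp
    qed (simp add: add_increasing2)
    then show "AE t in lebesgue_on {0..T}. norm (b t) \<le> norm (1 + norm (b t) powr q)"
      by (intro AE_I2) (simp add: add_nonneg_nonneg)
  qed
qed

lemma integral_subinterval_mono: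
  fixes \<gamma> \<kappa> :: "real \<Rightarrow> real"
  assumes g: "integrable (lebesgue_on {0..T}) \<gamma>" and k: "integrable (lebesgue_on {0..T}) \<kappa>"
    and le: "AE r in lebesgue_on {0..T}. \<gamma> r \<le> \<kappa> r" and st: "0 \<le> s" "t \<le> T"
  shows "integral {s..t} \<gamma> \<le> integral {s..t} \<kappa>"
  unfolding integral_subinterval(4)[OF g st] integral_subinterval(4)[OF k st]
proof (rule integral_mono_AE)
  show "AE r in lebesgue_on {0..T}. indicator {s..t} r * \<gamma> r \<le> indicator {s..t} r * \<kappa> r"
    using le by eventually_elim (simp add: indicator_def)
qed (use integral_subinterval(3)[OF g st] integral_subinterval(3)[OF k st] in auto)

lemma bounded_in_Lp:
  assumes p: "0 < p" and m: "bochner_measurable (lebesgue_on {0..T}) v"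
    and b: "AE t in lebesgue_on {0..T}. norm (v t) \<le> K"
  shows "v \<in> Lp T p"
proof -
  interpret complete_measure "lebesgue_on {0..T}" by (rule complete_measure_lebesgue_on) simp
  interpret finite_measure "lebesgue_on {0..T}" by (rule finite_measure_lebesgue_on) simp
  have "integrable (lebesgue_on {0..T}) (\<lambda>t. norm (v t) powr p)"
  proof (rule integrable_const_bound[where B = "K powr p"])
    show "AE t in lebesgue_on {0..T}. norm (norm (v t) powr p) \<le> K powr p"
      using b by eventually_elim (use p in \<open>auto intro: powr_mono2\<close>)
    show "(\<lambda>t. norm (v t) powr p) \<in> borel_measurable (lebesgue_on {0..T})"
      using bochner_measurable_norm[OF m] by measurable
  qed
  then show ?thesis using m by (simp add: Lp_def)
qed

text \<open>The vectors stay in \<open>V\<close> and are orthonormal only after \<iota>. Coordinates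
  in their span are then \<open>H\<close> inner products, while the combinations themselves can be
  inserted into operators on \<open>V\<close>.\<close>

definition orthonormal_image :: "('v::real_normed_vector \<Rightarrow>\<^sub>L 'h::real_inner) \<Rightarrow> 'v set \<Rightarrow> bool" where
  "orthonormal_image \<iota> E \<longleftrightarrow> finite E \<and> (\<forall>e\<in>E. \<forall>e'\<in>E. \<iota> e \<bullet> \<iota> e' = (if e = e' then 1 else 0))"

lemma orthonormal_coeff:
  assumes E: "orthonormal_image \<iota> E" and e: "e \<in> E"
  shows "(\<Sum>d\<in>E. a d *\<^sub>R \<iota> d) \<bullet> \<iota> e = a e"
proof -
  have "(\<Sum>d\<in>E. a d *\<^sub>R \<iota> d) \<bullet> \<iota> e = (\<Sum>d\<in>E. if d = e then a d else 0)"
    unfolding inner_sum_left using E e by (intro sum.cong) (auto simp: orthonormal_image_def)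
  then show ?thesis using E e by (simp add: orthonormal_image_def sum.delta)
qed

lemma orthonormal_norm:
  assumes E: "orthonormal_image \<iota> E"
  shows "(norm (\<Sum>d\<in>E. a d *\<^sub>R \<iota> d))\<^sup>2 = (\<Sum>d\<in>E. (a d)\<^sup>2)"
  unfolding power2_norm_eq_inner inner_sum_right
  using orthonormal_coeff[OF E] by (intro sum.cong) (auto simp: power2_eq_square)

lemma bessel:
  assumes E: "orthonormal_image \<iota> E"
  shows "(\<Sum>d\<in>E. (x \<bullet> \<iota> d)\<^sup>2) \<le> (norm x)\<^sup>2"
proof -
  let ?y = "\<Sum>d\<in>E. (x \<bullet> \<iota> d) *\<^sub>R \<iota> d"
  have "x \<bullet> ?y = (\<Sum>d\<in>E. (x \<bullet> \<iota> d)\<^sup>2)" by (simp add: inner_sum_right power2_eq_square)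
  moreover have "?y \<bullet> ?y = (\<Sum>d\<in>E. (x \<bullet> \<iota> d)\<^sup>2)"
    using orthonormal_norm[OF E] by (simp add: power2_norm_eq_inner)
  moreover have "0 \<le> (x - ?y) \<bullet> (x - ?y)" by simp
  ultimately show ?thesis by (simp add: power2_norm_eq_inner inner_simps inner_commute)
qed

text \<open>The setting after \<open>f\<close> has been absorbed into the operator. Growth is
  assumed separately on every ball of \<open>H\<close>, with constants depending on the radius,
  since there the factor with the \<open>H\<close> norm in (A4) becomes a constant.\<close>

locale evolution =
  fixes T p q :: real and \<iota> :: "'v::banach \<Rightarrow>\<^sub>L 'h::{real_inner, complete_space}"
    and B :: "real \<Rightarrow> 'v \<Rightarrow> ('v \<Rightarrow>\<^sub>L real)" and c1 :: real and k :: "real \<Rightarrow> real"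
  assumes T: "0 < T" and p: "1 < p" "1 / p + 1 / q = 1"
    and B_meas: "\<And>u. u \<in> Lp T p \<Longrightarrow> (\<lambda>t. \<iota> (u t)) \<in> Linf T \<Longrightarrow>
        bochner_measurable (lebesgue_on {0..T}) (\<lambda>t. B t (u t))"
    and c1: "0 < c1" and k_int: "integrable (lebesgue_on {0..T}) k"
    and B_coercive: "AE t in lebesgue_on {0..T}. \<forall>x. c1 * norm x powr p - k t \<le> B t x x"
    and B_growth: "\<And>R. \<exists>a b. 0 \<le> a \<and> b \<in> Lp T q \<and>
        (AE t in lebesgue_on {0..T}. \<forall>x. norm (\<iota> x) \<le> R \<longrightarrow> norm (B t x) \<le> a * norm x powr (p - 1) + b t)"
begin

abbreviation "M \<equiv> lebesgue_on {0..T}"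

sublocale complete_measure M by (rule complete_measure_lebesgue_on) simp
sublocale finite_measure M by (rule finite_measure_lebesgue_on) simp

lemma q: "1 < q" "(p - 1) * q = p"
  using conjugate_exponent[OF p] by auto

lemma B_along_Lp:
  obtains K where "0 \<le> K"
    "\<And>v. v \<in> Lp T p \<Longrightarrow> AE t in M. norm (\<iota> (v t)) \<le> R \<Longrightarrow>
      (\<lambda>t. B t (v t)) \<in> Lp T q \<and>
      (\<integral>t. norm (B t (v t)) powr q \<partial>M) \<le> K * (1 + (\<integral>t. norm (v t) powr p \<partial>M))"
proof -
  obtain a b where ab: "0 \<le> a" "b \<in> Lp T q"
    "AE t in M. \<forall>x. norm (\<iota> x) \<le> R \<longrightarrow> norm (B t x) \<le> a * norm x powr (p - 1) + b t"
    using B_growth by blast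
  define J where "J = (\<integral>t. norm (b t) powr q \<partial>M)"
  define K where "K = 2 powr q * (a powr q + J)"
  have J: "0 \<le> J" by (simp add: J_def)
  show ?thesis
  proof (rule that)
    show "0 \<le> K" using J by (simp add: K_def)
    fix v assume v: "v \<in> Lp T p" and R: "AE t in M. norm (\<iota> (v t)) \<le> R"
    have m: "bochner_measurable M (\<lambda>t. B t (v t))"
      by (rule B_meas[OF v]) (use LpD(1)[OF v] R in \<open>auto simp: Linf_def intro: bochner_measurable_blinfun_apply\<close>)
    have bound: "AE t in M. norm (B t (v t)) powr q \<le> 2 powr q * (a powr q * norm (v t) powr p + norm (b t) powr q)"
      using ab(3) R
    proof eventually_elim
      fix t assume "\<forall>x. norm (\<iota> x) \<le> R \<longrightarrow> norm (B t x) \<le> a * norm x powr (p - 1) + b t" "norm (\<iota> (v t)) \<le> R"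
      then have "norm (B t (v t)) \<le> a * norm (v t) powr (p - 1) + norm (b t)" by fastforce
      then have "norm (B t (v t)) powr q \<le> (a * norm (v t) powr (p - 1) + norm (b t)) powr q"
        using q by (intro powr_mono2) auto
      also have "\<dots> \<le> 2 powr q * ((a * norm (v t) powr (p - 1)) powr q + norm (b t) powr q)"
        using q ab(1) by (intro powr_add_le) auto
      also have "(a * norm (v t) powr (p - 1)) powr q = a powr q * norm (v t) powr p"
        using ab(1) by (simp add: powr_mult powr_powr q(2))
      finally show "norm (B t (v t)) powr q \<le> 2 powr q * (a powr q * norm (v t) powr p + norm (b t) powr q)" .
    qed
    have i: "integrable M (\<lambda>t. 2 powr q * (a powr q * norm (v t) powr p + norm (b t) powr q))"
      using LpD(2)[OF v] LpD(2)[OF ab(2)] by simp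
    have Bi: "integrable M (\<lambda>t. norm (B t (v t)) powr q)"
    proof (rule Bochner_Integration.integrable_bound[OF i])
      show "(\<lambda>t. norm (B t (v t)) powr q) \<in> borel_measurable M"
        using bochner_measurable_norm[OF m] by measurable
      show "AE t in M. norm (norm (B t (v t)) powr q)
          \<le> norm (2 powr q * (a powr q * norm (v t) powr p + norm (b t) powr q))"
        using bound by eventually_elim simp
    qed
    have "(\<integral>t. norm (B t (v t)) powr q \<partial>M) \<le> (\<integral>t. 2 powr q * (a powr q * norm (v t) powr p + norm (b t) powr q) \<partial>M)"
      by (rule integral_mono_AE[OF Bi i bound])
    also have "\<dots> = 2 powr q * (a powr q * (\<integral>t. norm (v t) powr p \<partial>M) + J)"
      using LpD(2)[OF v] LpD(2)[OF ab(2)] by (simp add: J_def)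
    also have "\<dots> \<le> K * (1 + (\<integral>t. norm (v t) powr p \<partial>M))"
    proof -
      have "0 \<le> (\<integral>t. norm (v t) powr p \<partial>M)" by simp
      then have "a powr q * (\<integral>t. norm (v t) powr p \<partial>M) + J \<le> (a powr q + J) * (1 + (\<integral>t. norm (v t) powr p \<partial>M))"
        using J by (simp add: algebra_simps)
      from mult_left_mono[OF this, of "2 powr q"] show ?thesis by (simp add: K_def)
    qed
    finally show "(\<lambda>t. B t (v t)) \<in> Lp T q \<and>
      (\<integral>t. norm (B t (v t)) powr q \<partial>M) \<le> K * (1 + (\<integral>t. norm (v t) powr p \<partial>M))"
      using m Bi by (simp add: Lp_def)
  qed
qed

text \<open>The right-hand side is evaluated at a time delayed by \<open>\<delta>\<close>, so that the solution is
  obtained by stepping, without a fixed point or compactness argument. Cutting off outside the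
  ball of radius \<open>R\<close> makes the delay error small uniformly; the energy estimate then shows that the
  cut-off was never active.\<close>

definition cutoff :: "real \<Rightarrow> (real \<Rightarrow> 'v) \<Rightarrow> 'v \<Rightarrow> real \<Rightarrow> real" where
  "cutoff R x w r = (if norm (\<iota> (x r)) \<le> R then - B r (x r) w else 0)"

text \<open>For t below \<delta> the interval of integration is empty, so the history enters only as
  the orthogonal projection of \<open>u0\<close> onto the image of the span of
  \<open>E\<close>.\<close>

definition delay_step :: "real \<Rightarrow> 'v set \<Rightarrow> 'h \<Rightarrow> real \<Rightarrow> (real \<Rightarrow> 'v) \<Rightarrow> real \<Rightarrow> 'v" where
  "delay_step R E u0 \<delta> x t = (\<Sum>e\<in>E. (u0 \<bullet> \<iota> e + integral {0..t - \<delta>} (cutoff R x e)) *\<^sub>R e)"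

definition continuous_combination :: "'v set \<Rightarrow> (real \<Rightarrow> 'v) \<Rightarrow> bool" where
  "continuous_combination E x \<longleftrightarrow>
     (\<exists>c. (\<forall>e\<in>E. continuous_on {0..T} (c e)) \<and> (\<forall>t. x t = (\<Sum>e\<in>E. c e t *\<^sub>R e)))"

lemma continuous_combination_Lp:
  assumes E: "finite E" and x: "continuous_combination E x"
  shows "x \<in> Lp T p" "(\<lambda>t. \<iota> (x t)) \<in> Linf T"
proof -
  obtain c where c: "\<And>e. e \<in> E \<Longrightarrow> continuous_on {0..T} (c e)" "\<And>t. x t = (\<Sum>e\<in>E. c e t *\<^sub>R e)"
    using x by (auto simp: continuous_combination_def)
  have xe: "x = (\<lambda>t. \<Sum>e\<in>E. c e t *\<^sub>R e)" using c(2) by auto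
  have m: "bochner_measurable M x" unfolding xe by (rule continuous_on_sum_bochner[OF E c(1)])
  have "continuous_on {0..T} x" unfolding xe by (intro continuous_intros c(1))
  then have "bounded (x ` {0..T})" by (intro compact_imp_bounded compact_continuous_image compact_Icc)
  then obtain K where "\<forall>y\<in>x ` {0..T}. norm y \<le> K" unfolding bounded_iff by blast
  then have K: "norm (x t) \<le> K" if "t \<in> {0..T}" for t using that by simp
  show "x \<in> Lp T p" using p K by (intro bounded_in_Lp[OF _ m] AE_I2) auto
  have "norm (\<iota> (x t)) \<le> norm \<iota> * K" if "t \<in> {0..T}" for t
    using norm_blinfun[of \<iota> "x t"] mult_left_mono[OF K[OF that], of "norm \<iota>"] by simp
  then show "(\<lambda>t. \<iota> (x t)) \<in> Linf T"
    using m by (auto simp: Linf_def intro!: bochner_measurable_blinfun_apply exI[of _ "norm \<iota> * K"] AE_I2)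
qed

text \<open>On the span of \<open>E\<close> the norm of \<open>V\<close> is at most \<open>L\<close>
  times that of \<open>H\<close>, since each coordinate is an inner product with a unit vector.
  Inside the ball of radius \<open>R\<close> the growth bound therefore has a majorant \<kappa> that
  depends neither on \<open>x\<close> nor on \<open>e\<close>; this uniformity controls the delay
  error.\<close>

lemma cutoff_bound:
  assumes E: "orthonormal_image \<iota> E"
  obtains \<kappa> where "integrable M \<kappa>" "\<And>r. 0 \<le> \<kappa> r"
    "\<And>x e. continuous_combination E x \<Longrightarrow> e \<in> E \<Longrightarrow>
      integrable M (cutoff R x e) \<and> (AE r in M. \<bar>cutoff R x e r\<bar> \<le> \<kappa> r)"
proof -
  have fE: "finite E" using E by (simp add: orthonormal_image_def)
  obtain a b where ab: "0 \<le> a" "b \<in> Lp T q"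
    "AE t in M. \<forall>x. norm (\<iota> x) \<le> R \<longrightarrow> norm (B t x) \<le> a * norm x powr (p - 1) + b t"
    using B_growth by blast
  define L where "L = (\<Sum>e\<in>E. norm e)"
  have L: "0 \<le> L" by (simp add: L_def sum_nonneg)
  define \<kappa> where "\<kappa> r = (a * (R * L) powr (p - 1) + \<bar>b r\<bar>) * L" for r
  have bi: "integrable M b" using q by (intro Lp_real_integrable[OF _ ab(2)]) simp
  have \<kappa>i: "integrable M \<kappa>" unfolding \<kappa>_def using bi by auto
  have k0: "0 \<le> \<kappa> r" for r using ab(1) L by (simp add: \<kappa>_def)
  show ?thesis
  proof (rule that[OF \<kappa>i k0])
    fix x e assume x: "continuous_combination E x" and e: "e \<in> E"
    obtain c where c: "\<And>t. x t = (\<Sum>e\<in>E. c e t *\<^sub>R e)" using x by (auto simp: continuous_combination_def)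
    have xL: "norm (x t) \<le> norm (\<iota> (x t)) * L" for t
    proof -
      have ix: "\<iota> (x t) = (\<Sum>e\<in>E. c e t *\<^sub>R \<iota> e)" unfolding c by (simp add: blinfun.bilinear_simps blinfun.sum_right)
      have ce: "\<bar>c d t\<bar> \<le> norm (\<iota> (x t))" if "d \<in> E" for d
      proof -
        have "norm (\<iota> d) = 1" using E that by (simp add: orthonormal_image_def norm_eq_1)
        then show ?thesis
          using Cauchy_Schwarz_ineq2[of "\<iota> (x t)" "\<iota> d"] orthonormal_coeff[OF E that, of "\<lambda>e. c e t"] by (simp add: ix)
      qed
      have "norm (x t) \<le> (\<Sum>e\<in>E. norm (c e t *\<^sub>R e))" unfolding c by (rule norm_sum)
      also have "\<dots> \<le> (\<Sum>e\<in>E. norm (\<iota> (x t)) * norm e)"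
        using ce by (intro sum_mono) (simp add: mult_right_mono)
      finally show ?thesis by (simp add: L_def sum_distrib_left)
    qed
    have eL: "norm e \<le> L" unfolding L_def by (rule member_le_sum[OF e _ fE]) simp
    have bound: "AE r in M. \<bar>cutoff R x e r\<bar> \<le> \<kappa> r"
      using ab(3)
    proof eventually_elim
      fix r assume g: "\<forall>x. norm (\<iota> x) \<le> R \<longrightarrow> norm (B r x) \<le> a * norm x powr (p - 1) + b r"
      show "\<bar>cutoff R x e r\<bar> \<le> \<kappa> r"
      proof (cases "norm (\<iota> (x r)) \<le> R")
        case True
        then have "norm (x r) \<le> R * L" using xL[of r] mult_right_mono[OF True L] by simp
        then have "norm (x r) powr (p - 1) \<le> (R * L) powr (p - 1)" using p by (intro powr_mono2) auto
        then have "a * norm (x r) powr (p - 1) + b r \<le> a * (R * L) powr (p - 1) + \<bar>b r\<bar>"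
          using ab(1) by (intro add_mono mult_left_mono) auto
        with g True have n: "norm (B r (x r)) \<le> a * (R * L) powr (p - 1) + \<bar>b r\<bar>" by force
        have "\<bar>cutoff R x e r\<bar> \<le> norm (B r (x r)) * norm e"
          using norm_blinfun[of "B r (x r)" e] True by (simp add: cutoff_def)
        also have "\<dots> \<le> \<kappa> r" unfolding \<kappa>_def using n eL ab(1) by (intro mult_mono) auto
        finally show ?thesis .
      qed (simp add: cutoff_def k0)
    qed
    have m1: "bochner_measurable M (\<lambda>r. \<iota> (x r))" "bochner_measurable M (\<lambda>r. B r (x r))"
      using continuous_combination_Lp[OF fE x] B_meas by (auto simp: Linf_def)
    have [measurable]: "(\<lambda>r. norm (\<iota> (x r))) \<in> borel_measurable M" "(\<lambda>r. B r (x r) e) \<in> borel_measurable M"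
      using bochner_measurable_norm[OF m1(1)] bochner_measurable_pairing[OF m1(2) bochner_measurable_const] by auto
    have "cutoff R x e \<in> borel_measurable M" unfolding cutoff_def[abs_def] by measurable
    moreover have "AE r in M. norm (cutoff R x e r) \<le> norm (\<kappa> r)" using bound by eventually_elim (simp add: k0)
    ultimately show "integrable M (cutoff R x e) \<and> (AE r in M. \<bar>cutoff R x e r\<bar> \<le> \<kappa> r)"
      using Bochner_Integration.integrable_bound[OF \<kappa>i] bound by blast
  qed
qed

lemma delay_step_continuous_combination:
  assumes E: "orthonormal_image \<iota> E" and x: "continuous_combination E x" and d: "0 < \<delta>"
  shows "continuous_combination E (delay_step R E u0 \<delta> x)"
  unfolding continuous_combination_def delay_step_def
proof (intro exI conjI ballI allI)
  fix e assume e: "e \<in> E"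
  have "integrable M (cutoff R x e)" using cutoff_bound[OF E, of R] x e by metis
  then have "continuous_on {0..T} (\<lambda>s. integral {0..s} (cutoff R x e))"
    using integral_subinterval(2)[of T _ 0 T] T by (intro indefinite_integral_continuous_1) auto
  \<comment> \<open>Clamping keeps the upper limit inside the time interval, where the primitive is
    known to be continuous, and does not change the integral.\<close>
  moreover have "continuous_on {0..T} (\<lambda>t. max 0 (t - \<delta>))" by (intro continuous_intros)
  ultimately have "continuous_on {0..T} (\<lambda>t. integral {0..max 0 (t - \<delta>)} (cutoff R x e))"
    using d by (elim continuous_on_compose2) auto
  moreover have "integral {0..max 0 (t - \<delta>)} (cutoff R x e) = integral {0..t - \<delta>} (cutoff R x e)" for t
    by (cases "t - \<delta> \<le> 0") (auto simp: max_def)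
  ultimately show "continuous_on {0..T} (\<lambda>t. u0 \<bullet> \<iota> e + integral {0..t - \<delta>} (cutoff R x e))"
    by (intro continuous_intros) simp
qed simp

text \<open>Method of steps: on the interval up to n \<delta> the n-th iterate is already reproduced
  by \<open>delay_step\<close>, because its value at \<open>t\<close> uses only times up to t -
  \<delta>. Finitely many iterations cover the whole time interval.\<close>

lemma delay_solution:
  assumes E: "orthonormal_image \<iota> E" and d: "0 < \<delta>"
  obtains x where "continuous_combination E x" "\<And>t. t \<in> {0..T} \<Longrightarrow> x t = delay_step R E u0 \<delta> x t"
proof -
  define X where "X n = (delay_step R E u0 \<delta> ^^ n) (\<lambda>_. \<Sum>e\<in>E. (u0 \<bullet> \<iota> e) *\<^sub>R e)" for n
  have X: "continuous_combination E (X n)" for n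
  proof (induction n)
    case 0
    show ?case unfolding X_def continuous_combination_def by (intro exI[of _ "\<lambda>e t. u0 \<bullet> \<iota> e"]) auto
  next
    case (Suc n)
    then show ?case using delay_step_continuous_combination[OF E _ d] by (simp add: X_def)
  qed
  have agree: "X n t = X (Suc n) t" if "t \<in> {0..T}" "t \<le> real n * \<delta>" for n t
    using that
  proof (induction n arbitrary: t)
    case 0
    then have "t - \<delta> < 0" using d by simp
    then show ?case by (simp add: X_def delay_step_def)
  next
    case (Suc n)
    have "integral {0..t - \<delta>} (cutoff R (X n) e) = integral {0..t - \<delta>} (cutoff R (X (Suc n)) e)" for e
    proof (rule Henstock_Kurzweil_Integration.integral_cong)
      fix r assume "r \<in> {0..t - \<delta>}"
      then have "X n r = X (Suc n) r" using Suc.prems d by (intro Suc.IH) (auto simp: algebra_simps)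
      then show "cutoff R (X n) e r = cutoff R (X (Suc n)) e r" by (simp add: cutoff_def)
    qed
    then have "delay_step R E u0 \<delta> (X n) t = delay_step R E u0 \<delta> (X (Suc n)) t" by (simp only: delay_step_def)
    then show ?case by (simp add: X_def)
  qed
  obtain n where n: "T / \<delta> \<le> real n" using real_arch_simple by blast
  show ?thesis
  proof (rule that[OF X[of n]])
    fix t assume t: "t \<in> {0..T}"
    have "T \<le> real n * \<delta>" using n d by (simp add: field_simps)
    then have "X n t = X (Suc n) t" using t by (intro agree) auto
    then show "X n t = delay_step R E u0 \<delta> (X n) t" by (simp add: X_def)
  qed
qed

text \<open>The square root bounds the undelayed primitive: the 2 under the root is the share of the
  delay error in the energy estimate. The final 1 is the distance between the delayed and the
  undelayed function.\<close>

definition energy_radius :: "'h \<Rightarrow> real" where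
  "energy_radius u0 = sqrt ((norm u0)\<^sup>2 + 2 * (\<integral>r. \<bar>k r\<bar> \<partial>M) + 2) + 1"

text \<open>\<open>u\<close> solves the delay equation, and \<open>y\<close> is the primitive of the
  same right-hand side without delay. The Galerkin equation is exact for \<open>y\<close> with the
  operator evaluated at \<open>u\<close>; the two functions differ by at most \<epsilon> in
  \<open>H\<close>.\<close>

lemma galerkin_solution:
  assumes E: "orthonormal_image \<iota> E" and eps: "0 < \<epsilon>" "\<epsilon> \<le> 1"
  obtains u y where "u \<in> Lp T p" "\<And>t. t \<in> {0..T} \<Longrightarrow> norm (\<iota> (u t)) \<le> energy_radius u0"
    "\<And>t. t \<in> {0..T} \<Longrightarrow> norm (y t - \<iota> (u t)) \<le> \<epsilon>"
    "\<And>t w. t \<in> {0..T} \<Longrightarrow> w \<in> span E \<Longrightarrow> y t \<bullet> \<iota> w = u0 \<bullet> \<iota> w - integral {0..t} (\<lambda>r. B r (u r) w)"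
    "\<And>t. t \<in> {0..T} \<Longrightarrow> (norm (y t))\<^sup>2 / 2 \<le> (norm u0)\<^sup>2 / 2 - integral {0..t} (\<lambda>r. B r (u r) (u r)) + \<epsilon>"
proof -
  define R where "R = energy_radius u0"
  have fE: "finite E" using E by (simp add: orthonormal_image_def)
  have normE: "norm (\<iota> e) = 1" if "e \<in> E" for e using E that by (simp add: orthonormal_image_def norm_eq_1)
  obtain \<kappa> where \<kappa>: "integrable M \<kappa>" "\<And>r. 0 \<le> \<kappa> r"
    and cut: "\<And>x e. continuous_combination E x \<Longrightarrow> e \<in> E \<Longrightarrow>
      integrable M (cutoff R x e) \<and> (AE r in M. \<bar>cutoff R x e r\<bar> \<le> \<kappa> r)"
    by (rule cutoff_bound[OF E, of R]) (rule that)
  define N where "N = real (card E)"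
  define I where "I = (\<integral>r. \<kappa> r \<partial>M)"
  \<comment> \<open>\<eta> will bound the change of each coordinate over one delay. Summed over the
    basis it must stay below \<epsilon>, both by itself, for the distance in \<open>H\<close>, and
    multiplied by the integral of \<kappa>, for the energy error.\<close>
  define \<eta> where "\<eta> = \<epsilon> / ((N + 1) * (I + 1))"
  have NI: "0 \<le> N" "0 \<le> I" using \<kappa> by (auto simp: N_def I_def)
  have \<eta>: "0 < \<eta>" "N * \<eta> \<le> \<epsilon>" "\<eta> * N * I \<le> \<epsilon>"
  proof -
    have pos: "0 < (N + 1) * (I + 1)" using NI by (simp add: add_nonneg_pos)
    then show "0 < \<eta>" using eps by (simp add: \<eta>_def)
    have "\<epsilon> * N \<le> \<epsilon> * ((N + 1) * (I + 1))" "\<epsilon> * (N * I) \<le> \<epsilon> * ((N + 1) * (I + 1))"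
      using NI eps by (auto intro!: mult_left_mono simp: algebra_simps)
    then show "N * \<eta> \<le> \<epsilon>" "\<eta> * N * I \<le> \<epsilon>"
      using pos by (simp_all add: \<eta>_def divide_le_eq mult_ac)
  qed
  obtain d where d: "0 < d" "\<And>s t. 0 \<le> s \<Longrightarrow> s \<le> t \<Longrightarrow> t \<le> T \<Longrightarrow> t - s < d \<Longrightarrow> \<bar>integral {s..t} \<kappa>\<bar> < \<eta>"
    by (rule integral_absolutely_continuous[OF \<kappa>(1) \<eta>(1)]) (rule that)
  define \<delta> where "\<delta> = d / 2"
  have \<delta>: "0 < \<delta>" "\<delta> < d" using d(1) by (auto simp: \<delta>_def)
  obtain u where u: "continuous_combination E u" "\<And>t. t \<in> {0..T} \<Longrightarrow> u t = delay_step R E u0 \<delta> u t"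
    by (rule delay_solution[OF E \<delta>(1), where R = R and ?u0.0 = u0]) (rule that)
  define G where "G e = cutoff R u e" for e
  have Gi: "integrable M (G e)" and G\<kappa>: "AE r in M. \<bar>G e r\<bar> \<le> \<kappa> r" if "e \<in> E" for e
    using cut[OF u(1) that] by (auto simp: G_def)
  define c where "c e t = u0 \<bullet> \<iota> e + integral {0..t - \<delta>} (G e)" for e t
  define y where "y e t = u0 \<bullet> \<iota> e + integral {0..t} (G e)" for e t
  define Y where "Y t = (\<Sum>e\<in>E. y e t *\<^sub>R \<iota> e)" for t
  have ut: "u t = (\<Sum>e\<in>E. c e t *\<^sub>R e)" if "t \<in> {0..T}" for t
    using u(2)[OF that] by (simp add: delay_step_def c_def G_def)
  have iut: "\<iota> (u t) = (\<Sum>e\<in>E. c e t *\<^sub>R \<iota> e)" if "t \<in> {0..T}" for t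
    unfolding ut[OF that] by (simp add: blinfun.bilinear_simps blinfun.sum_right)
  have absG: "\<bar>integral {s..t} (G e)\<bar> \<le> integral {s..t} \<kappa>" if "e \<in> E" "0 \<le> s" "t \<le> T" for e s t
  proof -
    have "integral {s..t} (G e) \<le> integral {s..t} \<kappa>"
      by (rule integral_subinterval_mono[OF Gi \<kappa>(1)]) (use that G\<kappa>[OF that(1)] in \<open>auto elim: eventually_mono\<close>)
    moreover have "integral {s..t} (\<lambda>r. - G e r) \<le> integral {s..t} \<kappa>"
      by (rule integral_subinterval_mono[OF _ \<kappa>(1)]) (use that Gi[OF that(1)] G\<kappa>[OF that(1)] in \<open>auto elim: eventually_mono\<close>)
    ultimately show ?thesis by simp
  qed
  have yc: "\<bar>y e t - c e t\<bar> \<le> \<eta>" if e: "e \<in> E" and t: "t \<in> {0..T}" for e t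
  proof (cases "t - \<delta> \<le> 0")
    case True
    then have "integral {0..t - \<delta>} (G e) = 0" by (cases "t - \<delta> = 0") auto
    then show ?thesis using absG[OF e, of 0 t] d(2)[of 0 t] t True \<delta> by (auto simp: y_def c_def)
  next
    case False
    then have "integral {0..t - \<delta>} (G e) + integral {t - \<delta>..t} (G e) = integral {0..t} (G e)"
      using t \<delta> integral_subinterval(2)[OF Gi[OF e], of 0 t] by (intro Henstock_Kurzweil_Integration.integral_combine) auto
    then show ?thesis using absG[OF e, of "t - \<delta>" t] d(2)[of "t - \<delta>" t] t False \<delta> by (auto simp: y_def c_def)
  qed
  have Yu: "norm (Y t - \<iota> (u t)) \<le> \<epsilon>" if t: "t \<in> {0..T}" for t
  proof -
    have "Y t - \<iota> (u t) = (\<Sum>e\<in>E. (y e t - c e t) *\<^sub>R \<iota> e)"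
      unfolding Y_def iut[OF t] by (simp add: sum_subtractf algebra_simps)
    also have "norm \<dots> \<le> (\<Sum>e\<in>E. \<eta>)"
      using yc[OF _ t] by (intro sum_norm_le) (simp add: normE)
    also have "\<dots> = N * \<eta>" by (simp add: N_def)
    finally show ?thesis using \<eta>(2) by simp
  qed
  \<comment> \<open>The derivative of the squared norm of \<open>Y\<close>, written in coordinates
    by the product rule.\<close>
  define Z where "Z r = (\<Sum>e\<in>E. G e r * y e r + y e r * G e r)" for r
  have Zei: "integrable M (\<lambda>r. G e r * y e r + y e r * G e r)"
    and ysq: "t \<in> {0..T} \<Longrightarrow> y e t * y e t = (u0 \<bullet> \<iota> e) * (u0 \<bullet> \<iota> e) + integral {0..t} (\<lambda>r. G e r * y e r + y e r * G e r)"
    if e: "e \<in> E" for e t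
  proof -
    have ye: "y e r = u0 \<bullet> \<iota> e + integral {0..r} (G e)" for r by (rule y_def)
    show "integrable M (\<lambda>r. G e r * y e r + y e r * G e r)"
      by (rule product_rule_integral(1)[OF Gi[OF e] Gi[OF e] ye ye, of 0]) (use T in simp)
    show "t \<in> {0..T} \<Longrightarrow> y e t * y e t = (u0 \<bullet> \<iota> e) * (u0 \<bullet> \<iota> e) + integral {0..t} (\<lambda>r. G e r * y e r + y e r * G e r)"
      by (rule product_rule_integral(2)[OF Gi[OF e] Gi[OF e] ye ye])
  qed
  have Zi: "integrable M Z" unfolding Z_def using Zei by (intro Bochner_Integration.integrable_sum)
  have energy: "(norm (Y t))\<^sup>2 \<le> (norm u0)\<^sup>2 + integral {0..t} Z" if t: "t \<in> {0..T}" for t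
  proof -
    have "(norm (Y t))\<^sup>2 = (\<Sum>e\<in>E. y e t * y e t)"
      unfolding Y_def orthonormal_norm[OF E] by (simp add: power2_eq_square)
    also have "\<dots> = (\<Sum>e\<in>E. (u0 \<bullet> \<iota> e)\<^sup>2) + (\<Sum>e\<in>E. integral {0..t} (\<lambda>r. G e r * y e r + y e r * G e r))"
      using ysq[OF _ t] by (simp add: power2_eq_square sum.distrib)
    also have "(\<Sum>e\<in>E. integral {0..t} (\<lambda>r. G e r * y e r + y e r * G e r)) = integral {0..t} Z"
      unfolding Z_def using t integral_subinterval(2)[OF Zei, of _ 0 t]
      by (intro Henstock_Kurzweil_Integration.integral_sum[symmetric] fE) auto
    finally show ?thesis using bessel[OF E, of u0] by simp
  qed
  \<comment> \<open>The coordinates of the right-hand side are weighted with those of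
    \<open>u\<close> instead of \<open>Y\<close>, which produces the pairing of the operator with
    its own argument. The exchange costs \<eta> \<kappa> per coordinate.\<close>
  define H where "H r = (if norm (\<iota> (u r)) \<le> R then - B r (u r) (u r) else 0)" for r
  have ZH: "AE r in M. Z r \<le> 2 * H r + 2 * (\<eta> * N * \<kappa> r)"
  proof -
    have "AE r in M. \<forall>e\<in>E. \<bar>G e r\<bar> \<le> \<kappa> r" using fE G\<kappa> by (intro AE_finite_allI) auto
    moreover have "AE r in M. r \<in> {0..T}" by (intro AE_I2) simp
    ultimately show ?thesis
    proof eventually_elim
      fix r assume g: "\<forall>e\<in>E. \<bar>G e r\<bar> \<le> \<kappa> r" and r: "r \<in> {0..T}"
      have "H r = (\<Sum>e\<in>E. c e r * G e r)"
        unfolding H_def G_def cutoff_def ut[OF r]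
        by (simp add: blinfun.bilinear_simps blinfun.sum_right sum_negf)
      moreover have "(\<Sum>e\<in>E. (y e r - c e r) * G e r) \<le> (\<Sum>e\<in>E. \<eta> * \<kappa> r)"
      proof (rule sum_mono)
        fix e assume e: "e \<in> E"
        have "(y e r - c e r) * G e r \<le> \<bar>y e r - c e r\<bar> * \<bar>G e r\<bar>" by (simp add: abs_mult[symmetric])
        also have "\<dots> \<le> \<eta> * \<kappa> r" using yc[OF e r] g e \<eta> by (intro mult_mono) auto
        finally show "(y e r - c e r) * G e r \<le> \<eta> * \<kappa> r" .
      qed
      moreover have "Z r = 2 * (\<Sum>e\<in>E. c e r * G e r) + 2 * (\<Sum>e\<in>E. (y e r - c e r) * G e r)"
        unfolding Z_def sum_distrib_left sum.distrib[symmetric] by (intro sum.cong) (auto simp: algebra_simps)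
      ultimately show "Z r \<le> 2 * H r + 2 * (\<eta> * N * \<kappa> r)" by (simp add: N_def mult_ac)
    qed
  qed
  have ki: "integrable M (\<lambda>r. \<bar>k r\<bar>)" using k_int by auto
  have Hk: "AE r in M. H r \<le> \<bar>k r\<bar>"
    using B_coercive
  proof eventually_elim
    fix r assume "\<forall>x. c1 * norm x powr p - k r \<le> B r x x"
    then have "c1 * norm (u r) powr p - k r \<le> B r (u r) (u r)" by blast
    moreover have "0 \<le> c1 * norm (u r) powr p" using c1 by simp
    ultimately show "H r \<le> \<bar>k r\<bar>" by (auto simp: H_def)
  qed
  \<comment> \<open>No continuation argument is needed: \<open>H\<close> is bounded by the absolute
    value of \<open>k\<close> whether or not the cut-off is active, so the energy estimate holds at
    once on the whole interval and shows that \<open>u\<close> never leaves the ball.\<close>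
  have R: "norm (\<iota> (u t)) \<le> R" if t: "t \<in> {0..T}" for t
  proof -
    let ?b = "\<lambda>r. 2 * \<bar>k r\<bar> + 2 * (\<eta> * N * \<kappa> r)"
    have bi: "integrable M ?b" using ki \<kappa>(1) by auto
    have b0: "0 \<le> ?b r" for r using \<eta>(1) NI \<kappa>(2)[of r] by simp
    have "integral {0..t} Z \<le> integral {0..t} ?b"
    proof (rule integral_subinterval_mono[OF Zi bi])
      show "AE r in M. Z r \<le> ?b r" using ZH Hk by eventually_elim simp
    qed (use t in auto)
    also have "\<dots> \<le> (\<integral>r. ?b r \<partial>M)" using integral_subinterval_le[OF bi, of 0 t] t b0 by simp
    also have "\<dots> = 2 * (\<integral>r. \<bar>k r\<bar> \<partial>M) + 2 * (\<eta> * N * I)" using ki \<kappa>(1) by (simp add: I_def)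
    finally have "(norm (Y t))\<^sup>2 \<le> (norm u0)\<^sup>2 + 2 * (\<integral>r. \<bar>k r\<bar> \<partial>M) + 2"
      using energy[OF t] \<eta>(3) eps by simp
    then have "norm (Y t) \<le> R - 1" by (simp add: R_def energy_radius_def real_le_rsqrt)
    then show ?thesis
      using Yu[OF t] eps norm_triangle_ineq3[of "Y t" "\<iota> (u t)"] by linarith
  qed
  have uLp: "u \<in> Lp T p" by (rule continuous_combination_Lp[OF fE u(1)])
  have BLq: "(\<lambda>r. B r (u r)) \<in> Lp T q"
  proof (rule B_along_Lp[of R])
    fix K assume *: "\<And>v. v \<in> Lp T p \<Longrightarrow> AE t in M. norm (\<iota> (v t)) \<le> R \<Longrightarrow>
      (\<lambda>t. B t (v t)) \<in> Lp T q \<and> (\<integral>t. norm (B t (v t)) powr q \<partial>M) \<le> K * (1 + (\<integral>t. norm (v t) powr p \<partial>M))"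
    have "AE t in M. norm (\<iota> (u t)) \<le> R" by (intro AE_I2) (simp add: R)
    from *[OF uLp this] show ?thesis by blast
  qed
  have Bwi: "integrable M (\<lambda>r. B r (u r) w)" for w by (rule pairing_integrable[OF p BLq Lp_const])
  have Bui: "integrable M (\<lambda>r. B r (u r) (u r))" by (rule pairing_integrable[OF p BLq uLp])
  show ?thesis
  proof (rule that[of u Y])
    show "u \<in> Lp T p" by (rule uLp)
    show "norm (\<iota> (u t)) \<le> energy_radius u0" if "t \<in> {0..T}" for t using R[OF that] by (simp add: R_def)
    show "norm (Y t - \<iota> (u t)) \<le> \<epsilon>" if "t \<in> {0..T}" for t by (rule Yu[OF that])
    show "Y t \<bullet> \<iota> w = u0 \<bullet> \<iota> w - integral {0..t} (\<lambda>r. B r (u r) w)" if t: "t \<in> {0..T}" and w: "w \<in> span E" for t w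
      using w
    proof (induction rule: span_induct_alt)
      case base
      then show ?case by (simp add: blinfun.bilinear_simps)
    next
      case (step a e w)
      have io: "(\<lambda>r. B r (u r) w) integrable_on {0..t}" for w
        using integral_subinterval(2)[OF Bwi, of 0 t] t by simp
      have "integral {0..t} (G e) = integral {0..t} (\<lambda>r. - B r (u r) e)"
        using t R by (intro Henstock_Kurzweil_Integration.integral_cong) (auto simp: G_def cutoff_def)
      then have "Y t \<bullet> \<iota> e = u0 \<bullet> \<iota> e - integral {0..t} (\<lambda>r. B r (u r) e)"
        unfolding Y_def orthonormal_coeff[OF E step(1)] by (simp add: y_def)
      moreover have "integral {0..t} (\<lambda>r. B r (u r) (a *\<^sub>R e + w))
          = a * integral {0..t} (\<lambda>r. B r (u r) e) + integral {0..t} (\<lambda>r. B r (u r) w)"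
        using io by (simp add: blinfun.bilinear_simps Henstock_Kurzweil_Integration.integral_add integrable_on_mult_right)
      moreover have "x \<bullet> \<iota> (a *\<^sub>R e + w) = a * (x \<bullet> \<iota> e) + x \<bullet> \<iota> w" for x
        by (simp add: blinfun.bilinear_simps inner_simps)
      ultimately show ?case using step(2) by (simp add: right_diff_distrib)
    qed
    show "(norm (Y t))\<^sup>2 / 2 \<le> (norm u0)\<^sup>2 / 2 - integral {0..t} (\<lambda>r. B r (u r) (u r)) + \<epsilon>" if t: "t \<in> {0..T}" for t
    proof -
      have bi: "integrable M (\<lambda>r. - 2 * B r (u r) (u r) + 2 * (\<eta> * N) * \<kappa> r)" using Bui \<kappa>(1) by auto
      have "integral {0..t} Z \<le> integral {0..t} (\<lambda>r. - 2 * B r (u r) (u r) + 2 * (\<eta> * N) * \<kappa> r)"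
      proof (rule integral_subinterval_mono[OF Zi bi])
        have "AE r in M. r \<in> {0..T}" by (intro AE_I2) simp
        with ZH show "AE r in M. Z r \<le> - 2 * B r (u r) (u r) + 2 * (\<eta> * N) * \<kappa> r"
          by eventually_elim (use R in \<open>simp add: H_def\<close>)
      qed (use t in auto)
      also have "\<dots> = - 2 * integral {0..t} (\<lambda>r. B r (u r) (u r)) + 2 * (\<eta> * N) * integral {0..t} \<kappa>"
        using integral_subinterval(2)[OF Bui, of 0 t] integral_subinterval(2)[OF \<kappa>(1), of 0 t] t
        by (subst Henstock_Kurzweil_Integration.integral_add) (auto intro: integrable_on_mult_right integrable_neg)
      also have "integral {0..t} \<kappa> \<le> I" using integral_subinterval_le[OF \<kappa>(1), of 0 t] t \<kappa>(2) by (simp add: I_def)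
      finally have "integral {0..t} Z \<le> - 2 * integral {0..t} (\<lambda>r. B r (u r) (u r)) + 2 * (\<eta> * N) * I"
        using \<eta>(1) NI by (simp add: mult_left_mono)
      then show ?thesis using energy[OF t] \<eta>(3) by simp
    qed
  qed
qed

lemma coercive_bound:
  assumes u: "u \<in> Lp T p" and B: "integrable M (\<lambda>r. B r (u r) (u r))" and le: "(\<integral>r. B r (u r) (u r) \<partial>M) \<le> C"
  shows "(\<integral>r. norm (u r) powr p \<partial>M) \<le> (C + (\<integral>r. \<bar>k r\<bar> \<partial>M)) / c1"
proof -
  have "(\<integral>r. c1 * norm (u r) powr p - \<bar>k r\<bar> \<partial>M) \<le> (\<integral>r. B r (u r) (u r) \<partial>M)"
  proof (rule integral_mono_AE)
    show "AE r in M. c1 * norm (u r) powr p - \<bar>k r\<bar> \<le> B r (u r) (u r)"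
      using B_coercive
    proof eventually_elim
      fix r assume "\<forall>x. c1 * norm x powr p - k r \<le> B r x x"
      then have "c1 * norm (u r) powr p - k r \<le> B r (u r) (u r)" by blast
      then show "c1 * norm (u r) powr p - \<bar>k r\<bar> \<le> B r (u r) (u r)" by linarith
    qed
  qed (use B LpD(2)[OF u] k_int in auto)
  then have "c1 * (\<integral>r. norm (u r) powr p \<partial>M) \<le> C + (\<integral>r. \<bar>k r\<bar> \<partial>M)"
    using le LpD(2)[OF u] k_int by simp
  then show ?thesis using c1 by (simp add: field_simps)
qed

end

section \<open>Passage to the limit\<close>

lemma frequently_subsequence:
  assumes "\<exists>\<^sub>F n in sequentially. P n"
  obtains s :: "nat \<Rightarrow> nat" where "strict_mono s" "\<And>n. P (s n)"
proof -
  have "infinite {n. P n}" using assms by (simp add: cofinite_eq_sequentially[symmetric] frequently_cofinite)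
  then show ?thesis using infinite_enumerate[of "{n. P n}"] that by blast
qed

text \<open>Gram-Schmidt for the inner product of \<open>H\<close>, carried out on vectors of
  \<open>V\<close>; injectivity of \<iota> ensures that a nonzero remainder can be
  normalized.\<close>

lemma orthonormal_image_exists:
  fixes \<iota> :: "'v::real_normed_vector \<Rightarrow>\<^sub>L 'h::real_inner"
  assumes inj: "inj \<iota>" and F: "finite F"
  shows "\<exists>E. orthonormal_image \<iota> E \<and> span E = span F"
  using F
proof (induction F)
  case empty
  have "orthonormal_image \<iota> {}" by (simp add: orthonormal_image_def)
  then show ?case by blast
next
  case (insert a F)
  then obtain E where E: "orthonormal_image \<iota> E" "span E = span F" by blast
  have fE: "finite E" using E by (simp add: orthonormal_image_def)
  have sp: "span (insert a F) = span (insert a E)" using E(2) by (simp add: span_insert)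
  define b where "b = a - (\<Sum>e\<in>E. (\<iota> a \<bullet> \<iota> e) *\<^sub>R e)"
  have comb: "(\<Sum>e\<in>E. (\<iota> a \<bullet> \<iota> e) *\<^sub>R e) \<in> span E" by (intro span_sum span_scale span_base)
  have ort: "\<iota> b \<bullet> \<iota> e = 0" if "e \<in> E" for e
    using orthonormal_coeff[OF E(1) that, of "\<lambda>e. \<iota> a \<bullet> \<iota> e"]
    by (simp add: b_def blinfun.bilinear_simps blinfun.sum_right inner_diff_left)
  show ?case
  proof (cases "b = 0")
    case True
    then have "a \<in> span E" using comb by (simp add: b_def)
    then have "span (insert a E) = span E" by (rule span_redundant)
    then show ?thesis using E sp by auto
  next
    case False
    then have "\<iota> b \<noteq> 0" using inj by (metis blinfun.zero_right injD)
    then have nb: "norm (\<iota> b) > 0" by simp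
    define d where "d = b /\<^sub>R norm (\<iota> b)"
    have dd: "\<iota> d \<bullet> \<iota> d = 1" using nb by (simp add: d_def blinfun.bilinear_simps power2_norm_eq_inner[symmetric] power2_eq_square)
    have de: "\<iota> d \<bullet> \<iota> e = 0" if "e \<in> E" for e using ort[OF that] by (simp add: d_def blinfun.bilinear_simps)
    have "d \<notin> E" using dd de by fastforce
    then have "orthonormal_image \<iota> (insert d E)"
      using E(1) dd de by (auto simp: orthonormal_image_def inner_commute)
    moreover have "span (insert d E) = span (insert a E)"
    proof -
      have a: "a = norm (\<iota> b) *\<^sub>R d + (\<Sum>e\<in>E. (\<iota> a \<bullet> \<iota> e) *\<^sub>R e)" using nb by (simp add: d_def b_def)
      have "a \<in> span (insert d E)"
        by (subst a) (intro span_add span_scale span_sum span_base; simp)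
      moreover have "b \<in> span (insert a E)"
        unfolding b_def by (intro span_diff span_scale span_sum span_base; simp)
      then have "d \<in> span (insert a E)" unfolding d_def by (rule span_scale)
      moreover have "E \<subseteq> span (insert d E)" "E \<subseteq> span (insert a E)" using span_superset by blast+
      ultimately show ?thesis unfolding span_eq by simp
    qed
    ultimately show ?thesis using sp by blast
  qed
qed

lemma dense_embedding_image:
  assumes "closure (range (blinfun_apply \<iota>)) = UNIV" "closure S = UNIV"
  shows "closure (blinfun_apply \<iota> ` S) = UNIV"
proof -
  have "blinfun_apply \<iota> ` closure S \<subseteq> closure (blinfun_apply \<iota> ` S)"
    by (rule closure_bounded_linear_image_subset[OF blinfun.bounded_linear_right])
  then have "closure (range (blinfun_apply \<iota>)) \<subseteq> closure (blinfun_apply \<iota> ` S)"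
    unfolding assms(2) by (rule closure_minimal) simp
  then show ?thesis using assms(1) by blast
qed

lemma inner_eq_on_dense:
  fixes x y :: "'h::real_inner"
  assumes D: "closure D = UNIV" and eq: "\<And>d. d \<in> D \<Longrightarrow> x \<bullet> d = y \<bullet> d"
  shows "x = y"
proof -
  have "closed {h. x \<bullet> h = y \<bullet> h}" by (intro closed_Collect_eq continuous_intros)
  then have "closure D \<subseteq> {h. x \<bullet> h = y \<bullet> h}" using eq by (intro closure_minimal) auto
  then have "x \<bullet> h = y \<bullet> h" for h using D by auto
  then show ?thesis by (metis vector_eq_rdot)
qed

text \<open>An Arzela-Ascoli argument: a diagonal subsequence over rational times and the countable
  set \<open>D0\<close>, then extension to all times. Equicontinuity is required only against
  vectors of \<open>D m\<close> and from index \<open>m\<close> on, as the Galerkin equation of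
  index \<open>n\<close> tests only with \<open>V\<^sub>n\<close>.\<close>

lemma weak_pointwise_subsequence:
  fixes y :: "nat \<Rightarrow> real \<Rightarrow> 'h::{real_inner, complete_space}" and D0 :: "'h set"
  assumes T: "0 < T" and bnd: "\<And>n t. t \<in> {0..T} \<Longrightarrow> norm (y n t) \<le> R"
    and D0: "countable D0" "closure D0 = UNIV" and D: "closure (\<Union>m. D m) = UNIV"
    and equi: "\<And>m h e. h \<in> D m \<Longrightarrow> 0 < e \<Longrightarrow> \<exists>d>0. \<forall>n\<ge>m. \<forall>s\<in>{0..T}. \<forall>t\<in>{0..T}. \<bar>s - t\<bar> < d \<longrightarrow> \<bar>y n s \<bullet> h - y n t \<bullet> h\<bar> \<le> e"
  obtains r u where "strict_mono (r :: nat \<Rightarrow> nat)" "\<And>t h. t \<in> {0..T} \<Longrightarrow> (\<lambda>n. y (r n) t \<bullet> h) \<longlonglongrightarrow> u t \<bullet> h"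
proof -
  have "0 \<in> {0..T}" using T by simp
  then have R: "0 \<le> R" using order_trans[OF norm_ge_zero bnd] by blast
  define S where "S = ({0..T} \<inter> \<rat>) \<times> D0"
  have cS: "countable S" unfolding S_def using D0(1) countable_rat by blast
  \<comment> \<open>Dividing by \<open>norm h + 1\<close> gives one bound for all \<open>h\<close>,
    as the diagonal selection needs a uniformly bounded sequence of functions.\<close>
  define f where "f n = (\<lambda>(t, h). (y n t \<bullet> h) / (norm h + 1))" for n
  have fR: "norm (f n x) \<le> R" if "x \<in> S" for n x
  proof -
    obtain t h where x: "x = (t, h)" "t \<in> {0..T}" using \<open>x \<in> S\<close> by (auto simp: S_def)
    have "\<bar>y n t \<bullet> h\<bar> \<le> norm (y n t) * norm h" by (rule Cauchy_Schwarz_ineq2)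
    also have "\<dots> \<le> R * (norm h + 1)" using bnd[OF x(2)] R by (intro mult_mono) auto
    finally show ?thesis using x by (simp add: f_def abs_divide pos_divide_le_eq add_nonneg_pos)
  qed
  obtain r :: "nat \<Rightarrow> nat" where r: "strict_mono r" "\<And>x. x \<in> S \<Longrightarrow> \<exists>l. (\<lambda>n. f (r n) x) \<longlonglongrightarrow> l"
    by (rule function_convergent_subsequence[where f = f and M = R, OF cS fR]) (auto intro: that)
  have rat: "convergent (\<lambda>n. y (r n) t \<bullet> h)" if "t \<in> {0..T}" "t \<in> \<rat>" "h \<in> D0" for t h
  proof -
    have "(t, h) \<in> S" using that by (simp add: S_def)
    then obtain l where "(\<lambda>n. f (r n) (t, h)) \<longlonglongrightarrow> l" using r(2) by blast
    then have "(\<lambda>n. (norm h + 1) * f (r n) (t, h)) \<longlonglongrightarrow> (norm h + 1) * l" by (intro tendsto_intros)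
    moreover have "(norm h + 1) * f (r n) (t, h) = y (r n) t \<bullet> h" for n
      using norm_ge_zero[of h] by (simp add: f_def add_nonneg_eq_0_iff)
    ultimately show ?thesis by (auto intro: convergentI)
  qed
  have conv: "convergent (\<lambda>n. y (r n) t \<bullet> h)" if t: "t \<in> {0..T}" and h: "h \<in> (\<Union>m. D m)" for t h
  proof (rule convergent_by_approximation)
    fix e :: real assume e: "0 < e"
    obtain m where m: "h \<in> D m" using h by blast
    obtain d where d: "0 < d" "\<And>n s t. m \<le> n \<Longrightarrow> s \<in> {0..T} \<Longrightarrow> t \<in> {0..T} \<Longrightarrow> \<bar>s - t\<bar> < d \<Longrightarrow> \<bar>y n s \<bullet> h - y n t \<bullet> h\<bar> \<le> e / 2"
      using equi[OF m, of "e / 2"] e by (metis half_gt_zero)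
    \<comment> \<open>The time is moved to a rational one first, while the test vector still lies in
      \<open>D m\<close> and equicontinuity applies. Only then is the vector replaced by one of
      \<open>D0\<close>, which uses nothing but the uniform bound on \<open>y\<close>.\<close>
    have "max 0 (t - d) < min T (t + d)" using t d(1) T by auto
    then obtain s where s: "s \<in> \<rat>" "max 0 (t - d) < s" "s < min T (t + d)" using Rats_dense_in_real by blast
    obtain h0 where h0: "h0 \<in> D0" "dist h h0 < e / (2 * (R + 1))"
      using dense_approx[OF D0(2), of "e / (2 * (R + 1))" h] e R by auto
    have sT: "s \<in> {0..T}" using s by auto
    have "\<bar>y (r n) t \<bullet> h - y (r n) s \<bullet> h0\<bar> \<le> e" if n: "m \<le> n" for n
    proof -
      have "m \<le> r n" using seq_suble[OF r(1), of n] n by simp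
      then have "\<bar>y (r n) t \<bullet> h - y (r n) s \<bullet> h\<bar> \<le> e / 2" using d(2)[of "r n" t s] t sT s by auto
      moreover have "\<bar>y (r n) s \<bullet> h - y (r n) s \<bullet> h0\<bar> \<le> e / 2"
      proof -
        have "\<bar>y (r n) s \<bullet> h - y (r n) s \<bullet> h0\<bar> \<le> norm (y (r n) s) * norm (h - h0)"
          using Cauchy_Schwarz_ineq2[of "y (r n) s" "h - h0"] by (simp add: inner_simps)
        also have "\<dots> \<le> R * (e / (2 * (R + 1)))"
          using bnd[OF sT] h0(2) R by (intro mult_mono) (auto simp: dist_norm)
        also have "\<dots> \<le> e / 2" using R e by (simp add: field_simps)
        finally show ?thesis .
      qed
      ultimately show ?thesis by linarith
    qed
    then have "\<forall>\<^sub>F n in sequentially. \<bar>y (r n) t \<bullet> h - y (r n) s \<bullet> h0\<bar> \<le> e" by (auto simp: eventually_sequentially)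
    with rat[OF sT s(1) h0(1)] show "\<exists>b. convergent b \<and> (\<forall>\<^sub>F n in sequentially. \<bar>y (r n) t \<bullet> h - b n\<bar> \<le> e)" by blast
  qed
  have "\<exists>x. \<forall>h. (\<lambda>n. y (r n) t \<bullet> h) \<longlonglongrightarrow> x \<bullet> h" if t: "t \<in> {0..T}" for t
    using weak_limit_in_hilbert_space[of "\<lambda>n. y (r n) t" R, OF bnd[OF t] D conv[OF t]] by metis
  then obtain u where "\<And>t h. t \<in> {0..T} \<Longrightarrow> (\<lambda>n. y (r n) t \<bullet> h) \<longlonglongrightarrow> u t \<bullet> h" by metis
  with r(1) show ?thesis by (rule that)
qed

text \<open>The sequence need not be bounded in \<open>V\<close>. If the pairings were at most - e
  infinitely often, the lower bound would make that subsequence bounded, hence weakly convergent to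
  \<open>l\<close>, and pseudo-monotonicity with y = l would give 0 \<le> - e.\<close>

lemma pseudo_monotone_nonneg_limit:
  fixes \<iota> :: "'v::real_normed_vector \<Rightarrow>\<^sub>L 'h::real_inner"
  assumes refl: "reflexive_space TYPE('v)" and inj: "inj \<iota>" and A: "pseudo_monotone A"
    and lim: "\<And>h. (\<lambda>n. h \<bullet> \<iota> (x n)) \<longlonglongrightarrow> h \<bullet> \<iota> l"
    and lb: "\<And>n. c * norm (x n) powr p - K \<le> A (x n) (x n - l)" and c: "0 < c" "0 < p" and e: "0 < e"
  shows "\<forall>\<^sub>F n in sequentially. - e < A (x n) (x n - l)"
proof (rule ccontr)
  assume "\<not> ?thesis"
  then have "\<exists>\<^sub>F n in sequentially. A (x n) (x n - l) \<le> - e" by (simp add: not_eventually not_less)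
  then obtain s :: "nat \<Rightarrow> nat" where s: "strict_mono s" "\<And>n. A (x (s n)) (x (s n) - l) \<le> - e"
    by (rule frequently_subsequence) (rule that)
  have "norm (x (s n)) \<le> (\<bar>K\<bar> / c) powr (1 / p)" for n
  proof -
    have "c * norm (x (s n)) powr p \<le> \<bar>K\<bar>" using lb[of "s n"] s(2)[of n] e by linarith
    then have "norm (x (s n)) powr p \<le> \<bar>K\<bar> / c" using c by (simp add: field_simps)
    then have "(norm (x (s n)) powr p) powr (1 / p) \<le> (\<bar>K\<bar> / c) powr (1 / p)" using c by (intro powr_mono2) auto
    then show ?thesis using c by (simp add: powr_powr)
  qed
  moreover have "(\<lambda>n. h \<bullet> \<iota> (x (s n))) \<longlonglongrightarrow> h \<bullet> \<iota> l" for h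
    using LIMSEQ_subseq_LIMSEQ[OF lim[of h] s(1)] by (simp add: o_def)
  ultimately obtain l' where l': "\<iota> l' = \<iota> l" "weakly_converges (\<lambda>n. x (s n)) l'"
    by (rule weak_convergence_lift[OF refl inj]) (rule that)
  have "l' = l" using inj l'(1) by (rule injD)
  with l' have w: "weakly_converges (\<lambda>n. x (s n)) l" by simp
  have "limsup (\<lambda>n. ereal (A (x (s n)) (x (s n) - l))) \<le> ereal (- e)"
    using s(2) by (intro Limsup_bounded) (auto intro: always_eventually)
  also have "\<dots> \<le> 0" using e by simp
  finally have "ereal (A l (l - l)) \<le> liminf (\<lambda>n. ereal (A (x (s n)) (x (s n) - l)))"
    using A w unfolding pseudo_monotone_def by blast
  also have "\<dots> \<le> limsup (\<lambda>n. ereal (A (x (s n)) (x (s n) - l)))" by (rule Liminf_le_Limsup) simp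
  also have "\<dots> \<le> ereal (- e)" using s(2) by (intro Limsup_bounded) (auto intro: always_eventually)
  finally show False using e by (simp add: blinfun.bilinear_simps)
qed

text \<open>Convergence of the pairings to 0 bounds them, and the lower bound then bounds the whole
  sequence in \<open>V\<close>. Hence all of it converges weakly and pseudo-monotonicity applies
  without a further subsequence.\<close>

lemma pseudo_monotone_limit_ge:
  fixes \<iota> :: "'v::real_normed_vector \<Rightarrow>\<^sub>L 'h::real_inner"
  assumes refl: "reflexive_space TYPE('v)" and inj: "inj \<iota>" and A: "pseudo_monotone A"
    and lim: "\<And>h. (\<lambda>n. h \<bullet> \<iota> (x n)) \<longlonglongrightarrow> h \<bullet> \<iota> l"
    and lb: "\<And>n. c * norm (x n) powr p - K \<le> A (x n) (x n - l)" and c: "0 < c" "0 < p" and e: "0 < e"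
    and zero: "(\<lambda>n. A (x n) (x n - l)) \<longlonglongrightarrow> 0"
  shows "\<forall>\<^sub>F n in sequentially. A l (l - y) - e < A (x n) (x n - y)"
proof -
  obtain C where C: "\<And>n. \<bar>A (x n) (x n - l)\<bar> \<le> C"
    using convergent_imp_Bseq[OF convergentI[OF zero]] by (auto simp: Bseq_def)
  have "norm (x n) \<le> ((C + \<bar>K\<bar>) / c) powr (1 / p)" for n
  proof -
    have "c * norm (x n) powr p \<le> C + \<bar>K\<bar>" using lb[of n] C[of n] by linarith
    then have "norm (x n) powr p \<le> (C + \<bar>K\<bar>) / c" using c by (simp add: field_simps)
    then have "(norm (x n) powr p) powr (1 / p) \<le> ((C + \<bar>K\<bar>) / c) powr (1 / p)" using c by (intro powr_mono2) auto
    then show ?thesis using c by (simp add: powr_powr)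
  qed
  then obtain l' where l': "\<iota> l' = \<iota> l" "weakly_converges x l'"
    by (rule weak_convergence_lift[OF refl inj _ lim]) (rule that)
  have "l' = l" using inj l'(1) by (rule injD)
  with l'(2) have w: "weakly_converges x l" by simp
  have "limsup (\<lambda>n. ereal (A (x n) (x n - l))) = ereal 0"
    using zero by (intro lim_imp_Limsup) auto
  then have "limsup (\<lambda>n. ereal (A (x n) (x n - l))) \<le> 0" by simp
  with A w have ge: "ereal (A l (l - y)) \<le> liminf (\<lambda>n. ereal (A (x n) (x n - y)))"
    unfolding pseudo_monotone_def by blast
  have "ereal (A l (l - y) - e) < ereal (A l (l - y))" using e by simp
  from less_le_trans[OF this ge]
  have "ereal (A l (l - y) - e) < liminf (\<lambda>n. ereal (A (x n) (x n - y)))" .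
  from less_LiminfD[OF this] show ?thesis by simp
qed

lemma Lp_uminus:
  assumes v: "v \<in> Lp T p"
  shows "(\<lambda>t. - v t) \<in> Lp T p"
  using bochner_measurable_diff[OF bochner_measurable_const[of _ 0] LpD(1)[OF v]] LpD(2)[OF v] by (simp add: Lp_def)

lemma Lp_diff:
  assumes p: "0 < p" and v: "v \<in> Lp T p" and w: "w \<in> Lp T p"
  shows "(\<lambda>t. v t - w t) \<in> Lp T p"
proof -
  interpret complete_measure "lebesgue_on {0..T}" by (rule complete_measure_lebesgue_on) simp
  have m: "bochner_measurable (lebesgue_on {0..T}) (\<lambda>t. v t - w t)"
    by (rule bochner_measurable_diff[OF LpD(1)[OF v] LpD(1)[OF w]])
  show ?thesis
    using m integrable_powr_diff(1)[OF p LpD(2)[OF v] LpD(2)[OF w] bochner_measurable_norm[OF m]] by (simp add: Lp_def)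
qed

lemma Lp_indicator:
  assumes p: "0 < p" and ab: "0 \<le> a" "b \<le> T"
  shows "(\<lambda>t. indicator {a..b} t *\<^sub>R w) \<in> Lp T p"
proof -
  interpret complete_measure "lebesgue_on {0..T}" by (rule complete_measure_lebesgue_on) simp
  have "{a..b} \<in> sets (lebesgue_on {0..T})" using ab by (simp add: sets_restrict_space_iff)
  then have "bochner_measurable (lebesgue_on {0..T}) (\<lambda>t. indicator {a..b} t *\<^sub>R w)"
    by (intro bochner_measurable_scaleR bochner_measurable_const borel_measurable_indicator)
  then show ?thesis
    by (rule bounded_in_Lp[OF p, where K = "norm w"]) (auto intro!: AE_I2 simp: indicator_def)
qed

context evolution
begin

text \<open>Half of the coercivity absorbs the pairing with \<open>v\<close>. The remainder \<kappa>
  is chosen before \<open>x\<close>, so it is one integrable lower bound for the whole Galerkin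
  sequence, as required by the convergence theorems.\<close>

lemma B_lower_bound:
  assumes v: "v \<in> Lp T p"
  obtains \<kappa> where "integrable M \<kappa>"
    "AE t in M. \<forall>x. norm (\<iota> x) \<le> R \<longrightarrow> c1 / 2 * norm x powr p - \<kappa> t \<le> B t x (x - v t)"
proof -
  obtain a b where ab: "0 \<le> a" "b \<in> Lp T q"
    "AE t in M. \<forall>x. norm (\<iota> x) \<le> R \<longrightarrow> norm (B t x) \<le> a * norm x powr (p - 1) + b t"
    using B_growth by blast
  \<comment> \<open>Chosen so that a l \<le> c1/2; the summand 1 avoids division by zero when a =
    0.\<close>
  define l where "l = c1 / (2 * (a + 1))"
  have l: "0 < l" "a * l \<le> c1 / 2" using c1 ab(1) by (auto simp: l_def field_simps)
  obtain C where C: "0 < C" "\<And>a b. 0 \<le> a \<Longrightarrow> 0 \<le> b \<Longrightarrow> a * b \<le> l * a powr q + C * b powr p"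
    by (rule young_epsilon[OF p l(1)]) (rule that)
  obtain D where D: "0 < D" "\<And>a b. 0 \<le> a \<Longrightarrow> 0 \<le> b \<Longrightarrow> a * b \<le> 1 * a powr q + D * b powr p"
    by (rule young_epsilon[OF p zero_less_one]) (rule that)
  define \<kappa> where "\<kappa> t = \<bar>k t\<bar> + (a * C + D) * norm (v t) powr p + norm (b t) powr q" for t
  show ?thesis
  proof (rule that)
    show "integrable M \<kappa>" unfolding \<kappa>_def using k_int LpD(2)[OF v] LpD(2)[OF ab(2)] by simp
    show "AE t in M. \<forall>x. norm (\<iota> x) \<le> R \<longrightarrow> c1 / 2 * norm x powr p - \<kappa> t \<le> B t x (x - v t)"
      using ab(3) B_coercive
    proof (eventually_elim, intro allI impI)
      fix t x
      assume g: "\<forall>x. norm (\<iota> x) \<le> R \<longrightarrow> norm (B t x) \<le> a * norm x powr (p - 1) + b t"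
        and co: "\<forall>x. c1 * norm x powr p - k t \<le> B t x x" and x: "norm (\<iota> x) \<le> R"
      define X where "X = norm x powr (p - 1)"
      have X: "0 \<le> X" "X powr q = norm x powr p" by (auto simp: X_def powr_powr q(2))
      have "norm (B t x) \<le> a * X + b t" using g x unfolding X_def by blast
      also have "\<dots> \<le> a * X + norm (b t)" by simp
      finally have n: "norm (B t x) \<le> a * X + norm (b t)" .
      have "B t x (v t) \<le> norm (B t x) * norm (v t)" using norm_blinfun[of "B t x" "v t"] by simp
      also have "\<dots> \<le> (a * X + norm (b t)) * norm (v t)" by (rule mult_right_mono[OF n]) simp
      also have "\<dots> = a * (X * norm (v t)) + norm (b t) * norm (v t)" by (simp add: algebra_simps)
      also have "\<dots> \<le> a * (l * X powr q + C * norm (v t) powr p) + (1 * norm (b t) powr q + D * norm (v t) powr p)"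
        using X ab(1) by (intro add_mono mult_left_mono C(2) D(2)) auto
      also have "\<dots> = (a * l) * norm x powr p + (a * C + D) * norm (v t) powr p + norm (b t) powr q"
        by (simp add: X algebra_simps)
      also have "(a * l) * norm x powr p \<le> c1 / 2 * norm x powr p" using l(2) by (intro mult_right_mono) auto
      finally have "B t x (v t) \<le> c1 / 2 * norm x powr p + (a * C + D) * norm (v t) powr p + norm (b t) powr q" by simp
      moreover have "c1 * norm x powr p - k t \<le> B t x x" using co by blast
      moreover have "B t x (x - v t) = B t x x - B t x (v t)" by (simp add: blinfun.bilinear_simps)
      moreover have "c1 * norm x powr p = c1 / 2 * norm x powr p + c1 / 2 * norm x powr p" by simp
      ultimately show "c1 / 2 * norm x powr p - \<kappa> t \<le> B t x (x - v t)" unfolding \<kappa>_def by linarith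
    qed
  qed
qed

end

text \<open>\<open>z n\<close> is the value at \<open>T\<close> of the undelayed primitive \<open>y\<close> that satisfies the Galerkin equation
  exactly; it differs from \<open>\<iota> (U n T)\<close> by the delay error.\<close>

locale galerkin_limit = evolution T p q \<iota> B c1 k
  for T p q and \<iota> :: "'v::banach \<Rightarrow>\<^sub>L 'h::{real_inner, complete_space}" and B c1 k +
  fixes U :: "nat \<Rightarrow> real \<Rightarrow> 'v" and u :: "real \<Rightarrow> 'h" and z :: "nat \<Rightarrow> 'h" and \<eta> :: "nat \<Rightarrow> real"
    and R Kp Kq :: real
  assumes sep: "separable_space (euclidean :: 'v topology)" and refl: "reflexive_space TYPE('v)"
    and inj: "inj (blinfun_apply \<iota>)" and pm: "AE t in lebesgue_on {0..T}. pseudo_monotone (B t)"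
    and U_Lp: "\<And>n. U n \<in> Lp T p" and U_R: "\<And>n t. t \<in> {0..T} \<Longrightarrow> norm (\<iota> (U n t)) \<le> R"
    and U_Kp: "\<And>n. (\<integral>t. norm (U n t) powr p \<partial>lebesgue_on {0..T}) \<le> Kp"
    and BU_Lq: "\<And>n. (\<lambda>t. B t (U n t)) \<in> Lp T q"
    and BU_Kq: "\<And>n. (\<integral>t. norm (B t (U n t)) powr q \<partial>lebesgue_on {0..T}) \<le> Kq"
    and U_lim: "\<And>t h. t \<in> {0..T} \<Longrightarrow> (\<lambda>n. h \<bullet> \<iota> (U n t)) \<longlonglongrightarrow> h \<bullet> u t"
    and u_cont: "\<And>h. continuous_on {0..T} (\<lambda>t. u t \<bullet> h)" and u_R: "\<And>t. t \<in> {0..T} \<Longrightarrow> norm (u t) \<le> R"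
    and BU_lim: "\<And>w s t. 0 \<le> s \<Longrightarrow> s \<le> t \<Longrightarrow> t \<le> T \<Longrightarrow>
      (\<lambda>n. integral {s..t} (\<lambda>r. B r (U n r) w)) \<longlonglongrightarrow> - ((u t - u s) \<bullet> \<iota> w)"
    and z_lim: "\<And>h. (\<lambda>n. z n \<bullet> h) \<longlonglongrightarrow> u T \<bullet> h" and eta: "\<eta> \<longlonglongrightarrow> 0"
    and energy: "\<And>n. (norm (z n))\<^sup>2 / 2 \<le> (norm (u 0))\<^sup>2 / 2 - integral {0..T} (\<lambda>r. B r (U n r) (U n r)) + \<eta> n"
begin

text \<open>For each e > 0 some subsequence is bounded by l + e, and lifting it puts
  \<open>u t\<close> into the range of \<iota> with that bound. The preimage is unique, so it is the
  same for all e.\<close>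

lemma limit_in_V:
  assumes t: "t \<in> {0..T}" and fin: "liminf (\<lambda>n. ennreal (norm (U n t) powr p)) = ennreal l" and l: "0 \<le> l"
  obtains x where "\<iota> x = u t" "norm x powr p \<le> l"
proof -
  have ex: "\<exists>x. \<iota> x = u t \<and> norm x powr p \<le> l + e" if e: "0 < e" for e
  proof -
    have "\<exists>\<^sub>F n in sequentially. norm (U n t) powr p \<le> l + e"
    proof (rule ccontr)
      assume "\<not> ?thesis"
      then have "\<forall>\<^sub>F n in sequentially. ennreal (l + e) \<le> ennreal (norm (U n t) powr p)"
        by (auto simp: not_frequently not_le elim!: eventually_mono intro: ennreal_leI)
      then have "ennreal (l + e) \<le> ennreal l" using Liminf_bounded fin by metis
      then show False using e l by simp
    qed
    then obtain s :: "nat \<Rightarrow> nat" where s: "strict_mono s" "\<And>n. norm (U (s n) t) powr p \<le> l + e"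
      by (rule frequently_subsequence) (rule that)
    have b: "norm (U (s n) t) \<le> (l + e) powr (1 / p)" for n
      using powr_mono2[OF _ _ s(2)[of n], of "1 / p"] p by (simp add: powr_powr)
    have lim: "(\<lambda>n. h \<bullet> \<iota> (U (s n) t)) \<longlonglongrightarrow> h \<bullet> u t" for h
      using LIMSEQ_subseq_LIMSEQ[OF U_lim[OF t, of h] s(1)] by (simp add: o_def)
    obtain x where x: "\<iota> x = u t" "weakly_converges (\<lambda>n. U (s n) t) x"
      by (rule weak_convergence_lift[OF refl inj b lim]) (rule that)
    have "norm x \<le> (l + e) powr (1 / p)" by (rule weakly_converges_norm_le[OF x(2) b])
    then have "norm x powr p \<le> ((l + e) powr (1 / p)) powr p" using p by (intro powr_mono2) auto
    then show ?thesis using x(1) p l e by (intro exI[of _ x]) (simp add: powr_powr)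
  qed
  obtain x where x: "\<iota> x = u t" using ex[OF zero_less_one] by blast
  have "norm x powr p \<le> l"
  proof (rule field_le_epsilon)
    fix e :: real assume "0 < e"
    then obtain x' where "\<iota> x' = u t" "norm x' powr p \<le> l + e" using ex by blast
    moreover from this x have "x' = x" by (intro injD[OF inj]) simp
    ultimately show "norm x powr p \<le> l + e" by simp
  qed
  with x show ?thesis by (rule that)
qed

text \<open>Fatou's lemma makes the lower limit \<open>L\<close> integrable and
  \<open>limit_in_V\<close> gives the pointwise bound. Measurability of \<open>v\<close> comes from
  weak continuity of \<open>u\<close>: pairings with functionals from \<open>H\<close> are
  measurable, density extends this to all functionals, and Pettis' criterion concludes.\<close>

lemma limit_Lp:
  obtains v where "v \<in> Lp T p" "AE t in M. \<iota> (v t) = u t"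
proof -
  define L where "L t = liminf (\<lambda>n. ennreal (norm (U n t) powr p))" for t
  have [measurable]: "(\<lambda>t. norm (U n t)) \<in> borel_measurable M" for n
    by (rule bochner_measurable_norm[OF LpD(1)[OF U_Lp]])
  have Lm: "L \<in> borel_measurable M" unfolding L_def[abs_def] by measurable
  have "(\<integral>\<^sup>+t. L t \<partial>M) \<le> liminf (\<lambda>n. \<integral>\<^sup>+t. ennreal (norm (U n t) powr p) \<partial>M)"
    unfolding L_def by (rule nn_integral_liminf) measurable
  also have "\<dots> \<le> limsup (\<lambda>n. \<integral>\<^sup>+t. ennreal (norm (U n t) powr p) \<partial>M)" by (rule Liminf_le_Limsup) simp
  also have "\<dots> \<le> ennreal Kp"
  proof (rule Limsup_bounded, rule always_eventually, rule allI)
    fix n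
    have "(\<integral>\<^sup>+t. ennreal (norm (U n t) powr p) \<partial>M) = ennreal (\<integral>t. norm (U n t) powr p \<partial>M)"
      by (rule nn_integral_eq_integral[OF LpD(2)[OF U_Lp]]) simp
    then show "(\<integral>\<^sup>+t. ennreal (norm (U n t) powr p) \<partial>M) \<le> ennreal Kp" using U_Kp[of n] by (simp add: ennreal_leI)
  qed
  finally have LK: "(\<integral>\<^sup>+t. L t \<partial>M) \<le> ennreal Kp" .
  then have "AE t in M. L t \<noteq> \<infinity>"
    by (intro nn_integral_noteq_infinite[OF Lm]) (auto simp: top_unique)
  moreover have "AE t in M. t \<in> {0..T}" by (intro AE_I2) simp
  ultimately have ex: "AE t in M. \<exists>x. \<iota> x = u t \<and> ennreal (norm x powr p) \<le> L t"
  proof eventually_elim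
    fix t assume t: "L t \<noteq> \<infinity>" "t \<in> {0..T}"
    then obtain l where l: "0 \<le> l" "L t = ennreal l" by (cases "L t") auto
    obtain x where "\<iota> x = u t" "norm x powr p \<le> l"
      by (rule limit_in_V[OF t(2) l(2)[unfolded L_def] l(1)]) (rule that)
    then show "\<exists>x. \<iota> x = u t \<and> ennreal (norm x powr p) \<le> L t" using l by (auto intro: ennreal_leI)
  qed
  \<comment> \<open>The choice is unique by injectivity; the value 0 is taken only where
    \<open>u t\<close> lies outside the range of \<iota>, that is, on a null set.\<close>
  define v where "v t = (if \<exists>x. \<iota> x = u t then SOME x. \<iota> x = u t else 0)" for t
  have vx: "v t = x" if "\<iota> x = u t" for x t
  proof -
    have "\<iota> (SOME x. \<iota> x = u t) = u t" using that by (rule someI)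
    with that have "(SOME x. \<iota> x = u t) = x" by (intro injD[OF inj]) simp
    then show ?thesis using that by (auto simp: v_def)
  qed
  have uv: "AE t in M. \<iota> (v t) = u t" using ex by eventually_elim (use vx in auto)
  have vL: "AE t in M. ennreal (norm (v t) powr p) \<le> L t" using ex by eventually_elim (use vx in auto)
  have hm: "(\<lambda>t. h \<bullet> \<iota> (v t)) \<in> borel_measurable M" for h
  proof (rule measurable_AE)
    show "(\<lambda>t. u t \<bullet> h) \<in> borel_measurable M" by (intro continuous_imp_measurable_on_sets_lebesgue u_cont) simp
    show "AE t in M. u t \<bullet> h = h \<bullet> \<iota> (v t)" using uv by eventually_elim (simp add: inner_commute)
  qed simp
  have vm: "bochner_measurable M v"
  proof (rule bochner_measurable_weak[OF sep])
    fix \<xi> :: "'v \<Rightarrow>\<^sub>L real"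
    have "\<xi> \<in> closure (range (adjoint_embedding \<iota>))" using dense_adjoint_embedding[OF refl inj] by simp
    then obtain \<zeta> where \<zeta>: "\<And>n. \<zeta> n \<in> range (adjoint_embedding \<iota>)" "\<zeta> \<longlonglongrightarrow> \<xi>"
      unfolding closure_sequential by blast
    show "(\<lambda>t. \<xi> (v t)) \<in> borel_measurable M"
    proof (rule borel_measurable_LIMSEQ_real)
      show "(\<lambda>n. \<zeta> n (v t)) \<longlonglongrightarrow> \<xi> (v t)" for t by (intro tendsto_intros \<zeta>(2))
      fix n
      obtain h where "\<zeta> n = adjoint_embedding \<iota> h" using \<zeta>(1) by blast
      then show "(\<lambda>t. \<zeta> n (v t)) \<in> borel_measurable M" using hm by simp
    qed
  qed
  have "integrable M (\<lambda>t. norm (v t) powr p)"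
  proof (rule integrableI_bounded)
    show "(\<lambda>t. norm (v t) powr p) \<in> borel_measurable M" using bochner_measurable_norm[OF vm] by measurable
    have "(\<integral>\<^sup>+t. ennreal (norm (norm (v t) powr p)) \<partial>M) \<le> (\<integral>\<^sup>+t. L t \<partial>M)"
      using vL by (intro nn_integral_mono_AE) simp
    also have "\<dots> < \<infinity>" using LK by (rule le_less_trans) simp
    finally show "(\<integral>\<^sup>+t. ennreal (norm (norm (v t) powr p)) \<partial>M) < \<infinity>" .
  qed
  with vm have "v \<in> Lp T p" by (simp add: Lp_def)
  then show ?thesis using uv by (rule that)
qed

lemma solution:
  obtains v where "v \<in> Lp T p" "AE t in M. \<iota> (v t) = u t" "(\<lambda>t. B t (v t)) \<in> Lp T q"
    "\<And>w s t. 0 \<le> s \<Longrightarrow> s \<le> t \<Longrightarrow> t \<le> T \<Longrightarrow> (u t - u s) \<bullet> \<iota> w = - integral {s..t} (\<lambda>r. B r (v r) w)"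
    "continuous_on {0..T} u"
proof -
  obtain v where v: "v \<in> Lp T p" and uv: "AE t in M. \<iota> (v t) = u t" by (rule limit_Lp) (rule that)
  have p0: "0 < p" using p by simp
  have AET: "AE t in M. t \<in> {0..T}" by (intro AE_I2) simp
  define h where "h n r = B r (U n r) (U n r - v r)" for n r
  have hi: "integrable M (h n)" for n
    unfolding h_def[abs_def] by (rule pairing_integrable[OF p BU_Lq Lp_diff[OF p0 U_Lp v]])
  have gi: "(\<lambda>r. - B r (U n r)) \<in> Lp T q" for n by (rule Lp_uminus[OF BU_Lq])
  have gK: "(\<integral>r. norm (- B r (U n r)) powr q \<partial>M) \<le> Kq" for n using BU_Kq by simp
  have glim: "(\<lambda>n. integral {s..t} (\<lambda>r. (- B r (U n r)) w)) \<longlonglongrightarrow> (u t - u s) \<bullet> \<iota> w"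
    if "0 \<le> s" "s \<le> t" "t \<le> T" for w s t
    using tendsto_minus[OF BU_lim[OF that, of w]] by (simp add: blinfun.bilinear_simps)
  have elim: "(\<lambda>n. integral {0..T} (\<lambda>r. (- B r (U n r)) (v r))) \<longlonglongrightarrow> (norm (u T))\<^sup>2 / 2 - (norm (u 0))\<^sup>2 / 2"
    by (rule energy_limit[OF p v uv u_cont gi gK glim]) (use T in auto)
  \<comment> \<open>An upper bound for the integral of \<open>h n\<close>. The squared norm of
    \<open>z n\<close> has been replaced by its linearization at \<open>u T\<close>, a lower bound,
    so that weak convergence of \<open>z n\<close> suffices for \<beta> to tend to 0.\<close>
  define \<beta> where "\<beta> n = ((norm (u 0))\<^sup>2 / 2 - (norm (u T))\<^sup>2 / 2 - (z n \<bullet> u T - u T \<bullet> u T) + \<eta> n)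
      + integral {0..T} (\<lambda>r. (- B r (U n r)) (v r))" for n
  have "\<beta> \<longlonglongrightarrow> ((norm (u 0))\<^sup>2 / 2 - (norm (u T))\<^sup>2 / 2 - (u T \<bullet> u T - u T \<bullet> u T) + 0)
      + ((norm (u T))\<^sup>2 / 2 - (norm (u 0))\<^sup>2 / 2)"
    unfolding \<beta>_def[abs_def] by (intro tendsto_intros z_lim eta elim)
  then have \<beta>0: "\<beta> \<longlonglongrightarrow> 0" by simp
  have h\<beta>: "(\<integral>r. h n r \<partial>M) \<le> \<beta> n" for n
  proof -
    have i1: "integrable M (\<lambda>r. B r (U n r) (U n r))" by (rule pairing_integrable[OF p BU_Lq U_Lp])
    have i2: "integrable M (\<lambda>r. (- B r (U n r)) (v r))" by (rule pairing_integrable[OF p gi v])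
    have "(\<integral>r. h n r \<partial>M) = (\<integral>r. B r (U n r) (U n r) + (- B r (U n r)) (v r) \<partial>M)"
      by (simp add: h_def blinfun.bilinear_simps)
    also have "\<dots> = integral {0..T} (\<lambda>r. B r (U n r) (U n r)) + integral {0..T} (\<lambda>r. (- B r (U n r)) (v r))"
      unfolding integral_full_interval[OF i1] integral_full_interval[OF i2] using i1 i2 by (rule Bochner_Integration.integral_add)
    also have "integral {0..T} (\<lambda>r. B r (U n r) (U n r)) \<le> (norm (u 0))\<^sup>2 / 2 - (norm (z n))\<^sup>2 / 2 + \<eta> n"
      using energy[of n] by simp
    also have "\<dots> \<le> (norm (u 0))\<^sup>2 / 2 - (norm (u T))\<^sup>2 / 2 - (z n \<bullet> u T - u T \<bullet> u T) + \<eta> n"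
      using half_norm_diff_bounds(1)[of "z n" "u T"] by (simp add: inner_diff_left)
    finally show ?thesis by (simp add: \<beta>_def)
  qed
  obtain \<kappa> where \<kappa>: "integrable M \<kappa>"
    "AE t in M. \<forall>x. norm (\<iota> x) \<le> R \<longrightarrow> c1 / 2 * norm x powr p - \<kappa> t \<le> B t x (x - v t)"
    by (rule B_lower_bound[OF v, of R]) (rule that)
  have c2: "0 < c1 / 2" using c1 by simp
  have hlb: "AE t in M. \<forall>n. c1 / 2 * norm (U n t) powr p - \<kappa> t \<le> h n t"
    using \<kappa>(2) AET by eventually_elim (use U_R in \<open>auto simp: h_def\<close>)
  have Ulim: "(\<lambda>n. h' \<bullet> \<iota> (U n t)) \<longlonglongrightarrow> h' \<bullet> \<iota> (v t)" if "t \<in> {0..T}" "\<iota> (v t) = u t" for t h'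
    using U_lim[OF that(1)] that(2) by simp
  have mlim: "AE t in M. (\<lambda>n. min (h n t) 0) \<longlonglongrightarrow> 0"
    using hlb pm uv AET
  proof eventually_elim
    fix t assume lb: "\<forall>n. c1 / 2 * norm (U n t) powr p - \<kappa> t \<le> h n t" and A: "pseudo_monotone (B t)"
      and ut: "\<iota> (v t) = u t" and t: "t \<in> {0..T}"
    show "(\<lambda>n. min (h n t) 0) \<longlonglongrightarrow> 0"
    proof (rule tendstoI)
      fix e :: real assume e: "0 < e"
      have "\<forall>\<^sub>F n in sequentially. - e < B t (U n t) (U n t - v t)"
        by (rule pseudo_monotone_nonneg_limit[where K = "\<kappa> t", OF refl inj A Ulim[OF t ut] _ c2 p0 e])
          (use lb in \<open>simp add: h_def\<close>)
      then show "\<forall>\<^sub>F n in sequentially. dist (min (h n t) 0) 0 < e"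
        by eventually_elim (use e in \<open>auto simp: h_def dist_real_def min_def\<close>)
    qed
  qed
  have mint: "(\<lambda>n. \<integral>t. min (h n t) 0 \<partial>M) \<longlonglongrightarrow> (\<integral>t. 0 \<partial>M)"
  proof (rule integral_dominated_convergence[OF _ _ _ mlim])
    show "integrable M (\<lambda>t. \<bar>\<kappa> t\<bar>)" using \<kappa>(1) by auto
    show "(\<lambda>t. min (h n t) 0) \<in> borel_measurable M" for n using hi[of n] by measurable
    show "AE t in M. norm (min (h n t) 0) \<le> \<bar>\<kappa> t\<bar>" for n
      using hlb
    proof eventually_elim
      fix t assume "\<forall>n. c1 / 2 * norm (U n t) powr p - \<kappa> t \<le> h n t"
      then have "c1 / 2 * norm (U n t) powr p - \<kappa> t \<le> h n t" by blast
      moreover have "0 \<le> c1 / 2 * norm (U n t) powr p" using c2 by simp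
      ultimately show "norm (min (h n t) 0) \<le> \<bar>\<kappa> t\<bar>" by (auto simp: min_def)
    qed
  qed simp
  have L1: "(\<lambda>n. \<integral>t. norm (h n t) \<partial>M) \<longlonglongrightarrow> 0"
  proof (rule tendsto_sandwich[of "\<lambda>_. 0" _ _ "\<lambda>n. \<beta> n - 2 * (\<integral>t. min (h n t) 0 \<partial>M)"])
    have "(\<integral>t. norm (h n t) \<partial>M) = (\<integral>t. h n t - 2 * min (h n t) 0 \<partial>M)" for n
      by (intro Bochner_Integration.integral_cong) (auto simp: min_def)
    also have "\<dots> n = (\<integral>t. h n t \<partial>M) - 2 * (\<integral>t. min (h n t) 0 \<partial>M)" for n
      using hi[of n] by simp
    finally show "\<forall>\<^sub>F n in sequentially. (\<integral>t. norm (h n t) \<partial>M) \<le> \<beta> n - 2 * (\<integral>t. min (h n t) 0 \<partial>M)"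
      using h\<beta> by (intro always_eventually) simp
    show "(\<lambda>n. \<beta> n - 2 * (\<integral>t. min (h n t) 0 \<partial>M)) \<longlonglongrightarrow> 0"
      using tendsto_diff[OF \<beta>0 tendsto_mult_left[OF mint, of 2]] by simp
  qed auto
  obtain s :: "nat \<Rightarrow> nat" where s: "strict_mono s" "AE t in M. (\<lambda>n. h (s n) t) \<longlonglongrightarrow> 0"
    using tendsto_L1_AE_subseq[OF hi L1] by blast
  have hs0: "(\<lambda>n. \<integral>t. h (s n) t \<partial>M) \<longlonglongrightarrow> 0"
  proof (rule tendsto_by_bound)
    show "\<bar>(\<integral>t. h (s n) t \<partial>M) - 0\<bar> \<le> (\<integral>t. norm (h (s n) t) \<partial>M)" for n
      using integral_abs_bound[of M "h (s n)"] by simp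
    show "(\<lambda>n. \<integral>t. norm (h (s n) t) \<partial>M) \<longlonglongrightarrow> 0" using LIMSEQ_subseq_LIMSEQ[OF L1 s(1)] by (simp add: o_def)
  qed
  have vR: "AE t in M. norm (\<iota> (v t)) \<le> R" using uv AET by eventually_elim (use u_R in auto)
  have Bv: "(\<lambda>t. B t (v t)) \<in> Lp T q"
  proof (rule B_along_Lp[of R])
    fix K assume *: "\<And>v. v \<in> Lp T p \<Longrightarrow> AE t in M. norm (\<iota> (v t)) \<le> R \<Longrightarrow>
      (\<lambda>t. B t (v t)) \<in> Lp T q \<and> (\<integral>t. norm (B t (v t)) powr q \<partial>M) \<le> K * (1 + (\<integral>t. norm (v t) powr p \<partial>M))"
    from *[OF v vR] show ?thesis by blast
  qed
  have Bvw: "integrable M (\<lambda>r. B r (v r) w)" for w by (rule pairing_integrable[OF p Bv Lp_const])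
  have BUw: "integrable M (\<lambda>r. B r (U n r) w)" for n w by (rule pairing_integrable[OF p BU_Lq Lp_const])
  have le: "integral {a..b} (\<lambda>r. B r (v r) w) \<le> - ((u b - u a) \<bullet> \<iota> w)" if ab: "0 \<le> a" "a \<le> b" "b \<le> T" for a b w
  proof (rule field_le_epsilon)
    fix e :: real assume e: "0 < e"
    \<comment> \<open>A localized perturbation of \<open>v\<close>: since v - \<psi> is
      \<open>w\<close> on [a, b] and 0 elsewhere, the pointwise inequality of pseudo-monotonicity
      integrates to one over [a, b] tested with \<open>w\<close>.\<close>
    define \<psi> where "\<psi> r = v r - indicator {a..b} r *\<^sub>R w" for r
    have \<psi>: "\<psi> \<in> Lp T p" unfolding \<psi>_def[abs_def] by (rule Lp_diff[OF p0 v Lp_indicator[OF p0 ab(1,3)]])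
    obtain \<mu> where \<mu>: "integrable M \<mu>"
      "AE t in M. \<forall>x. norm (\<iota> x) \<le> R \<longrightarrow> c1 / 2 * norm x powr p - \<mu> t \<le> B t x (x - \<psi> t)"
      by (rule B_lower_bound[OF \<psi>, of R]) (rule that)
    define h' where "h' n r = B r (U (s n) r) (U (s n) r - \<psi> r)" for n r
    have h'i: "integrable M (h' n)" for n
      unfolding h'_def[abs_def] by (rule pairing_integrable[OF p BU_Lq Lp_diff[OF p0 U_Lp \<psi>]])
    define G where "G r = B r (v r) (v r - \<psi> r)" for r
    have Gi: "integrable M G" unfolding G_def[abs_def] by (rule pairing_integrable[OF p Bv Lp_diff[OF p0 v \<psi>]])
    have "\<forall>\<^sub>F n in sequentially. (\<integral>r. G r \<partial>M) - e < (\<integral>r. h' n r \<partial>M)"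
    proof (rule eventually_integral_ge[OF h'i \<mu>(1) Gi _ _ e])
      show "AE r in M. - \<mu> r \<le> h' n r" for n
        using \<mu>(2) AET
      proof eventually_elim
        fix t assume "\<forall>x. norm (\<iota> x) \<le> R \<longrightarrow> c1 / 2 * norm x powr p - \<mu> t \<le> B t x (x - \<psi> t)" "t \<in> {0..T}"
        then have "c1 / 2 * norm (U (s n) t) powr p - \<mu> t \<le> h' n t" using U_R by (simp add: h'_def)
        moreover have "0 \<le> c1 / 2 * norm (U (s n) t) powr p" using c2 by simp
        ultimately show "- \<mu> t \<le> h' n t" by linarith
      qed
      show "AE r in M. \<forall>e>0. \<forall>\<^sub>F n in sequentially. G r - e < h' n r"
        using hlb pm uv AET s(2)
      proof (eventually_elim, intro allI impI)
        fix t and e :: real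
        assume lb: "\<forall>n. c1 / 2 * norm (U n t) powr p - \<kappa> t \<le> h n t" and A: "pseudo_monotone (B t)"
          and ut: "\<iota> (v t) = u t" and t: "t \<in> {0..T}" and h0: "(\<lambda>n. h (s n) t) \<longlonglongrightarrow> 0" and e: "0 < e"
        have lim: "(\<lambda>n. h' \<bullet> \<iota> (U (s n) t)) \<longlonglongrightarrow> h' \<bullet> \<iota> (v t)" for h'
          using LIMSEQ_subseq_LIMSEQ[OF Ulim[OF t ut, of h'] s(1)] by (simp add: o_def)
        show "\<forall>\<^sub>F n in sequentially. G t - e < h' n t"
          unfolding G_def h'_def
          by (rule pseudo_monotone_limit_ge[where K = "\<kappa> t", OF refl inj A lim _ c2 p0 e])
            (use lb h0 in \<open>simp_all add: h_def\<close>)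
      qed
    qed
    moreover have "(\<integral>r. G r \<partial>M) = integral {a..b} (\<lambda>r. B r (v r) w)"
      unfolding integral_subinterval(4)[OF Bvw ab(1,3)] by (simp add: G_def \<psi>_def blinfun.bilinear_simps)
    moreover have "(\<integral>r. h' n r \<partial>M) = (\<integral>r. h (s n) r \<partial>M) + integral {a..b} (\<lambda>r. B r (U (s n) r) w)" for n
    proof -
      have "(\<integral>r. h' n r \<partial>M) = (\<integral>r. h (s n) r + indicator {a..b} r * B r (U (s n) r) w \<partial>M)"
        by (simp add: h'_def h_def \<psi>_def blinfun.bilinear_simps algebra_simps)
      also have "\<dots> = (\<integral>r. h (s n) r \<partial>M) + (\<integral>r. indicator {a..b} r * B r (U (s n) r) w \<partial>M)"
        by (rule Bochner_Integration.integral_add[OF hi integral_subinterval(3)[OF BUw ab(1,3)]])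
      finally show ?thesis unfolding integral_subinterval(4)[OF BUw ab(1,3)] .
    qed
    ultimately have ev: "\<forall>\<^sub>F n in sequentially. integral {a..b} (\<lambda>r. B r (v r) w) - e
        \<le> (\<integral>r. h (s n) r \<partial>M) + integral {a..b} (\<lambda>r. B r (U (s n) r) w)"
      by (auto elim: eventually_mono)
    have "(\<lambda>n. integral {a..b} (\<lambda>r. B r (U (s n) r) w)) \<longlonglongrightarrow> - ((u b - u a) \<bullet> \<iota> w)"
      using LIMSEQ_subseq_LIMSEQ[OF BU_lim[OF ab, of w] s(1)] by (simp add: o_def)
    from tendsto_lowerbound[OF tendsto_add[OF hs0 this] ev]
    show "integral {a..b} (\<lambda>r. B r (v r) w) \<le> - ((u b - u a) \<bullet> \<iota> w) + e" by simp
  qed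
  have eq: "(u b - u a) \<bullet> \<iota> w = - integral {a..b} (\<lambda>r. B r (v r) w)" if ab: "0 \<le> a" "a \<le> b" "b \<le> T" for a b w
  proof -
    \<comment> \<open>Both sides are linear in \<open>w\<close>, so the inequality for - w turns it
      into an equation.\<close>
    have "integral {a..b} (\<lambda>r. B r (v r) (- w)) = - integral {a..b} (\<lambda>r. B r (v r) w)"
      by (simp add: blinfun.bilinear_simps)
    then show ?thesis using le[OF ab, of w] le[OF ab, of "- w"] by (simp add: blinfun.bilinear_simps)
  qed
  have ngi: "(\<lambda>r. - B r (v r)) \<in> Lp T q" by (rule Lp_uminus[OF Bv])
  have nvi: "integrable M (\<lambda>r. (- B r (v r)) (v r))" by (rule pairing_integrable[OF p ngi v])
  have norm_eq: "(norm (u t))\<^sup>2 = (norm (u 0))\<^sup>2 + 2 * integral {0..t} (\<lambda>r. (- B r (v r)) (v r))" if t: "t \<in> {0..T}" for t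
  proof -
    \<comment> \<open>Integration by parts for the limit itself is \<open>energy_limit\<close>
      applied to a constant sequence.\<close>
    have "(\<lambda>n::nat. integral {0..t} (\<lambda>r. (- B r (v r)) (v r))) \<longlonglongrightarrow> (norm (u t))\<^sup>2 / 2 - (norm (u 0))\<^sup>2 / 2"
    proof (rule energy_limit[OF p v uv u_cont ngi order_refl])
      show "(\<lambda>n. integral {a..b} (\<lambda>r. (- B r (v r)) w)) \<longlonglongrightarrow> (u b - u a) \<bullet> \<iota> w" if "0 \<le> a" "a \<le> b" "b \<le> T" for w a b
        using eq[OF that, of w] by (simp add: blinfun.bilinear_simps)
    qed (use t in auto)
    then have "integral {0..t} (\<lambda>r. (- B r (v r)) (v r)) = (norm (u t))\<^sup>2 / 2 - (norm (u 0))\<^sup>2 / 2"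
      by (rule LIMSEQ_unique[OF tendsto_const])
    then show ?thesis by simp
  qed
  have nc: "continuous_on {0..T} (\<lambda>t. (norm (u 0))\<^sup>2 + 2 * integral {0..t} (\<lambda>r. (- B r (v r)) (v r)))"
    by (intro continuous_intros indefinite_integral_continuous_1 integral_subinterval(2)[OF nvi]) auto
  have "continuous_on {0..T} u"
    unfolding continuous_on_def
  proof
    fix t assume t: "t \<in> {0..T}"
    \<comment> \<open>This is the squared distance of \<open>u r\<close> from \<open>u t\<close>
      with the squared norm of \<open>u r\<close> replaced by its integral formula; each summand is
      then known to be continuous from weak continuity alone.\<close>
    let ?f = "\<lambda>r. ((norm (u 0))\<^sup>2 + 2 * integral {0..r} (\<lambda>r. (- B r (v r)) (v r))) - 2 * (u r \<bullet> u t) + u t \<bullet> u t"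
    have "continuous_on {0..T} ?f" by (intro continuous_intros nc u_cont)
    then have "(?f \<longlongrightarrow> ?f t) (at t within {0..T})" using t unfolding continuous_on_def by (rule bspec)
    moreover have "?f t = 0" using norm_eq[OF t] by (simp add: power2_norm_eq_inner)
    ultimately have "(?f \<longlongrightarrow> 0) (at t within {0..T})" by simp
    moreover have f_eq: "?f r = (norm (u r - u t))\<^sup>2" if "r \<in> {0..T}" for r
      using norm_eq[OF that] unfolding power2_norm_eq_inner by (simp add: inner_simps inner_commute)
    then have "\<forall>\<^sub>F r in at t within {0..T}. ?f r = (norm (u r - u t))\<^sup>2"
      unfolding eventually_at_filter by (intro always_eventually allI impI f_eq)
    ultimately have "((\<lambda>r. (norm (u r - u t))\<^sup>2) \<longlongrightarrow> 0) (at t within {0..T})" by (rule Lim_transform_eventually)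
    then have "((\<lambda>r. sqrt ((norm (u r - u t))\<^sup>2)) \<longlongrightarrow> sqrt 0) (at t within {0..T})" by (rule tendsto_real_sqrt)
    then show "(u \<longlongrightarrow> u t) (at t within {0..T})" by (simp add: tendsto_norm_zero_iff LIM_zero_iff)
  qed
  with v uv Bv eq show ?thesis by (rule that)
qed

end

section \<open>Galerkin sequence and existence for the equation without right-hand side\<close>

context evolution
begin

lemma galerkin_sequence:
  fixes u0 :: 'h and W :: "nat \<Rightarrow> 'v set"
  assumes inj: "inj (blinfun_apply \<iota>)" and W: "\<And>n. \<exists>F. finite F \<and> W n = span F"
  obtains U :: "nat \<Rightarrow> real \<Rightarrow> 'v" and y :: "nat \<Rightarrow> real \<Rightarrow> 'h" and Kp Kq :: real where
    "\<And>n. U n \<in> Lp T p" "\<And>n t. t \<in> {0..T} \<Longrightarrow> norm (\<iota> (U n t)) \<le> energy_radius u0"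
    "\<And>n t. t \<in> {0..T} \<Longrightarrow> norm (y n t - \<iota> (U n t)) \<le> inverse (real (Suc n))"
    "\<And>n t w. t \<in> {0..T} \<Longrightarrow> w \<in> W n \<Longrightarrow> y n t \<bullet> \<iota> w = u0 \<bullet> \<iota> w - integral {0..t} (\<lambda>r. B r (U n r) w)"
    "\<And>n t. t \<in> {0..T} \<Longrightarrow>
      (norm (y n t))\<^sup>2 / 2 \<le> (norm u0)\<^sup>2 / 2 - integral {0..t} (\<lambda>r. B r (U n r) (U n r)) + inverse (real (Suc n))"
    "\<And>n. (\<integral>t. norm (U n t) powr p \<partial>M) \<le> Kp"
    "\<And>n. (\<lambda>t. B t (U n t)) \<in> Lp T q" "\<And>n. (\<integral>t. norm (B t (U n t)) powr q \<partial>M) \<le> Kq"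
proof -
  define P where "P n U y \<longleftrightarrow> U \<in> Lp T p \<and> (\<forall>t\<in>{0..T}. norm (\<iota> (U t)) \<le> energy_radius u0) \<and>
    (\<forall>t\<in>{0..T}. norm (y t - \<iota> (U t)) \<le> inverse (real (Suc n))) \<and>
    (\<forall>t\<in>{0..T}. \<forall>w\<in>W n. y t \<bullet> \<iota> w = u0 \<bullet> \<iota> w - integral {0..t} (\<lambda>r. B r (U r) w)) \<and>
    (\<forall>t\<in>{0..T}. (norm (y t))\<^sup>2 / 2 \<le> (norm u0)\<^sup>2 / 2 - integral {0..t} (\<lambda>r. B r (U r) (U r)) + inverse (real (Suc n)))"
    for n and U :: "real \<Rightarrow> 'v" and y :: "real \<Rightarrow> 'h"
  have "\<exists>U y. P n U y" for n
  proof -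
    obtain F where F: "finite F" "W n = span F" using W by blast
    obtain E where E: "orthonormal_image \<iota> E" "span E = span F"
      using orthonormal_image_exists[OF inj F(1)] by blast
    have e: "0 < inverse (real (Suc n))" "inverse (real (Suc n)) \<le> 1" by (auto simp: field_simps)
    obtain U y where "U \<in> Lp T p" "\<And>t. t \<in> {0..T} \<Longrightarrow> norm (\<iota> (U t)) \<le> energy_radius u0"
      "\<And>t. t \<in> {0..T} \<Longrightarrow> norm (y t - \<iota> (U t)) \<le> inverse (real (Suc n))"
      "\<And>t w. t \<in> {0..T} \<Longrightarrow> w \<in> span E \<Longrightarrow> y t \<bullet> \<iota> w = u0 \<bullet> \<iota> w - integral {0..t} (\<lambda>r. B r (U r) w)"
      "\<And>t. t \<in> {0..T} \<Longrightarrow> (norm (y t))\<^sup>2 / 2 \<le> (norm u0)\<^sup>2 / 2 - integral {0..t} (\<lambda>r. B r (U r) (U r)) + inverse (real (Suc n))"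
      by (rule galerkin_solution[OF E(1) e, of u0]) (rule that)
    then have "P n U y" unfolding P_def F(2) E(2) by blast
    then show ?thesis by blast
  qed
  then obtain U y where Py: "\<And>n. P n (U n) (y n)" by metis
  have 1: "U n \<in> Lp T p" for n using Py[of n] unfolding P_def by blast
  have 2: "norm (\<iota> (U n t)) \<le> energy_radius u0" if "t \<in> {0..T}" for n t using Py[of n] that unfolding P_def by blast
  have 3: "norm (y n t - \<iota> (U n t)) \<le> inverse (real (Suc n))" if "t \<in> {0..T}" for n t
    using Py[of n] that unfolding P_def by blast
  have 4: "y n t \<bullet> \<iota> w = u0 \<bullet> \<iota> w - integral {0..t} (\<lambda>r. B r (U n r) w)" if "t \<in> {0..T}" "w \<in> W n" for n t w
    using Py[of n] that unfolding P_def by blast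
  have 5: "(norm (y n t))\<^sup>2 / 2 \<le> (norm u0)\<^sup>2 / 2 - integral {0..t} (\<lambda>r. B r (U n r) (U n r)) + inverse (real (Suc n))"
    if "t \<in> {0..T}" for n t using Py[of n] that unfolding P_def by blast
  obtain K where K: "0 \<le> K" and KB: "\<And>v. v \<in> Lp T p \<Longrightarrow> AE t in M. norm (\<iota> (v t)) \<le> energy_radius u0 \<Longrightarrow>
      (\<lambda>t. B t (v t)) \<in> Lp T q \<and> (\<integral>t. norm (B t (v t)) powr q \<partial>M) \<le> K * (1 + (\<integral>t. norm (v t) powr p \<partial>M))"
    by (rule B_along_Lp[of "energy_radius u0"]) (rule that)
  have AER: "AE t in M. norm (\<iota> (U n t)) \<le> energy_radius u0" for n by (intro AE_I2) (simp add: 2)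
  have 7: "(\<lambda>t. B t (U n t)) \<in> Lp T q" for n using KB[OF 1 AER] by blast
  define Kp where "Kp = ((norm u0)\<^sup>2 / 2 + 1 + (\<integral>r. \<bar>k r\<bar> \<partial>M)) / c1"
  have 6: "(\<integral>t. norm (U n t) powr p \<partial>M) \<le> Kp" for n
  proof -
    have i: "integrable M (\<lambda>r. B r (U n r) (U n r))" by (rule pairing_integrable[OF p 7 1])
    \<comment> \<open>The squared norm of y n T is discarded from the energy estimate, which leaves
      a bound on the integrated coercivity term.\<close>
    have "0 \<le> (norm u0)\<^sup>2 / 2 - integral {0..T} (\<lambda>r. B r (U n r) (U n r)) + inverse (real (Suc n))"
      using order_trans[OF _ 5[of T n], of 0] T by simp
    moreover have "inverse (real (Suc n)) \<le> 1" by (simp add: field_simps)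
    ultimately have "(\<integral>r. B r (U n r) (U n r) \<partial>M) \<le> (norm u0)\<^sup>2 / 2 + 1"
      unfolding integral_full_interval[OF i, symmetric] by linarith
    from coercive_bound[OF 1 i this] show ?thesis by (simp add: Kp_def)
  qed
  have 8: "(\<integral>t. norm (B t (U n t)) powr q \<partial>M) \<le> K * (1 + Kp)" for n
  proof -
    have "(\<integral>t. norm (B t (U n t)) powr q \<partial>M) \<le> K * (1 + (\<integral>t. norm (U n t) powr p \<partial>M))"
      using KB[OF 1 AER] by blast
    also have "\<dots> \<le> K * (1 + Kp)" using 6[of n] K by (intro mult_left_mono) auto
    finally show ?thesis .
  qed
  from 1 2 3 4 5 6 7 8 show ?thesis by (rule that)
qed

lemma functional_integral_bound:
  fixes g :: "real \<Rightarrow> 'v \<Rightarrow>\<^sub>L real"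
  assumes g: "g \<in> Lp T q" and K: "(\<integral>t. norm (g t) powr q \<partial>M) \<le> K"
    and young: "\<And>a b. 0 \<le> a \<Longrightarrow> 0 \<le> b \<Longrightarrow> a * b \<le> l * a powr q + C * b powr p" and l: "0 \<le> l"
    and st: "0 \<le> s" "s \<le> t" "t \<le> T"
  shows "\<bar>integral {s..t} (\<lambda>r. g r w)\<bar> \<le> norm w * (l * K + C * (t - s))"
proof -
  have i1: "(\<lambda>r. g r w) integrable_on {s..t}"
    by (rule integral_subinterval(2)[OF pairing_integrable[OF p g Lp_const] st(1,3)])
  note gi = LpD(2)[OF g]
  have i2: "(\<lambda>r. norm (g r) powr q) integrable_on {s..t}" by (rule integral_subinterval(2)[OF gi st(1,3)])
  have "norm (integral {s..t} (\<lambda>r. g r w)) \<le> integral {s..t} (\<lambda>r. norm w * (l * norm (g r) powr q + C))"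
  proof (rule Henstock_Kurzweil_Integration.integral_norm_bound_integral[OF i1])
    show "(\<lambda>r. norm w * (l * norm (g r) powr q + C)) integrable_on {s..t}"
      by (intro integrable_on_mult_right integrable_add i2 integrable_const_ivl)
    fix r
    have "norm (g r w) \<le> norm w * norm (g r)" using norm_blinfun[of "g r" w] by (simp add: mult.commute)
    also have "\<dots> \<le> norm w * (l * norm (g r) powr q + C)"
      using young[of "norm (g r)" 1] by (intro mult_left_mono) auto
    finally show "norm (g r w) \<le> norm w * (l * norm (g r) powr q + C)" .
  qed
  also have "\<dots> = norm w * (l * integral {s..t} (\<lambda>r. norm (g r) powr q) + C * (t - s))"
    using i2 st by (simp add: Henstock_Kurzweil_Integration.integral_add integrable_on_mult_right integrable_const_ivl mult.commute)
  also have "\<dots> \<le> norm w * (l * K + C * (t - s))"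
    using integral_subinterval_le[OF gi st(1,3)] K l by (intro mult_left_mono add_right_mono) auto
  finally show ?thesis by simp
qed

lemma existence:
  fixes u0 :: 'h and W :: "nat \<Rightarrow> 'v set"
  assumes sep: "separable_space (euclidean :: 'v topology)" and refl: "reflexive_space TYPE('v)"
    and emb: "dense_embedding \<iota>" and pm: "AE t in M. pseudo_monotone (B t)"
    and W: "\<And>n. \<exists>F. finite F \<and> W n = span F" "\<And>n. W n \<subseteq> W (Suc n)" "closure (\<Union>n. W n) = UNIV"
  obtains v u where "v \<in> Lp T p" "AE t in M. \<iota> (v t) = u t" "(\<lambda>t. B t (v t)) \<in> Lp T q"
    "\<And>w s t. 0 \<le> s \<Longrightarrow> s \<le> t \<Longrightarrow> t \<le> T \<Longrightarrow> (u t - u s) \<bullet> \<iota> w = - integral {s..t} (\<lambda>r. B r (v r) w)"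
    "continuous_on {0..T} u" "u 0 = u0"
proof -
  have inj: "inj (blinfun_apply \<iota>)" and dense: "closure (range (blinfun_apply \<iota>)) = UNIV"
    using emb by (auto simp: dense_embedding_def)
  define R where "R = energy_radius u0"
  obtain U y Kp Kq where U: "\<And>n. U n \<in> Lp T p" and U_R: "\<And>n t. t \<in> {0..T} \<Longrightarrow> norm (\<iota> (U n t)) \<le> R"
    and yU: "\<And>n t. t \<in> {0..T} \<Longrightarrow> norm (y n t - \<iota> (U n t)) \<le> inverse (real (Suc n))"
    and yeq: "\<And>n t w. t \<in> {0..T} \<Longrightarrow> w \<in> W n \<Longrightarrow> y n t \<bullet> \<iota> w = u0 \<bullet> \<iota> w - integral {0..t} (\<lambda>r. B r (U n r) w)"
    and energy: "\<And>n t. t \<in> {0..T} \<Longrightarrow>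
      (norm (y n t))\<^sup>2 / 2 \<le> (norm u0)\<^sup>2 / 2 - integral {0..t} (\<lambda>r. B r (U n r) (U n r)) + inverse (real (Suc n))"
    and Kp: "\<And>n. (\<integral>t. norm (U n t) powr p \<partial>M) \<le> Kp"
    and BU: "\<And>n. (\<lambda>t. B t (U n t)) \<in> Lp T q" and Kq: "\<And>n. (\<integral>t. norm (B t (U n t)) powr q \<partial>M) \<le> Kq"
    by (rule galerkin_sequence[OF inj W(1), of u0, folded R_def]) (rule that)
  have Kq0: "0 \<le> Kq" using order_trans[OF Bochner_Integration.integral_nonneg Kq] by simp
  have T0: "0 \<in> {0..T}" using T by simp
  have R0: "0 \<le> R" using order_trans[OF norm_ge_zero U_R[OF T0]] .
  have W_mono: "W m \<subseteq> W n" if "m \<le> n" for m n using W(2) that by (rule lift_Suc_mono_le[of W])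
  have BUw: "integrable M (\<lambda>r. B r (U n r) w)" for n w by (rule pairing_integrable[OF p BU Lp_const])
  have ydiff: "(y n t - y n s) \<bullet> \<iota> w = - integral {s..t} (\<lambda>r. B r (U n r) w)"
    if "w \<in> W n" "0 \<le> s" "s \<le> t" "t \<le> T" for n w s t
    using that yeq[of t w n] yeq[of s w n] integral_subinterval(2)[OF BUw, of 0 t]
      Henstock_Kurzweil_Integration.integral_combine[of 0 s t "\<lambda>r. B r (U n r) w"]
    by (simp add: inner_diff_left)
  have equi: "\<exists>d>0. \<forall>n s t. 0 \<le> s \<longrightarrow> s \<le> t \<longrightarrow> t \<le> T \<longrightarrow> t - s < d \<longrightarrow> \<bar>integral {s..t} (\<lambda>r. B r (U n r) w)\<bar> \<le> e"
    if e: "0 < e" for e w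
  proof -
    \<comment> \<open>All constants depend on \<open>w\<close>, \<open>e\<close> and the common
      bound \<open>Kq\<close> only; this is what makes \<open>d\<close> independent of
      \<open>n\<close>.\<close>
    define N where "N = (norm w + 1) * (Kq + 1)"
    define l where "l = e / (2 * N)"
    have pos: "0 < N" unfolding N_def using Kq0 by (intro mult_pos_pos add_nonneg_pos) auto
    have l: "0 < l" "norm w * (l * Kq) \<le> e / 2"
    proof -
      show "0 < l" using e pos by (simp add: l_def)
      have "norm w * Kq \<le> N" unfolding N_def using Kq0 by (intro mult_mono) auto
      from mult_left_mono[OF this, of "e / 2"] show "norm w * (l * Kq) \<le> e / 2"
        using pos e by (simp add: l_def field_simps)
    qed
    obtain C where C: "0 < C" "\<And>a b. 0 \<le> a \<Longrightarrow> 0 \<le> b \<Longrightarrow> a * b \<le> l * a powr q + C * b powr p"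
      by (rule young_epsilon[OF p l(1)]) (rule that)
    define N' where "N' = norm w + 1"
    have nw: "0 < N'" "norm w \<le> N'" unfolding N'_def by (auto intro: add_nonneg_pos)
    define d where "d = e / (2 * (N' * C))"
    have d: "0 < d" using e C nw by (simp add: d_def)
    have "\<bar>integral {s..t} (\<lambda>r. B r (U n r) w)\<bar> \<le> e" if st: "0 \<le> s" "s \<le> t" "t \<le> T" "t - s < d" for n s t
    proof -
      have "norm w * (C * (t - s)) \<le> N' * (C * d)" using st C(1) d nw by (intro mult_mono) auto
      also have "\<dots> = e / 2" using C(1) nw by (simp add: d_def)
      finally show ?thesis
        using functional_integral_bound[OF BU[of n] Kq[of n] C(2) less_imp_le[OF l(1)] st(1-3), where w = w] l(2) by (simp add: algebra_simps)
    qed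
    with d show ?thesis by blast
  qed
  have DW: "closure (\<Union>m. \<iota> ` W m) = UNIV"
    using dense_embedding_image[OF dense W(3)] by (simp add: image_UN)
  obtain D0 :: "'v set" where D0: "countable D0" "closure D0 = UNIV" using sep by (auto simp: separable_space_def)
  have yR: "norm (y n t) \<le> R + 1" if "t \<in> {0..T}" for n t
  proof -
    have "inverse (real (Suc n)) \<le> 1" by (simp add: field_simps)
    then show ?thesis using U_R[OF that, of n] yU[OF that, of n] norm_triangle_ineq2[of "y n t" "\<iota> (U n t)"] by linarith
  qed
  obtain r u where r: "strict_mono (r :: nat \<Rightarrow> nat)" and ylim: "\<And>t h. t \<in> {0..T} \<Longrightarrow> (\<lambda>n. y (r n) t \<bullet> h) \<longlonglongrightarrow> u t \<bullet> h"
  proof (rule weak_pointwise_subsequence[OF T yR countable_image[OF D0(1)] dense_embedding_image[OF dense D0(2)] DW])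
    fix m h and e :: real assume h: "h \<in> \<iota> ` W m" and e: "0 < e"
    then obtain w where w: "w \<in> W m" "h = \<iota> w" by blast
    obtain d where d: "0 < d"
      "\<And>n s t. 0 \<le> s \<Longrightarrow> s \<le> t \<Longrightarrow> t \<le> T \<Longrightarrow> t - s < d \<Longrightarrow> \<bar>integral {s..t} (\<lambda>r. B r (U n r) w)\<bar> \<le> e"
      using equi[OF e, of w] by blast
    have le: "\<bar>y n t \<bullet> h - y n s \<bullet> h\<bar> \<le> e" if "m \<le> n" "0 \<le> s" "s \<le> t" "t \<le> T" "t - s < d" for n s t
      using ydiff[of w n s t] W_mono[OF that(1)] w that d(2)[of s t n] by (auto simp: inner_diff_left)
    have "\<bar>y n s \<bullet> h - y n t \<bullet> h\<bar> \<le> e" if "m \<le> n" "s \<in> {0..T}" "t \<in> {0..T}" "\<bar>s - t\<bar> < d" for n s t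
      using le[of n s t] le[of n t s] that by (cases "s \<le> t") (auto simp: abs_minus_commute)
    then show "\<exists>d>0. \<forall>n\<ge>m. \<forall>s\<in>{0..T}. \<forall>t\<in>{0..T}. \<bar>s - t\<bar> < d \<longrightarrow> \<bar>y n s \<bullet> h - y n t \<bullet> h\<bar> \<le> e"
      using d(1) by blast
  qed (assumption | rule that)+
  have rn: "n \<le> r n" for n by (rule seq_suble[OF r])
  have Ulim: "(\<lambda>n. h \<bullet> \<iota> (U (r n) t)) \<longlonglongrightarrow> h \<bullet> u t" if t: "t \<in> {0..T}" for t h
  proof -
    have "(\<lambda>n. y (r n) t \<bullet> h - h \<bullet> \<iota> (U (r n) t)) \<longlonglongrightarrow> 0"
    proof (rule tendsto_by_bound)
      fix n
      have "\<bar>y (r n) t \<bullet> h - h \<bullet> \<iota> (U (r n) t)\<bar> \<le> norm (y (r n) t - \<iota> (U (r n) t)) * norm h"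
        using Cauchy_Schwarz_ineq2[of "y (r n) t - \<iota> (U (r n) t)" h] by (simp add: inner_simps inner_commute)
      also have "\<dots> \<le> inverse (real (Suc n)) * norm h"
        using yU[OF t, of "r n"] rn[of n] by (intro mult_right_mono order_trans[OF yU[OF t]] le_imp_inverse_le) auto
      finally show "\<bar>y (r n) t \<bullet> h - h \<bullet> \<iota> (U (r n) t) - 0\<bar> \<le> inverse (real (Suc n)) * norm h" by simp
      show "(\<lambda>n. inverse (real (Suc n)) * norm h) \<longlonglongrightarrow> 0"
        using tendsto_mult_right[OF LIMSEQ_inverse_real_of_nat, of "norm h"] by simp
    qed
    from tendsto_diff[OF ylim[OF t, of h] this] show ?thesis by (simp add: inner_commute)
  qed
  have uR: "norm (u t) \<le> R" if t: "t \<in> {0..T}" for t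
  proof (cases "u t = 0")
    case False
    \<comment> \<open>Weak lower semicontinuity of the norm, obtained by testing with the limit
      itself.\<close>
    have "u t \<bullet> \<iota> (U (r n) t) \<le> norm (u t) * R" for n
      using Cauchy_Schwarz_ineq2[of "u t" "\<iota> (U (r n) t)"] mult_left_mono[OF U_R[OF t, of "r n"], of "norm (u t)"] by simp
    then have "u t \<bullet> u t \<le> norm (u t) * R" by (intro LIMSEQ_le_const2[OF Ulim[OF t]]) blast
    then show ?thesis using False by (simp add: power2_norm_eq_inner[symmetric] power2_eq_square)
  qed (simp add: R0)
  obtain C1 where C1: "0 < C1" "\<And>a b. 0 \<le> a \<Longrightarrow> 0 \<le> b \<Longrightarrow> a * b \<le> 1 * a powr q + C1 * b powr p"
    by (rule young_epsilon[OF p zero_less_one]) (rule that)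
  define A where "A = Kq + C1 * T"
  have A0: "0 \<le> A" using Kq0 C1 T by (simp add: A_def)
  have BUA: "\<bar>integral {s..t} (\<lambda>r. B r (U n r) w)\<bar> \<le> norm w * A" if "0 \<le> s" "s \<le> t" "t \<le> T" for n w s t
  proof -
    have "\<bar>integral {s..t} (\<lambda>r. B r (U n r) w)\<bar> \<le> norm w * (1 * Kq + C1 * (t - s))"
      by (rule functional_integral_bound[OF BU Kq C1(2) zero_le_one that])
    also have "\<dots> \<le> norm w * A" using that C1 by (auto simp: A_def intro!: mult_left_mono)
    finally show ?thesis .
  qed
  have BUlim: "(\<lambda>n. integral {s..t} (\<lambda>r'. B r' (U (r n) r') w)) \<longlonglongrightarrow> - ((u t - u s) \<bullet> \<iota> w)"
    if st: "0 \<le> s" "s \<le> t" "t \<le> T" for w s t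
  proof (rule tendsto_by_approximation)
    fix e :: real assume e: "0 < e"
    have stT: "s \<in> {0..T}" "t \<in> {0..T}" using st by auto
    \<comment> \<open>\<open>A\<close> is a Lipschitz constant in \<open>w\<close> of the integrals,
      and 2 R times the norm of \<iota> is one of the limit; the 1 makes \<open>Q\<close> positive.
      With these uniform bounds, convergence for test vectors in some \<open>W m\<close> extends to
      all of \<open>V\<close>.\<close>
    define Q where "Q = A + 2 * R * norm \<iota> + 1"
    have Q: "0 < Q" using A0 R0 by (simp add: Q_def add_nonneg_pos)
    obtain w' where w': "w' \<in> (\<Union>n. W n)" "dist w w' < e / Q"
      using dense_approx[OF W(3), of "e / Q" w] e Q by auto
    then obtain m where m: "w' \<in> W m" by blast
    have small: "norm (w - w') * Q \<le> e" using w'(2) Q by (simp add: dist_norm field_simps)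
    have "(\<lambda>n. integral {s..t} (\<lambda>r'. B r' (U (r n) r') w')) \<longlonglongrightarrow> - ((u t - u s) \<bullet> \<iota> w')"
    proof (rule Lim_transform_eventually)
      show "(\<lambda>n. - ((y (r n) t - y (r n) s) \<bullet> \<iota> w')) \<longlonglongrightarrow> - ((u t - u s) \<bullet> \<iota> w')"
        unfolding inner_diff_left by (intro tendsto_intros ylim stT)
      have "- ((y (r n) t - y (r n) s) \<bullet> \<iota> w') = integral {s..t} (\<lambda>r'. B r' (U (r n) r') w')" if "m \<le> n" for n
        using ydiff[OF _ st, of w' "r n"] m W_mono[of m "r n"] rn[of n] that by auto
      then show "\<forall>\<^sub>F n in sequentially. - ((y (r n) t - y (r n) s) \<bullet> \<iota> w') = integral {s..t} (\<lambda>r'. B r' (U (r n) r') w')"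
        by (auto simp: eventually_sequentially)
    qed
    moreover have "\<bar>integral {s..t} (\<lambda>r'. B r' (U (r n) r') w) - integral {s..t} (\<lambda>r'. B r' (U (r n) r') w')\<bar> \<le> e" for n
    proof -
      have "integral {s..t} (\<lambda>r'. B r' (U (r n) r') w) - integral {s..t} (\<lambda>r'. B r' (U (r n) r') w')
          = integral {s..t} (\<lambda>r'. B r' (U (r n) r') (w - w'))"
        using integral_subinterval(2)[OF BUw st(1,3)]
        by (simp add: blinfun.bilinear_simps Henstock_Kurzweil_Integration.integral_diff)
      then have "\<bar>integral {s..t} (\<lambda>r'. B r' (U (r n) r') w) - integral {s..t} (\<lambda>r'. B r' (U (r n) r') w')\<bar> \<le> norm (w - w') * A"
        using BUA[OF st] by simp
      also have "\<dots> \<le> norm (w - w') * Q" using R0 by (intro mult_left_mono) (auto simp: Q_def)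
      finally show ?thesis using small by simp
    qed
    moreover have "\<bar>- ((u t - u s) \<bullet> \<iota> w) - - ((u t - u s) \<bullet> \<iota> w')\<bar> \<le> e"
    proof -
      have "\<bar>(u t - u s) \<bullet> \<iota> (w - w')\<bar> \<le> norm (u t - u s) * norm (\<iota> (w - w'))" by (rule Cauchy_Schwarz_ineq2)
      also have "\<dots> \<le> (2 * R) * (norm \<iota> * norm (w - w'))"
        using norm_triangle_ineq4[of "u t" "u s"] uR[OF stT(1)] uR[OF stT(2)] R0 by (intro mult_mono norm_blinfun) auto
      also have "\<dots> = norm (w - w') * (2 * R * norm \<iota>)" by simp
      also have "\<dots> \<le> norm (w - w') * Q" using A0 by (intro mult_left_mono) (auto simp: Q_def)
      finally show ?thesis using small by (simp add: blinfun.bilinear_simps inner_diff_right)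
    qed
    ultimately show "\<exists>b l'. b \<longlonglongrightarrow> l' \<and>
        (\<forall>\<^sub>F n in sequentially. \<bar>integral {s..t} (\<lambda>r'. B r' (U (r n) r') w) - b n\<bar> \<le> e) \<and>
        \<bar>- ((u t - u s) \<bullet> \<iota> w) - l'\<bar> \<le> e"
      by (intro exI conjI always_eventually allI)
  qed
  have ucont: "continuous_on {0..T} (\<lambda>t. u t \<bullet> h)" for h
    unfolding continuous_on_iff
  proof (intro ballI allI impI)
    fix t e assume t: "t \<in> {0..T}" and e: "(0::real) < e"
    have "0 < e / (4 * (R + 1))" using e R0 by simp
    then obtain h' where h': "h' \<in> range (blinfun_apply \<iota>)" "dist h h' < e / (4 * (R + 1))"
      by (rule dense_approx[OF dense]) (rule that)
    then obtain w where w: "h' = \<iota> w" by blast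
    obtain d where d: "0 < d"
      "\<And>n s t. 0 \<le> s \<Longrightarrow> s \<le> t \<Longrightarrow> t \<le> T \<Longrightarrow> t - s < d \<Longrightarrow> \<bar>integral {s..t} (\<lambda>r. B r (U n r) w)\<bar> \<le> e / 4"
      using equi[of "e / 4" w] e by auto
    have le: "\<bar>(u b - u a) \<bullet> \<iota> w\<bar> \<le> e / 4" if ab: "0 \<le> a" "a \<le> b" "b \<le> T" "b - a < d" for a b
    proof -
      have "(\<lambda>n. \<bar>integral {a..b} (\<lambda>r'. B r' (U (r n) r') w)\<bar>) \<longlonglongrightarrow> \<bar>- ((u b - u a) \<bullet> \<iota> w)\<bar>"
        by (intro tendsto_intros BUlim ab)
      then have "\<bar>- ((u b - u a) \<bullet> \<iota> w)\<bar> \<le> e / 4" using d(2)[OF ab] by (intro LIMSEQ_le_const2) blast+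
      then show ?thesis by simp
    qed
    have hh: "\<bar>u a \<bullet> h - u a \<bullet> \<iota> w\<bar> \<le> e / 4" if a: "a \<in> {0..T}" for a
    proof -
      have "\<bar>u a \<bullet> (h - \<iota> w)\<bar> \<le> norm (u a) * norm (h - \<iota> w)" by (rule Cauchy_Schwarz_ineq2)
      also have "\<dots> \<le> R * (e / (4 * (R + 1)))" using uR[OF a] h'(2) R0 by (intro mult_mono) (auto simp: w dist_norm)
      also have "\<dots> \<le> e / 4" using R0 e by (simp add: field_simps)
      finally show ?thesis by (simp add: inner_diff_right)
    qed
    have "dist (u s \<bullet> h) (u t \<bullet> h) < e" if s: "s \<in> {0..T}" "dist s t < d" for s
    proof -
      have "\<bar>u s \<bullet> \<iota> w - u t \<bullet> \<iota> w\<bar> \<le> e / 4"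
        using le[of s t] le[of t s] s t by (cases "s \<le> t") (auto simp: dist_real_def inner_diff_left abs_minus_commute)
      then show ?thesis using hh[OF s(1)] hh[OF t] e unfolding dist_real_def by linarith
    qed
    with d(1) show "\<exists>d>0. \<forall>s\<in>{0..T}. dist s t < d \<longrightarrow> dist (u s \<bullet> h) (u t \<bullet> h) < e" by blast
  qed
  have u0: "u 0 = u0"
  proof (rule inner_eq_on_dense[OF DW])
    fix d assume "d \<in> (\<Union>m. \<iota> ` W m)"
    then obtain m w where w: "w \<in> W m" "d = \<iota> w" by blast
    have "y (r n) 0 \<bullet> d = u0 \<bullet> d" if "m \<le> n" for n
      using yeq[OF T0, of w "r n"] w W_mono[of m "r n"] rn[of n] that by auto
    then have "\<forall>\<^sub>F n in sequentially. y (r n) 0 \<bullet> d = u0 \<bullet> d" by (auto simp: eventually_sequentially)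
    then have "(\<lambda>n. y (r n) 0 \<bullet> d) \<longlonglongrightarrow> u0 \<bullet> d" by (rule tendsto_eventually)
    with ylim[OF T0] show "u 0 \<bullet> d = u0 \<bullet> d" by (rule LIMSEQ_unique)
  qed
  have TT: "T \<in> {0..T}" using T by simp
  interpret galerkin_limit T p q \<iota> B c1 k "\<lambda>n. U (r n)" u "\<lambda>n. y (r n) T" "\<lambda>n. inverse (real (Suc (r n)))" R Kp Kq
  proof
    show "(\<lambda>n. inverse (real (Suc (r n)))) \<longlonglongrightarrow> 0"
      using LIMSEQ_subseq_LIMSEQ[OF LIMSEQ_inverse_real_of_nat r] by (simp add: o_def)
    show "(norm (y (r n) T))\<^sup>2 / 2 \<le> (norm (u 0))\<^sup>2 / 2 - integral {0..T} (\<lambda>r'. B r' (U (r n) r') (U (r n) r')) + inverse (real (Suc (r n)))" for n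
      unfolding u0 by (rule energy[OF TT])
  qed (fact sep refl inj pm U U_R Kp BU Kq Ulim ucont uR BUlim ylim[OF TT])+
  show ?thesis
  proof (rule solution)
    fix v assume "v \<in> Lp T p" "AE t in M. \<iota> (v t) = u t" "(\<lambda>t. B t (v t)) \<in> Lp T q"
      "\<And>w s t. 0 \<le> s \<Longrightarrow> s \<le> t \<Longrightarrow> t \<le> T \<Longrightarrow> (u t - u s) \<bullet> \<iota> w = - integral {s..t} (\<lambda>r. B r (v r) w)"
      "continuous_on {0..T} u"
    then show thesis using u0 by (rule that)
  qed
qed

end

text \<open>Along a weakly convergent sequence the pairings with the fixed functional \<xi>
  converge, so they shift upper and lower limits by their limit.\<close>

lemma pseudo_monotone_diff_const:
  assumes A: "pseudo_monotone A"
  shows "pseudo_monotone (\<lambda>x. A x - \<xi>)"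
  unfolding pseudo_monotone_def
proof (intro allI impI, elim conjE)
  fix x l y
  assume w: "weakly_converges x l" and ls: "limsup (\<lambda>n. ereal ((A (x n) - \<xi>) (x n - l))) \<le> 0"
  have lim: "(\<lambda>n. ereal (\<xi> (x n - y))) \<longlonglongrightarrow> ereal (\<xi> (l - y))" for y
  proof -
    have "(\<lambda>n. \<xi> (x n)) \<longlonglongrightarrow> \<xi> l" using w by (simp add: weakly_converges_def)
    then have "(\<lambda>n. \<xi> (x n) - \<xi> y) \<longlonglongrightarrow> \<xi> l - \<xi> y" by (rule tendsto_diff) simp
    then show ?thesis by (simp add: blinfun.bilinear_simps)
  qed
  have "limsup (\<lambda>n. ereal (A (x n) (x n - l))) = limsup (\<lambda>n. ereal (\<xi> (x n - l)) + ereal ((A (x n) - \<xi>) (x n - l)))"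
    by (simp add: blinfun.bilinear_simps)
  also have "\<dots> = ereal (\<xi> (l - l)) + limsup (\<lambda>n. ereal ((A (x n) - \<xi>) (x n - l)))"
    by (rule ereal_limsup_lim_add[OF lim]) simp
  also have "\<dots> \<le> 0" using ls by (simp add: blinfun.bilinear_simps)
  finally have "ereal (A l (l - y)) \<le> liminf (\<lambda>n. ereal (A (x n) (x n - y)))"
    using A w unfolding pseudo_monotone_def by blast
  then have "ereal (- \<xi> (l - y)) + ereal (A l (l - y)) \<le> ereal (- \<xi> (l - y)) + liminf (\<lambda>n. ereal (A (x n) (x n - y)))"
    by (rule add_left_mono)
  also have "\<dots> = liminf (\<lambda>n. ereal (- \<xi> (x n - y)) + ereal (A (x n) (x n - y)))"
    using tendsto_uminus_ereal[OF lim[of y]] by (intro ereal_liminf_lim_add[symmetric]) simp_all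
  finally show "ereal ((A l - \<xi>) (l - y)) \<le> liminf (\<lambda>n. ereal ((A (x n) - \<xi>) (x n - y)))"
    by (simp add: blinfun.bilinear_simps algebra_simps)
qed

section \<open>Generalized derivative and conclusion\<close>

lemma bochner_integral_scaled:
  fixes v :: "real \<Rightarrow> 'b::banach" and \<phi> :: "real \<Rightarrow> real"
  assumes q: "1 \<le> q" and v: "v \<in> Lp T q" and \<phi>: "continuous_on {0..T} \<phi>"
  obtains I where "bochner_integral_is (lebesgue_on {0..T}) (\<lambda>t. \<phi> t *\<^sub>R v t) I"
    "\<And>\<xi> :: 'b \<Rightarrow>\<^sub>L real. \<xi> I = (\<integral>t. \<phi> t * \<xi> (v t) \<partial>lebesgue_on {0..T})"
proof -
  let ?M = "lebesgue_on {0..T}"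
  interpret complete_measure ?M by (rule complete_measure_lebesgue_on) simp
  have \<phi>m: "\<phi> \<in> borel_measurable ?M" by (intro continuous_imp_measurable_on_sets_lebesgue \<phi>) simp
  have m: "bochner_measurable ?M (\<lambda>t. \<phi> t *\<^sub>R v t)" by (rule bochner_measurable_scaleR[OF \<phi>m LpD(1)[OF v]])
  have "bounded (\<phi> ` {0..T})" by (intro compact_imp_bounded compact_continuous_image \<phi> compact_Icc)
  then obtain K where K: "\<forall>x\<in>\<phi> ` {0..T}. norm x \<le> K" unfolding bounded_iff by blast
  have "(\<lambda>t. norm (v t)) \<in> Lp T q"
    using bochner_measurable_norm[OF LpD(1)[OF v]] LpD(2)[OF v] by (simp add: Lp_def bochner_measurable_real)
  then have nv: "integrable ?M (\<lambda>t. norm (v t))" by (rule Lp_real_integrable[OF q])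
  have "integrable ?M (\<lambda>t. norm (\<phi> t *\<^sub>R v t))"
  proof (rule Bochner_Integration.integrable_bound)
    show "integrable ?M (\<lambda>t. K * norm (v t))" using nv by simp
    show "(\<lambda>t. norm (\<phi> t *\<^sub>R v t)) \<in> borel_measurable ?M" by (rule bochner_measurable_norm[OF m])
    show "AE t in ?M. norm (norm (\<phi> t *\<^sub>R v t)) \<le> norm (K * norm (v t))"
    proof (rule AE_I2)
      fix t assume "t \<in> space ?M"
      then have "\<bar>\<phi> t\<bar> \<le> K" using K by simp
      then have "\<bar>\<phi> t\<bar> \<le> \<bar>K\<bar>" by linarith
      then show "norm (norm (\<phi> t *\<^sub>R v t)) \<le> norm (K * norm (v t))" by (simp add: abs_mult mult_right_mono)
    qed
  qed
  from bochner_integral_exists[OF m this] obtain I where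
    "bochner_integral_is ?M (\<lambda>t. \<phi> t *\<^sub>R v t) I" "\<And>\<xi> :: 'b \<Rightarrow>\<^sub>L real. \<xi> I = (\<integral>t. \<xi> (\<phi> t *\<^sub>R v t) \<partial>?M)" by blast
  then show ?thesis by (intro that) (simp_all add: blinfun.bilinear_simps)
qed

text \<open>Tested with a fixed \<open>w\<close>, the claim is the scalar product rule for \<phi>
  times the pairing of \<open>u\<close> with \<iota> w; the boundary terms vanish because \<phi> is
  0 at both ends.\<close>

lemma generalized_derivativeI:
  fixes \<iota> :: "'v::banach \<Rightarrow>\<^sub>L 'h::{real_inner, complete_space}"
  assumes T: "0 < T" and p: "1 < p" "1 / p + 1 / q = 1" and v: "v \<in> Lp T p" and g: "g \<in> Lp T q"
    and uv: "AE t in lebesgue_on {0..T}. \<iota> (v t) = u t"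
    and u: "\<And>w t. t \<in> {0..T} \<Longrightarrow> (u t - u 0) \<bullet> \<iota> w = integral {0..t} (\<lambda>r. blinfun_apply (g r) w)"
  shows "has_generalized_derivative (gelfand_embedding \<iota>) T v g"
  unfolding has_generalized_derivative_def
proof
  let ?M = "lebesgue_on {0..T}"
  interpret complete_measure ?M by (rule complete_measure_lebesgue_on) simp
  fix \<phi> assume \<phi>: "\<phi> \<in> test_functions T"
  have d: "((deriv ^^ n) \<phi>) differentiable (at t)" for n t using \<phi> by (simp add: test_functions_def)
  have d0: "\<phi> differentiable (at t)" and d1: "deriv \<phi> differentiable (at t)" for t
    using d[of 0 t] d[of 1 t] by simp_all
  have c0: "continuous_on S \<phi>" and c1: "continuous_on S (deriv \<phi>)" for S
    using d0 d1 by (auto intro!: continuous_at_imp_continuous_on differentiable_imp_continuous_within)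
  have ends: "\<phi> 0 = 0" "\<phi> T = 0"
  proof -
    have "closure {t. \<phi> t \<noteq> 0} \<subseteq> {0<..<T}" using \<phi> by (simp add: test_functions_def)
    then have "{t. \<phi> t \<noteq> 0} \<subseteq> {0<..<T}" by (rule order_trans[OF closure_subset])
    then show "\<phi> 0 = 0" "\<phi> T = 0" by auto
  qed
  have FTC: "\<phi> t = 0 + integral {0..t} (deriv \<phi>)" if "t \<in> {0..T}" for t
  proof -
    have "(deriv \<phi> has_integral \<phi> t - \<phi> 0) {0..t}"
    proof (rule fundamental_theorem_of_calculus)
      show "(\<phi> has_vector_derivative deriv \<phi> x) (at x within {0..t})" for x
        using d0[of x] by (simp add: DERIV_deriv_iff_real_differentiable[symmetric] has_real_derivative_iff_has_vector_derivative[symmetric] has_field_derivative_at_within)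
    qed (use that in simp)
    then show ?thesis using ends by (simp add: has_integral_iff)
  qed
  have q1: "1 \<le> q" using conjugate_exponent[OF p] by simp
  obtain I where I: "bochner_integral_is ?M (\<lambda>t. deriv \<phi> t *\<^sub>R v t) I"
    "\<And>\<xi> :: 'v \<Rightarrow>\<^sub>L real. \<xi> I = (\<integral>t. deriv \<phi> t * \<xi> (v t) \<partial>?M)"
    by (rule bochner_integral_scaled[OF less_imp_le[OF p(1)] v c1]) (rule that)
  obtain J where J: "bochner_integral_is ?M (\<lambda>t. \<phi> t *\<^sub>R g t) J"
    "\<And>\<xi> :: ('v \<Rightarrow>\<^sub>L real) \<Rightarrow>\<^sub>L real. \<xi> J = (\<integral>t. \<phi> t * \<xi> (g t) \<partial>?M)"
    by (rule bochner_integral_scaled[OF q1 g c0]) (rule that)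
  have "gelfand_embedding \<iota> I = - J"
  proof (rule blinfun_eqI)
    fix w
    have bl: "bounded_linear (\<lambda>\<xi> :: 'v \<Rightarrow>\<^sub>L real. \<xi> w)" by (rule blinfun.bounded_linear_left)
    \<comment> \<open>Evaluation at \<open>w\<close> is a functional on the dual of
      \<open>V\<close>, and functionals commute with the Bochner integral.\<close>
    have Jw: "J w = (\<integral>t. \<phi> t * g t w \<partial>?M)"
      using J(2)[of "Blinfun (\<lambda>\<xi>. blinfun_apply \<xi> w)"] by (simp add: bounded_linear_Blinfun_apply[OF bl])
    have gw: "integrable ?M (\<lambda>t. g t w)" by (rule pairing_integrable[OF p g Lp_const])
    have dphi: "integrable ?M (deriv \<phi>)" by (intro continuous_imp_integrable_real c1)
    define G where "G t = u t \<bullet> \<iota> w" for t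
    have G: "G t = u 0 \<bullet> \<iota> w + integral {0..t} (\<lambda>r. g r w)" if "t \<in> {0..T}" for t
      using u[OF that, of w] by (simp add: G_def inner_diff_left)
    have TT: "T \<in> {0..T}" using T by simp
    have prod: "integrable ?M (\<lambda>r. deriv \<phi> r * G r + \<phi> r * g r w)"
      "\<phi> T * G T = 0 * (u 0 \<bullet> \<iota> w) + integral {0..T} (\<lambda>r. deriv \<phi> r * G r + \<phi> r * g r w)"
      by (rule product_rule_integral[OF dphi gw FTC G TT]; assumption)+
    have uw: "continuous_on {0..T} G"
    proof -
      have "continuous_on {0..T} (\<lambda>t. u 0 \<bullet> \<iota> w + integral {0..t} (\<lambda>r. g r w))"
        by (intro continuous_intros indefinite_integral_continuous_1 integral_subinterval(2)[OF gw]) auto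
      then show ?thesis by (rule continuous_on_eq) (simp add: G)
    qed
    have i1: "integrable ?M (\<lambda>r. deriv \<phi> r * G r)" by (rule integrable_mult_continuous[OF dphi uw])
    have i2: "integrable ?M (\<lambda>r. \<phi> r * g r w)"
      using integrable_mult_continuous[OF gw c0] by (simp add: mult.commute)
    have "0 = (\<integral>r. deriv \<phi> r * G r + \<phi> r * g r w \<partial>?M)"
      using prod(2) ends integral_full_interval[OF prod(1)] by simp
    also have "\<dots> = (\<integral>r. deriv \<phi> r * G r \<partial>?M) + J w" using i1 i2 by (simp add: Jw)
    also have "(\<integral>r. deriv \<phi> r * G r \<partial>?M) = (\<integral>r. deriv \<phi> r * (\<iota> w \<bullet> \<iota> (v r)) \<partial>?M)"
    proof (rule integral_cong_AE)
      show "(\<lambda>r. deriv \<phi> r * G r) \<in> borel_measurable ?M" using i1 by simp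
      have "(\<lambda>r. \<iota> w \<bullet> \<iota> (v r)) \<in> borel_measurable ?M"
        using bochner_measurable_blinfun_apply[OF LpD(1)[OF v], of "adjoint_embedding \<iota> (\<iota> w)"]
        by (simp add: bochner_measurable_real)
      then show "(\<lambda>r. deriv \<phi> r * (\<iota> w \<bullet> \<iota> (v r))) \<in> borel_measurable ?M" using dphi by measurable
      show "AE r in ?M. deriv \<phi> r * G r = deriv \<phi> r * (\<iota> w \<bullet> \<iota> (v r))"
        using uv by eventually_elim (simp add: G_def inner_commute)
    qed
    also have "\<dots> = \<iota> I \<bullet> \<iota> w" using I(2)[of "adjoint_embedding \<iota> (\<iota> w)"] by (simp add: inner_commute)
    finally show "gelfand_embedding \<iota> I w = (- J) w" by (simp add: blinfun.bilinear_simps)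
  qed
  with I(1) J(1) show "\<exists>I J. bochner_integral_is ?M (\<lambda>t. deriv \<phi> t *\<^sub>R v t) I \<and>
      bochner_integral_is ?M (\<lambda>t. \<phi> t *\<^sub>R g t) J \<and> gelfand_embedding \<iota> I = - J" by blast
qed

theorem theorem3p3:
  fixes T p p' :: real
    and \<iota> :: "'v::banach \<Rightarrow>\<^sub>L 'h::{real_inner, complete_space}"
    and j :: "'z::banach \<Rightarrow>\<^sub>L 'v"
    and Vn :: "nat \<Rightarrow> 'z set"
    and P :: "nat \<Rightarrow> 'h \<Rightarrow>\<^sub>L 'h"
    and A :: "real \<Rightarrow> 'v \<Rightarrow> ('v \<Rightarrow>\<^sub>L real)"
    and u0 :: 'h
    and f :: "real \<Rightarrow> ('v \<Rightarrow>\<^sub>L real)"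
  assumes T: "0 < T"
    and p: "1 < p" "1 / p + 1 / p' = 1"
    and V: "separable_space (euclidean :: 'v topology)" "reflexive_space TYPE('v)"
    and gelfand: "dense_embedding \<iota>"
    and Z: "separable_space (euclidean :: 'z topology)" "reflexive_space TYPE('z)"
      "dense_embedding j"
    and Vn_fin: "\<And>n. finite_dim_subspace (Vn n)"
    and Vn_incr: "\<And>n. Vn n \<subseteq> Vn (Suc n)"
    and Vn_dense: "closure (\<Union>n. blinfun_apply j ` Vn n) = UNIV"
    and P_proj: "\<And>n. self_adjoint_projection (P n)"
    and P_range: "\<And>n. blinfun_apply (P n) ` range (blinfun_apply \<iota>)
                        = blinfun_apply \<iota> ` blinfun_apply j ` Vn n"
    and P_bound: "\<exists>c. \<forall>n. \<exists>R :: 'z \<Rightarrow>\<^sub>L 'z.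
        (\<forall>z. blinfun_apply \<iota> (blinfun_apply j (blinfun_apply R z))
               = blinfun_apply (P n) (blinfun_apply \<iota> (blinfun_apply j z))) \<and>
        norm R \<le> c"
    and A1: "AE t in lebesgue_on {0..T}. pseudo_monotone (A t)"
    and A2: "\<And>u. u \<in> Lp T p \<Longrightarrow> (\<lambda>t. blinfun_apply \<iota> (u t)) \<in> Linf T \<Longrightarrow>
        bochner_measurable (lebesgue_on {0..T}) (\<lambda>t. A t (u t))"
    and A3: "\<exists>c1 C2. c1 > 0 \<and> C2 \<in> Lp T 1 \<and>
        (AE t in lebesgue_on {0..T}. (0::real) \<le> C2 t) \<and>
        (AE t in lebesgue_on {0..T}. \<forall>x.
           blinfun_apply (A t x) x \<ge> c1 * norm x powr p - C2 t)"
    and A4: "\<exists>q c3 c4 C5. 0 \<le> q \<and> c3 > 0 \<and> c4 \<ge> 0 \<and> C5 \<in> Lp T p' \<and>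
        (AE t in lebesgue_on {0..T}. (0::real) \<le> C5 t) \<and>
        (AE t in lebesgue_on {0..T}. \<forall>x.
           norm (A t x) \<le> c3 * norm x powr (p - 1)
             + c4 * norm (blinfun_apply \<iota> x) powr q * norm x powr (p - 1) + C5 t)"
    and f: "f \<in> Lp T p'"
  shows "\<exists>u \<in> W1p \<iota> T p p'.
      (\<exists>g \<in> Lp T p'. has_generalized_derivative (gelfand_embedding \<iota>) T u g \<and>
         (AE t in lebesgue_on {0..T}. g t + A t (u t) = f t)) \<and>
      (\<exists>w. continuous_representative T (\<lambda>t. blinfun_apply \<iota> (u t)) w \<and> w 0 = u0)"
  proof -
  let ?M = "lebesgue_on {0..T}"
  interpret complete_measure ?M by (rule complete_measure_lebesgue_on) simp
  have p0: "0 < p" using p by simp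
  have q0: "0 < p'" using conjugate_exponent[OF p] by simp
  have inj: "inj (blinfun_apply \<iota>)" using gelfand by (simp add: dense_embedding_def)
  obtain c1 C2 where c1: "0 < c1" and C2: "C2 \<in> Lp T 1"
    and co: "AE t in ?M. \<forall>x. blinfun_apply (A t x) x \<ge> c1 * norm x powr p - C2 t" using A3 by blast
  obtain r c3 c4 C5 where r: "0 \<le> r" and c3: "0 < c3" and c4: "0 \<le> c4" and C5: "C5 \<in> Lp T p'"
    and gr: "AE t in ?M. \<forall>x. norm (A t x) \<le> c3 * norm x powr (p - 1)
             + c4 * norm (blinfun_apply \<iota> x) powr r * norm x powr (p - 1) + C5 t" using A4 by blast
  have c1': "0 < c1 / 2" using c1 by simp
  have p': "1 < p'" "1 / p' + 1 / p = 1" using conjugate_exponent(1)[OF p] p(2) by simp_all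
  \<comment> \<open>Half of the coercivity constant pays for the pairing with \<open>f\<close>; the
    remainder, \<open>C\<close> times the p'-th power of its norm, goes into
    \<open>k\<close>.\<close>
  obtain C where C: "0 < C" "\<And>a b. 0 \<le> a \<Longrightarrow> 0 \<le> b \<Longrightarrow> a * b \<le> c1 / 2 * a powr p + C * b powr p'"
    by (rule young_epsilon[OF p' c1']) (rule that)
  define B where "B t x = A t x - f t" for t x
  define k where "k t = C2 t + C * norm (f t) powr p'" for t
  interpret evolution T p p' \<iota> B "c1 / 2" k
  proof
    fix u :: "real \<Rightarrow> 'v" assume "u \<in> Lp T p" "(\<lambda>t. \<iota> (u t)) \<in> Linf T"
    then show "bochner_measurable ?M (\<lambda>t. B t (u t))"
      unfolding B_def by (rule bochner_measurable_diff[OF A2 LpD(1)[OF f]])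
  next
    show "integrable ?M k" unfolding k_def using C2 LpD(2)[OF f] by (simp add: Lp_1_real_iff)
    show "AE t in ?M. \<forall>x. c1 / 2 * norm x powr p - k t \<le> B t x x"
      using co
    proof (eventually_elim, intro allI)
      fix t x assume "\<forall>x. blinfun_apply (A t x) x \<ge> c1 * norm x powr p - C2 t"
      then have "c1 * norm x powr p - C2 t \<le> A t x x" by blast
      moreover have "f t x \<le> norm x * norm (f t)" using norm_blinfun[of "f t" x] by (simp add: mult.commute)
      moreover have "norm x * norm (f t) \<le> c1 / 2 * norm x powr p + C * norm (f t) powr p'" by (rule C(2)) auto
      moreover have "c1 * norm x powr p = c1 / 2 * norm x powr p + c1 / 2 * norm x powr p" by simp
      ultimately show "c1 / 2 * norm x powr p - k t \<le> B t x x"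
        unfolding B_def k_def minus_blinfun.rep_eq by linarith
    qed
    fix R :: real
    have "(\<lambda>t. norm (f t)) \<in> Lp T p'"
      using bochner_measurable_norm[OF LpD(1)[OF f]] LpD(2)[OF f] by (simp add: Lp_def bochner_measurable_real)
    from Lp_diff[OF q0 C5 Lp_uminus[OF this]] have b: "(\<lambda>t. C5 t + norm (f t)) \<in> Lp T p'" by simp
    \<comment> \<open>\<open>R\<close> is arbitrary here, so its absolute value is used as the base
      of the power.\<close>
    have "AE t in ?M. \<forall>x. norm (\<iota> x) \<le> R \<longrightarrow>
        norm (B t x) \<le> (c3 + c4 * \<bar>R\<bar> powr r) * norm x powr (p - 1) + (C5 t + norm (f t))"
      using gr
    proof (eventually_elim, intro allI impI)
      fix t x
      assume g: "\<forall>x. norm (A t x) \<le> c3 * norm x powr (p - 1)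
             + c4 * norm (blinfun_apply \<iota> x) powr r * norm x powr (p - 1) + C5 t" and x: "norm (\<iota> x) \<le> R"
      have "norm (B t x) \<le> norm (A t x) + norm (f t)" unfolding B_def by (rule norm_triangle_ineq4)
      moreover have "norm (A t x) \<le> c3 * norm x powr (p - 1)
             + c4 * norm (blinfun_apply \<iota> x) powr r * norm x powr (p - 1) + C5 t" using g by blast
      moreover have "c4 * norm (\<iota> x) powr r * norm x powr (p - 1) \<le> c4 * \<bar>R\<bar> powr r * norm x powr (p - 1)"
        using x c4 r by (intro mult_right_mono mult_left_mono powr_mono2) auto
      ultimately show "norm (B t x) \<le> (c3 + c4 * \<bar>R\<bar> powr r) * norm x powr (p - 1) + (C5 t + norm (f t))"
        unfolding distrib_right by linarith
    qed
    moreover have "0 \<le> c3 + c4 * \<bar>R\<bar> powr r" using c3 c4 by simp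
    ultimately show "\<exists>a b. 0 \<le> a \<and> b \<in> Lp T p' \<and>
        (AE t in ?M. \<forall>x. norm (\<iota> x) \<le> R \<longrightarrow> norm (B t x) \<le> a * norm x powr (p - 1) + b t)"
      using b by (intro exI conjI)
  qed (fact T p c1')+
  have pm: "AE t in ?M. pseudo_monotone (B t)"
    using A1 unfolding B_def[abs_def] by eventually_elim (rule pseudo_monotone_diff_const)
  have W: "\<exists>F. finite F \<and> j ` Vn n = span F" for n
  proof -
    obtain F where F: "finite F" "Vn n = span F" using Vn_fin[of n] by (auto simp: finite_dim_subspace_def)
    have "j ` span F = span (j ` F)"
      by (rule linear_span_image[symmetric]) (simp add: blinfun.bounded_linear_right bounded_linear.linear)
    then show ?thesis using F by (intro exI[of _ "j ` F"]) simp
  qed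
  obtain v u where v: "v \<in> Lp T p" and uv: "AE t in ?M. \<iota> (v t) = u t" and Bv: "(\<lambda>t. B t (v t)) \<in> Lp T p'"
    and eq: "\<And>w s t. 0 \<le> s \<Longrightarrow> s \<le> t \<Longrightarrow> t \<le> T \<Longrightarrow> (u t - u s) \<bullet> \<iota> w = - integral {s..t} (\<lambda>r. B r (v r) w)"
    and uc: "continuous_on {0..T} u" "u 0 = u0"
    by (rule existence[OF V gelfand pm W image_mono[OF Vn_incr] Vn_dense, of u0]) (rule that)
  \<comment> \<open>The derivative is taken to be - B t (v t) = f t - A t (v t), so the equation
    holds by construction; the content lies in its being the generalized derivative of
    \<open>v\<close>.\<close>
  have g: "(\<lambda>t. - B t (v t)) \<in> Lp T p'" by (rule Lp_uminus[OF Bv])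
  have der: "has_generalized_derivative (gelfand_embedding \<iota>) T v (\<lambda>t. - B t (v t))"
    by (rule generalized_derivativeI[OF T p v g uv]) (use eq in \<open>simp add: blinfun.bilinear_simps\<close>)
  have sol: "AE t in ?M. - B t (v t) + A t (v t) = f t" by (simp add: B_def)
  have rep: "continuous_representative T (\<lambda>t. \<iota> (v t)) u"
    unfolding continuous_representative_def using uc(1) uv by (auto elim: eventually_mono)
  have "v \<in> W1p \<iota> T p p'" unfolding W1p_def using v g der by blast
  then show ?thesis using g der sol rep uc(2) by (intro bexI[of _ v] conjI bexI[of _ "\<lambda>t. - B t (v t)"] exI[of _ u])
qed

end
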